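(* Let $V$ be a connected complex Fano manifold of dimension $n$, with notation as in the context. The semi-simple associativity condition on a function $$F=\frac16\int_V x^{\cup 3}+f$$ for $f$ which is - independent of $x_0$ up to adding a polynomial of degree two, at most quadratic in $x_0$ and at most linear in other variables, - homogeneous of weight $(3-n)$ up to adding a polynomial of degree one, is locally equivalent to the following problem for a symmetric $\sigma\times\sigma$ matrix $y=(y_{ab}=y_{ba})_{a,b=1}^{\sigma}$ of functions of $(x_1,\dots,x_\sigma)$: the Pfaff system $$dy_{ab}=\sum_{c=1}^{\sigma} r_{abc}(x,y)\,dx_c$$ together with the algebraic constraint $$\sum_{c=1}^{\sigma}\bigl(c_c+(1-p_c)x_c\bigr)\,r_{abc}(x,y)=n\sum_{c=1}^{\sigma}g_{abc}x_c+(1-n+p_a+p_b)\,y_{ab},$$ where the $r_{abc}(x,y)$ are the functions defined in the context, rational in $x=(x_a)_{a=1}^{\sigma}$ and $y$ and fully symmetric in the indices $a,b,c$. The correspondence is given locally by $y_{ab}=\frac{\partial^2 f}{\partial x_a\partial x_b}$ for $a,b\in\{1,\dots,\sigma\}$.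
   Context: Setting. $H(V)=\bigoplus_{p=0}^{n}H^{p,p}(V)$ with cup product. $(h_0,\dots,h_\sigma)$ is a basis of $H(V)$, $h_\alpha\in H^{p_\alpha,p_\alpha}(V)$, of classes Poincaré dual to integral cycles in general position, with $h_0=1$, $h_1,\dots,h_\rho$ classes of integral effective divisors generating $\mathrm{Pic}(V)\cong H^{1,1}(V)\cap H^2(V,\mathbb Z)$ and spanning $H^{1,1}(V)$, and $h_\sigma$ the class of a point. Greek indices run through $0,\dots,\sigma$, Latin indices $a,b,c$ through $1,\dots,\sigma$. Put $$g_{\alpha\beta}=\int_V h_\alpha\cup h_\beta,\quad (\bar g_{\alpha\beta})=(g_{\alpha\beta})^{-1},\quad g_{\alpha\beta\gamma}=\int_V h_\alpha\cup h_\beta\cup h_\gamma,$$ $$c_1(V)=\sum_\alpha c_\alpha h_\alpha,\quad c_{\alpha\beta}=\int_V c_1(V)\cup h_\alpha\cup h_\beta=\sum_\gamma g_{\alpha\beta\gamma}c_\gamma .$$ The coordinates $(x_0,\dots,x_\sigma)$ on $H(V)$ are dual to the basis, so that the variable point is $x=\sum_\alpha x_\alpha h_\alpha$. Homogeneity. The Euler field is $E=\sum_\alpha(c_\alpha+(1-p_\alpha)x_\alpha)\frac{\partial}{\partial x_\alpha}$. A function $f$ is homogeneous of weight $3-n$ if $E(f)=(3-n)f$; it is so up to adding a polynomial of degree one if all second partial derivatives of $E(f)-(3-n)f$ vanish. Semi-simple associativity. The multiplication of tangent vectors defined by $F$ is $$\frac{\partial}{\partial x_\alpha}\cdot\frac{\partial}{\partial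 x_\beta}=\sum_{\gamma,\delta}\bar g_{\gamma\delta}\frac{\partial^3F}{\partial x_\alpha\partial x_\beta\partial x_\delta}\frac{\partial}{\partial x_\gamma}.$$ The associativity condition is the requirement that this commutative multiplication, with unit $\partial/\partial x_0$, be associative (a system of quadratic equations on the third partial derivatives of $F$); it is semi-simple if the resulting algebra of tangent vectors is semi-simple. The functions $R_{\alpha\beta\gamma}$. For a symmetric $(\sigma+1)\times(\sigma+1)$ matrix $Y=(Y_{\alpha\beta})$ let the vectors $(z_{i0},\dots,z_{i\sigma})^{\intercal}$, $i=0,\dots,\sigma$, be solutions to the eigen-problem with simple eigenvalues $a_0,\dots,a_\sigma$ $$\sum_{\beta,\gamma}\bar g_{\beta\gamma}\bigl(c_{\alpha\beta}+(1-n+p_\alpha+p_\beta)Y_{\alpha\beta}\bigr)z_{i\gamma}=a_iz_{i\alpha}.$$ Then $$R_{\alpha\beta\gamma}(Y)=\sum_{i}\frac{z_{i\alpha}z_{i\beta}z_{i\gamma}}{\sum_{\delta,\epsilon}\bar g_{\delta\epsilon}z_{i\delta}z_{i\epsilon}z_{i0}}$$ is a rational function of $Y$. The functions $r_{abc}$. They are $r_{abc}=R_{abc}(Y)-g_{abc}$, where $Y_{ab}=y_{ab}+\int_V x\cup h_a\cup h_b$ and $Y_{0\beta}=Y_{\beta0}=\int_V x\cup h_\beta$; the result does not depend on $x_0$.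
   Formalization: The algebraic constraint is stated without the summand n∑g_abc x_c, which homogeneity of f rules out: for n≥3 (e.g. P³) the printed constraint has no solutions although semi-simple F exist; for n≤2 the summand vanishes. *)

theory Defs
  imports "HOL-Analysis.Analysis"
begin

section \<open>The cohomology ring of a Fano manifold\<close>

text \<open>
  The type \<open>'h\<close> is the ring \<open>H(V)\<close>, the direct sum of the groups \<open>H\<^sup>p\<^sup>,\<^sup>p(V)\<close>, with cup product as
  its multiplication and \<open>scl\<close> as its complex scalar multiplication. Latin indices are the elements
  of the finite type \<open>'a\<close>; Greek indices are the elements of \<open>'a option\<close>, where \<open>None\<close> is the index
  \<open>0\<close> and \<open>Some a\<close> is the Latin index \<open>a\<close>. Thus \<open>\<sigma> = CARD('a)\<close>, and \<open>1, \<dots>, \<rho>\<close> are the indices of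
  degree one.
\<close>

record ('h, 'a) fano_data =
  scl :: "complex \<Rightarrow> 'h \<Rightarrow> 'h"
  dimV :: nat
  Hodge :: "nat \<Rightarrow> 'h set"          \<comment> \<open>\<open>Hodge p\<close> is \<open>H\<^sup>p\<^sup>,\<^sup>p(V)\<close>\<close>
  intg :: "'h \<Rightarrow> complex"           \<comment> \<open>integration over \<open>V\<close>\<close>
  lattice :: "'h set"               \<comment> \<open>the integral classes in \<open>H(V)\<close>\<close>
  effective :: "nat \<Rightarrow> 'h set"      \<comment> \<open>classes of nonzero effective integral cycles, by codimension\<close>
  chern1 :: 'h                      \<comment> \<open>\<open>c\<^sub>1(V)\<close>\<close>
  cls :: "'a option \<Rightarrow> 'h"          \<comment> \<open>the basis \<open>h\<^sub>\<alpha>\<close>\<close>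
  deg :: "'a option \<Rightarrow> nat"         \<comment> \<open>\<open>p\<^sub>\<alpha>\<close>\<close>
  pnt :: 'a                         \<comment> \<open>the index \<open>\<sigma>\<close>\<close>

definition graded_algebra :: "('h::comm_ring_1, 'a::finite) fano_data \<Rightarrow> bool" where
  "graded_algebra D \<longleftrightarrow>
     vector_space (scl D) \<and>
     (\<forall>t u v. scl D t (u * v) = scl D t u * v) \<and>
     (\<forall>p. module.subspace (scl D) (Hodge D p)) \<and>
     (\<forall>u. \<exists>!v. (\<forall>p. v p \<in> Hodge D p) \<and> (\<forall>p>dimV D. v p = 0) \<and> u = (\<Sum>p\<le>dimV D. v p)) \<and>
     (\<forall>p>dimV D. Hodge D p = {0}) \<and>
     (\<forall>p q u v. u \<in> Hodge D p \<and> v \<in> Hodge D q \<longrightarrow> u * v \<in> Hodge D (p + q))"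

text \<open>The last clause is Poincare duality on \<open>H(V)\<close>; connectedness of \<open>V\<close> is the clause on
  \<open>Hodge D 0\<close>.\<close>

definition poincare_duality :: "('h::comm_ring_1, 'a::finite) fano_data \<Rightarrow> bool" where
  "poincare_duality D \<longleftrightarrow>
     Hodge D 0 = range (\<lambda>t. scl D t 1) \<and>
     Vector_Spaces.linear (scl D) (*) (intg D) \<and>
     (\<forall>p u. p \<noteq> dimV D \<and> u \<in> Hodge D p \<longrightarrow> intg D u = 0) \<and>
     (\<forall>u. (\<forall>v. intg D (u * v) = 0) \<longrightarrow> u = 0)"

definition integral_structure :: "('h::comm_ring_1, 'a::finite) fano_data \<Rightarrow> bool" where
  "integral_structure D \<longleftrightarrow>
     1 \<in> lattice D \<and>
     (\<forall>u\<in>lattice D. \<forall>v\<in>lattice D. u - v \<in> lattice D \<and> u * v \<in> lattice D) \<and>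
     (\<forall>u\<in>lattice D. intg D u \<in> \<int>) \<and>
     (\<forall>q. effective D q \<subseteq> Hodge D q \<inter> lattice D) \<and>
     (\<forall>q. \<forall>u\<in>effective D q. \<forall>v\<in>effective D q. u + v \<in> effective D q) \<and>
     1 \<in> effective D 0"

text \<open>Ampleness of \<open>c\<^sub>1(V)\<close> is recorded through the positivity of its intersection numbers with
  effective cycles of every codimension (Nakai--Moishezon).\<close>

definition ample_chern1 :: "('h::comm_ring_1, 'a::finite) fano_data \<Rightarrow> bool" where
  "ample_chern1 D \<longleftrightarrow>
     chern1 D \<in> Hodge D 1 \<inter> lattice D \<and>
     (\<forall>q\<le>dimV D. \<forall>u\<in>effective D q. \<exists>r::real. r > 0 \<and> intg D (chern1 D ^ (dimV D - q) * u) = of_real r)"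

definition adapted_basis :: "('h::comm_ring_1, 'a::finite) fano_data \<Rightarrow> bool" where
  "adapted_basis D \<longleftrightarrow>
     inj (cls D) \<and> \<not> module.dependent (scl D) (range (cls D)) \<and>
     module.span (scl D) (range (cls D)) = UNIV \<and>
     (\<forall>\<alpha>. cls D \<alpha> \<in> Hodge D (deg D \<alpha>) \<inter> lattice D) \<and>
     cls D None = 1 \<and> deg D None = 0 \<and>
     (\<forall>a. deg D (Some a) = 1 \<longrightarrow> cls D (Some a) \<in> effective D 1) \<and>
     Hodge D 1 = module.span (scl D) {cls D (Some a) | a. deg D (Some a) = 1} \<and>
     Hodge D 1 \<inter> lattice D =
       range (\<lambda>m::'a \<Rightarrow> int. \<Sum>a | deg D (Some a) = 1. of_int (m a) * cls D (Some a)) \<and>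
     deg D (Some (pnt D)) = dimV D \<and> cls D (Some (pnt D)) \<in> effective D (dimV D) \<and>
     intg D (cls D (Some (pnt D))) = 1"

definition fano :: "('h::comm_ring_1, 'a::finite) fano_data \<Rightarrow> bool" where
  "fano D \<longleftrightarrow> graded_algebra D \<and> poincare_duality D \<and> integral_structure D \<and>
     ample_chern1 D \<and> adapted_basis D"

definition g2 :: "('h::comm_ring_1, 'a::finite) fano_data \<Rightarrow> 'a option \<Rightarrow> 'a option \<Rightarrow> complex" where
  "g2 D \<alpha> \<beta> = intg D (cls D \<alpha> * cls D \<beta>)"

definition gbar :: "('h::comm_ring_1, 'a::finite) fano_data \<Rightarrow> 'a option \<Rightarrow> 'a option \<Rightarrow> complex" where
  "gbar D \<alpha> \<beta> = matrix_inv (\<chi> \<gamma> \<delta>. g2 D \<gamma> \<delta>) $ \<alpha> $ \<beta>"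

definition g3 :: "('h::comm_ring_1, 'a::finite) fano_data \<Rightarrow>
    'a option \<Rightarrow> 'a option \<Rightarrow> 'a option \<Rightarrow> complex" where
  "g3 D \<alpha> \<beta> \<gamma> = intg D (cls D \<alpha> * cls D \<beta> * cls D \<gamma>)"

definition c_coord :: "('h::comm_ring_1, 'a::finite) fano_data \<Rightarrow> 'a option \<Rightarrow> complex" where
  "c_coord D \<alpha> = module.representation (scl D) (range (cls D)) (chern1 D) (cls D \<alpha>)"

definition c2 :: "('h::comm_ring_1, 'a::finite) fano_data \<Rightarrow> 'a option \<Rightarrow> 'a option \<Rightarrow> complex" where
  "c2 D \<alpha> \<beta> = intg D (chern1 D * cls D \<alpha> * cls D \<beta>)"

definition point_of :: "('h::comm_ring_1, 'a::finite) fano_data \<Rightarrow> complex^('a option) \<Rightarrow> 'h" where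
  "point_of D x = (\<Sum>\<alpha>\<in>UNIV. scl D (x $ \<alpha>) (cls D \<alpha>))"


section \<open>Holomorphic functions of several variables\<close>

definition holo_on :: "(complex^'i::finite \<Rightarrow> complex) \<Rightarrow> (complex^'i) set \<Rightarrow> bool" where
  "holo_on f U \<longleftrightarrow> (\<forall>x\<in>U. \<exists>A::complex^'i. (f has_derivative (\<lambda>v. \<Sum>i\<in>UNIV. A $ i * v $ i)) (at x))"

definition pd :: "'i \<Rightarrow> (complex^'i::finite \<Rightarrow> complex) \<Rightarrow> complex^'i \<Rightarrow> complex" where
  "pd i f x = deriv (\<lambda>t. f (x + t *s axis i 1)) 0"

text \<open>Forgetting \<open>x\<^sub>0\<close>, and the section \<open>x\<^sub>0 = 0\<close> of this projection.\<close>

definition drop0 :: "complex^('a::finite option) \<Rightarrow> complex^'a" where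
  "drop0 x = (\<chi> a. x $ Some a)"

definition insert0 :: "complex^'a \<Rightarrow> complex^('a::finite option)" where
  "insert0 w = (\<chi> \<alpha>. case \<alpha> of None \<Rightarrow> 0 | Some a \<Rightarrow> w $ a)"

definition hess :: "(complex^('a::finite option) \<Rightarrow> complex) \<Rightarrow> complex^('a option) \<Rightarrow> complex^'a^'a" where
  "hess f x = (\<chi> a b. pd (Some a) (pd (Some b) f) x)"


section \<open>The potential\<close>

definition x0_quadratic :: "(complex^('a::finite option) \<Rightarrow> complex) \<Rightarrow> bool" where
  "x0_quadratic P \<longleftrightarrow> (\<exists>q m e. \<exists>l k :: complex^'a. \<forall>x.
     P x = q * (x $ None)\<^sup>2 + x $ None * (\<Sum>a\<in>UNIV. l $ a * x $ Some a)
           + m * x $ None + (\<Sum>a\<in>UNIV. k $ a * x $ Some a) + e)"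

definition indep_x0_mod_quadratic ::
    "(complex^('a::finite option)) set \<Rightarrow> (complex^('a option) \<Rightarrow> complex) \<Rightarrow> bool" where
  "indep_x0_mod_quadratic U f \<longleftrightarrow>
     (\<exists>\<phi> P. x0_quadratic P \<and> (\<forall>x\<in>U. f x = \<phi> (drop0 x) + P x))"

definition euler_coeff :: "('h::comm_ring_1, 'a::finite) fano_data \<Rightarrow>
    complex^('a option) \<Rightarrow> 'a option \<Rightarrow> complex" where
  "euler_coeff D x \<alpha> = c_coord D \<alpha> + (1 - of_nat (deg D \<alpha>)) * x $ \<alpha>"

definition euler :: "('h::comm_ring_1, 'a::finite) fano_data \<Rightarrow>
    (complex^('a option) \<Rightarrow> complex) \<Rightarrow> complex^('a option) \<Rightarrow> complex" where
  "euler D f x = (\<Sum>\<alpha>\<in>UNIV. euler_coeff D x \<alpha> * pd \<alpha> f x)"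

definition homogeneous_mod_affine :: "('h::comm_ring_1, 'a::finite) fano_data \<Rightarrow>
    (complex^('a option)) set \<Rightarrow> (complex^('a option) \<Rightarrow> complex) \<Rightarrow> bool" where
  "homogeneous_mod_affine D U f \<longleftrightarrow> (\<forall>x\<in>U. \<forall>\<alpha> \<beta>.
     pd \<alpha> (pd \<beta> (\<lambda>x. euler D f x - (3 - of_nat (dimV D)) * f x)) x = 0)"

definition admissible :: "('h::comm_ring_1, 'a::finite) fano_data \<Rightarrow>
    (complex^('a option)) set \<Rightarrow> (complex^('a option) \<Rightarrow> complex) \<Rightarrow> bool" where
  "admissible D U f \<longleftrightarrow> open U \<and> holo_on f U \<and> indep_x0_mod_quadratic U f \<and>
     homogeneous_mod_affine D U f"

definition potential :: "('h::comm_ring_1, 'a::finite) fano_data \<Rightarrow>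
    (complex^('a option) \<Rightarrow> complex) \<Rightarrow> complex^('a option) \<Rightarrow> complex" where
  "potential D f x = intg D (point_of D x ^ 3) / 6 + f x"

definition tangent_mult :: "('h::comm_ring_1, 'a::finite) fano_data \<Rightarrow>
    (complex^('a option) \<Rightarrow> complex) \<Rightarrow> complex^('a option) \<Rightarrow>
    complex^('a option) \<Rightarrow> complex^('a option) \<Rightarrow> complex^('a option)" where
  "tangent_mult D F x u v =
     (\<chi> \<gamma>. \<Sum>\<alpha>\<in>UNIV. \<Sum>\<beta>\<in>UNIV. u $ \<alpha> * v $ \<beta> *
        (\<Sum>\<delta>\<in>UNIV. gbar D \<gamma> \<delta> * pd \<alpha> (pd \<beta> (pd \<delta> F)) x))"

text \<open>Semi-simplicity of a commutative algebra structure \<open>m\<close> on \<open>\<complex>\<^sup>i\<close>: the algebra is a sum of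
  simple modules over itself, that is, it is the sum of its minimal nonzero ideals.\<close>

definition alg_ideal :: "(complex^'i \<Rightarrow> complex^'i \<Rightarrow> complex^'i::finite) \<Rightarrow> (complex^'i) set \<Rightarrow> bool" where
  "alg_ideal m I \<longleftrightarrow> vec.subspace I \<and> (\<forall>u. \<forall>v\<in>I. m u v \<in> I)"

definition minimal_ideal :: "(complex^'i \<Rightarrow> complex^'i \<Rightarrow> complex^'i::finite) \<Rightarrow> (complex^'i) set \<Rightarrow> bool" where
  "minimal_ideal m I \<longleftrightarrow> alg_ideal m I \<and> I \<noteq> {0} \<and>
     (\<forall>J. alg_ideal m J \<and> J \<subseteq> I \<longrightarrow> J = {0} \<or> J = I)"

definition semisimple_alg :: "(complex^'i \<Rightarrow> complex^'i \<Rightarrow> complex^'i::finite) \<Rightarrow> bool" where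
  "semisimple_alg m \<longleftrightarrow> vec.span (\<Union>{I. minimal_ideal m I}) = UNIV"

definition semisimple_associative :: "('h::comm_ring_1, 'a::finite) fano_data \<Rightarrow>
    (complex^('a option)) set \<Rightarrow> (complex^('a option) \<Rightarrow> complex) \<Rightarrow> bool" where
  "semisimple_associative D U F \<longleftrightarrow> (\<forall>x\<in>U. let m = tangent_mult D F x in
     (\<forall>u v. m u v = m v u) \<and> (\<forall>u. m (axis None 1) u = u) \<and>
     (\<forall>u v w. m (m u v) w = m u (m v w)) \<and>
     semisimple_alg m)"


section \<open>The rational functions and the Pfaff problem\<close>

text \<open>There are as many eigenvalues \<open>a i\<close> as the size of the matrix, so \<open>inj a\<close> says that they are
  simple.\<close>

definition eigen_system :: "('h::comm_ring_1, 'a::finite) fano_data \<Rightarrow> complex^('a option)^('a option) \<Rightarrow>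
    ('a option \<Rightarrow> complex) \<Rightarrow> ('a option \<Rightarrow> complex^('a option)) \<Rightarrow> bool" where
  "eigen_system D Y a z \<longleftrightarrow> inj a \<and> (\<forall>i. z i \<noteq> 0) \<and>
     (\<forall>i \<alpha>. (\<Sum>\<beta>\<in>UNIV. \<Sum>\<gamma>\<in>UNIV. gbar D \<beta> \<gamma> *
        (c2 D \<alpha> \<beta> + (1 - of_nat (dimV D) + of_nat (deg D \<alpha>) + of_nat (deg D \<beta>)) * Y $ \<alpha> $ \<beta>) * z i $ \<gamma>)
        = a i * z i $ \<alpha>)"

definition R_denom :: "('h::comm_ring_1, 'a::finite) fano_data \<Rightarrow> complex^('a option) \<Rightarrow> complex" where
  "R_denom D \<zeta> = (\<Sum>\<delta>\<in>UNIV. \<Sum>\<epsilon>\<in>UNIV. gbar D \<delta> \<epsilon> * \<zeta> $ \<delta> * \<zeta> $ \<epsilon> * \<zeta> $ None)"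

text \<open>The choice of the eigenvectors is immaterial: each is determined up to a nonzero factor, and
  each summand of \<open>R\<close> is homogeneous of degree zero in it. As division by zero yields zero in HOL,
  \<open>R\<close> is meaningful only on \<open>R_dom\<close>.\<close>

definition R_dom :: "('h::comm_ring_1, 'a::finite) fano_data \<Rightarrow> complex^('a option)^('a option) \<Rightarrow> bool" where
  "R_dom D Y \<longleftrightarrow> (\<exists>a z. eigen_system D Y a z \<and> (\<forall>i. R_denom D (z i) \<noteq> 0))"

definition R :: "('h::comm_ring_1, 'a::finite) fano_data \<Rightarrow> complex^('a option)^('a option) \<Rightarrow>
    'a option \<Rightarrow> 'a option \<Rightarrow> 'a option \<Rightarrow> complex" where
  "R D Y \<alpha> \<beta> \<gamma> = (let z = (SOME z. \<exists>a. eigen_system D Y a z) in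
     \<Sum>i\<in>UNIV. z i $ \<alpha> * z i $ \<beta> * z i $ \<gamma> / R_denom D (z i))"

definition Ymat :: "('h::comm_ring_1, 'a::finite) fano_data \<Rightarrow> complex^('a option) \<Rightarrow> complex^'a^'a \<Rightarrow>
    complex^('a option)^('a option)" where
  "Ymat D x y = (\<chi> \<alpha> \<beta>. case \<alpha> of None \<Rightarrow> intg D (point_of D x * cls D \<beta>)
     | Some a \<Rightarrow> (case \<beta> of None \<Rightarrow> intg D (point_of D x * cls D \<alpha>)
        | Some b \<Rightarrow> y $ a $ b + intg D (point_of D x * cls D (Some a) * cls D (Some b))))"

definition r_full :: "('h::comm_ring_1, 'a::finite) fano_data \<Rightarrow> complex^('a option) \<Rightarrow> complex^'a^'a \<Rightarrow>
    'a \<Rightarrow> 'a \<Rightarrow> 'a \<Rightarrow> complex" where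
  "r_full D x y a b c = R D (Ymat D x y) (Some a) (Some b) (Some c) - g3 D (Some a) (Some b) (Some c)"

text \<open>Since \<open>r_full\<close> does not depend on \<open>x\<^sub>0\<close>, it is evaluated at \<open>x\<^sub>0 = 0\<close>.\<close>

definition r :: "('h::comm_ring_1, 'a::finite) fano_data \<Rightarrow> complex^'a \<Rightarrow> complex^'a^'a \<Rightarrow>
    'a \<Rightarrow> 'a \<Rightarrow> 'a \<Rightarrow> complex" where
  "r D w y = r_full D (insert0 w) y"

definition r_dom :: "('h::comm_ring_1, 'a::finite) fano_data \<Rightarrow> complex^'a \<Rightarrow> complex^'a^'a \<Rightarrow> bool" where
  "r_dom D w y \<longleftrightarrow> transpose y = y \<and> R_dom D (Ymat D (insert0 w) y)"

inductive poly_fun :: "(complex^'a::finite \<Rightarrow> complex^'a^'a \<Rightarrow> complex) \<Rightarrow> bool" where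
  const: "poly_fun (\<lambda>x y. t)"
| var_x: "poly_fun (\<lambda>x y. x $ a)"
| var_y: "poly_fun (\<lambda>x y. y $ a $ b)"
| add: "poly_fun P \<Longrightarrow> poly_fun Q \<Longrightarrow> poly_fun (\<lambda>x y. P x y + Q x y)"
| mult: "poly_fun P \<Longrightarrow> poly_fun Q \<Longrightarrow> poly_fun (\<lambda>x y. P x y * Q x y)"

text \<open>
  The right hand side of the algebraic constraint is what applying
  \<open>\<partial>\<^sup>2/\<partial>x\<^sub>a\<partial>x\<^sub>b\<close> to \<open>E(f) - (3 - n) f\<close> forces for \<open>y\<^sub>a\<^sub>b = \<partial>\<^sup>2f/\<partial>x\<^sub>a\<partial>x\<^sub>b\<close> and \<open>r\<^sub>a\<^sub>b\<^sub>c = \<partial>\<^sup>3f/\<partial>x\<^sub>a\<partial>x\<^sub>b\<partial>x\<^sub>c\<close>.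
  The equation with the further summand \<open>n \<Sum>\<^sub>c g\<^sub>a\<^sub>b\<^sub>c x\<^sub>c\<close> on the right is \<open>constraint_with_cubic_term\<close>.
  The two coincide if all \<open>g\<^sub>a\<^sub>b\<^sub>c\<close> with Latin indices vanish, that is, for \<open>n \<le> 2\<close>; otherwise they
  cannot both hold on a nonempty open set.
\<close>

definition constraint :: "('h::comm_ring_1, 'a::finite) fano_data \<Rightarrow> complex^'a \<Rightarrow> complex^'a^'a \<Rightarrow> bool" where
  "constraint D w y \<longleftrightarrow> (\<forall>a b.
     (\<Sum>c\<in>UNIV. (c_coord D (Some c) + (1 - of_nat (deg D (Some c))) * w $ c) * r D w y a b c)
     = (1 - of_nat (dimV D) + of_nat (deg D (Some a)) + of_nat (deg D (Some b))) * y $ a $ b)"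

definition constraint_with_cubic_term ::
    "('h::comm_ring_1, 'a::finite) fano_data \<Rightarrow> complex^'a \<Rightarrow> complex^'a^'a \<Rightarrow> bool" where
  "constraint_with_cubic_term D w y \<longleftrightarrow> (\<forall>a b.
     (\<Sum>c\<in>UNIV. (c_coord D (Some c) + (1 - of_nat (deg D (Some c))) * w $ c) * r D w y a b c)
     = of_nat (dimV D) * (\<Sum>c\<in>UNIV. g3 D (Some a) (Some b) (Some c) * w $ c)
       + (1 - of_nat (dimV D) + of_nat (deg D (Some a)) + of_nat (deg D (Some b))) * y $ a $ b)"

definition pfaff_problem :: "('h::comm_ring_1, 'a::finite) fano_data \<Rightarrow> (complex^'a) set \<Rightarrow>
    (complex^'a \<Rightarrow> complex^'a^'a) \<Rightarrow> bool" where
  "pfaff_problem D W y \<longleftrightarrow> open W \<and>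
     (\<forall>w\<in>W. r_dom D w (y w)) \<and>
     (\<forall>w\<in>W. \<forall>a b. ((\<lambda>w. y w $ a $ b) has_derivative
        (\<lambda>v. \<Sum>c\<in>UNIV. r D w (y w) a b c * v $ c)) (at w)) \<and>
     (\<forall>w\<in>W. constraint D w (y w))"

end

theory Submission
  imports Defs "HOL-Complex_Analysis.Cauchy_Integral_Formula" "HOL-Computational_Algebra.Fundamental_Theorem_Algebra"
begin

text \<open>
  Homogeneity says that multiplication by the Euler field has the matrix
  \<open>c\<^sub>\<alpha>\<^sub>\<beta> + (1 - n + p\<^sub>\<alpha> + p\<^sub>\<beta>) Y\<^sub>\<alpha>\<^sub>\<beta>\<close>, where \<open>Y\<close> is the Hessian of the potential. If the algebra is
  associative and this operator has simple eigenvalues, its eigenvectors are multiples of orthogonal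
  idempotents, and expanding the third derivatives of the potential in them gives \<open>R\<^sub>\<alpha>\<^sub>\<beta>\<^sub>\<gamma>(Y)\<close>.
  Conversely the tensor \<open>R\<^sub>\<alpha>\<^sub>\<beta>\<^sub>\<gamma>(Y)\<close> always defines a semi-simple algebra with unit \<open>\<partial>/\<partial>x\<^sub>0\<close>. So the
  associativity equations say that the third derivatives of \<open>f\<close> are \<open>r\<^sub>a\<^sub>b\<^sub>c\<close>, and two applications of
  the Poincare lemma reconstruct \<open>f\<close> from \<open>y\<close>. Expressing the idempotents by the powers of the Euler
  field makes \<open>r\<^sub>a\<^sub>b\<^sub>c\<close> rational. Finally, if the eigenvalues were not simple on an open set, one would
  differentiate the minimal polynomial of the Euler field along a vector \<open>v\<close>: the derivative of the
  eigenvalue at an idempotent is the component of \<open>v\<close> there, so these components would agree at two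
  different idempotents for every \<open>v\<close>.
\<close>

section \<open>The calculus of several complex variables\<close>

text \<open>The classical cubic is homogeneous up to a constant Hessian:
  \<open>g3 D \<alpha> \<beta> \<gamma>\<close> vanishes unless the three degrees add up to n, and
  then 1 - n + p_\<alpha> + p_\<beta> equals 1 - p_\<gamma>, the linear part of the Euler
  coefficient. So the cubic contributes nothing to the right side of the constraint. Simple
  eigenvalues enter twice: they turn eigenvectors of one operator into common eigenvectors of the
  whole algebra, and they make the powers of the Euler field a basis. Cramer's rule in that basis
  gives rational formulas although the eigenvectors themselves are not rational. The obstacle to
  density is that eigenvalues and idempotents are not known to be differentiable where eigenvalues
  collide. Only the coefficients of the minimal polynomial, quotients of determinants, are
  differentiated, at a point where its degree is maximal; the relation is tested against
  eigenvectors frozen at that point. Of f only complex differentiability is given; all higher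
  derivatives come from Cauchy's formula on a circle in one coordinate.\<close>

definition clin :: "complex^'i::finite \<Rightarrow> complex^'i \<Rightarrow> complex" where
  "clin A v = (\<Sum>i\<in>UNIV. A $ i * v $ i)"

text \<open>The pairing has no conjugation, so a derivative of the form \<open>clin A\<close> is
  complex linear. Membership in the library locale supplies the linearity and continuity rules used
  throughout.\<close>

lemma bounded_bilinear_clin: "bounded_bilinear (clin :: complex^'i::finite \<Rightarrow> _)"
proof
  show "\<exists>K. \<forall>a b. norm (clin a b :: complex) \<le> norm (a :: complex^'i) * norm b * K"
  proof (intro exI allI)
    fix a b :: "complex^'i"
    have "norm (clin a b) \<le> (\<Sum>i\<in>UNIV. norm (a $ i) * norm (b $ i))"
      unfolding clin_def by (rule order.trans[OF norm_sum]) (simp add: norm_mult)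
    also have "\<dots> \<le> (\<Sum>i\<in>(UNIV::'i set). norm a * norm b)"
      by (intro sum_mono mult_mono) (auto simp: Finite_Cartesian_Product.norm_nth_le)
    finally show "norm (clin a b) \<le> norm a * norm b * of_nat (CARD('i))" by (simp add: mult.commute)
  qed
qed (auto simp: clin_def algebra_simps sum.distrib scaleR_sum_right)

interpretation clin: bounded_bilinear clin
  by (rule bounded_bilinear_clin)

lemma clin_axis [simp]: "clin A (axis i 1) = A $ i"
  unfolding clin_def axis_def by (simp add: if_distrib cong: if_cong)

lemma clin_axis_left [simp]: "clin (axis i 1) v = v $ i"
  by (simp add: clin_def axis_def if_distrib if_distribR cong: if_cong)

lemma clin_smult: "clin A (t *s v) = t * clin A v"
  by (simp add: clin_def sum_distrib_left mult_ac)

lemma clin_smult_left: "clin (t *s A) v = t * clin A v"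
  by (simp add: clin_def sum_distrib_left mult_ac)

lemma holo_on_iff: "holo_on f U \<longleftrightarrow> (\<forall>x\<in>U. \<exists>A. (f has_derivative clin A) (at x))"
  by (simp add: holo_on_def clin_def[abs_def])

text \<open>Restriction to a complex line, where one-variable function theory applies.\<close>

lemma has_derivative_line:
  assumes "(f has_derivative clin A) (at (x + t *s v))"
  shows "((\<lambda>s. f (x + s *s v)) has_field_derivative clin A v) (at t)"
proof -
  have "((\<lambda>s::complex. x + s *s v) has_derivative (\<lambda>s. s *s v)) (at t)"
  proof -
    have "bounded_linear (\<lambda>s::complex. s *s v)"
      by (intro linear_conv_bounded_linear[THEN iffD1] linearI) (auto simp: vec_eq_iff algebra_simps)
    then show ?thesis
      by (auto intro!: derivative_eq_intros bounded_linear_imp_has_derivative)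
  qed
  from diff_chain_at[OF this assms] show ?thesis
    by (simp add: o_def clin_smult has_field_derivative_def mult.commute[of _ "clin A v"])
qed

lemma has_derivative_pd_unique:
  assumes "(f has_derivative clin A) (at x)"
  shows "pd i f x = A $ i"
  using has_derivative_line[of f A x 0 "axis i 1"] assms unfolding pd_def
  by (auto intro: DERIV_imp_deriv)

lemma holo_on_has_derivative:
  assumes "holo_on f U" "x \<in> U"
  shows "(f has_derivative clin (\<chi> i. pd i f x)) (at x)"
proof -
  obtain A where A: "(f has_derivative clin A) (at x)" using assms by (auto simp: holo_on_iff)
  then have "A = (\<chi> i. pd i f x)" by (simp add: vec_eq_iff has_derivative_pd_unique)
  with A show ?thesis by simp
qed

lemma holo_onI: "(\<And>x. x \<in> U \<Longrightarrow> (f has_derivative clin (A x)) (at x)) \<Longrightarrow> holo_on f U"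
  by (auto simp: holo_on_iff)

lemma holo_on_subset: "holo_on f U \<Longrightarrow> V \<subseteq> U \<Longrightarrow> holo_on f V"
  by (auto simp: holo_on_iff)

lemma holo_on_continuous_on: "holo_on f U \<Longrightarrow> continuous_on U f"
  by (meson continuous_at_imp_continuous_on has_derivative_continuous holo_on_iff)

lemma pd_cong:
  assumes "open U" "x \<in> U" "\<And>y. y \<in> U \<Longrightarrow> f y = g y"
  shows "pd i f x = pd i g x"
proof -
  have "open ((\<lambda>t::complex. x + t *s axis i 1) -` U)"
    by (rule open_vimage[OF assms(1)])
       (auto simp: vector_scalar_mult_def intro!: continuous_intros)
  then have "eventually (\<lambda>t::complex. x + t *s axis i 1 \<in> U) (nhds 0)"
    unfolding eventually_nhds
    by (intro exI[of _ "(\<lambda>t::complex. x + t *s axis i 1) -` U"]) (use assms in auto)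
  then have "eventually (\<lambda>t::complex. f (x + t *s axis i 1) = g (x + t *s axis i 1)) (nhds 0)"
    by (rule eventually_mono) (auto simp: assms)
  then show ?thesis unfolding pd_def by (rule deriv_cong_ev) simp
qed

section \<open>Cauchy's formula on coordinate circles and the regularity of partial
  derivatives\<close>

lemma leibniz_clin:
  fixes f :: "complex^'i::finite \<Rightarrow> real \<Rightarrow> complex"
  assumes V: "open V" "convex V" "x \<in> V"
    and d: "\<And>x s. x \<in> V \<Longrightarrow> s \<in> {0..1} \<Longrightarrow> ((\<lambda>x. f x s) has_derivative clin (A x s)) (at x)"
    and f: "\<And>x. x \<in> V \<Longrightarrow> continuous_on {0..1} (f x)"
    and A: "continuous_on (V \<times> {0..1}) (\<lambda>(x,s). A x s)"
  shows "((\<lambda>x. integral {0..1} (f x)) has_derivative clin (integral {0..1} (A x))) (at x)"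
proof -
  have Ax: "continuous_on {0..1} (A x)"
    using continuous_on_compose2[OF A, of "{0..1}" "\<lambda>s. (x, s)"] V(3)
    by (simp add: continuous_on_Pair continuous_on_const continuous_on_id image_subset_iff)
  have "((\<lambda>x. integral (cbox 0 1) (f x)) has_derivative integral (cbox 0 1) (\<lambda>s. clin.prod_right (A x s))) (at x within V)"
  proof (rule leibniz_rule)
    show "continuous_on (V \<times> cbox 0 1) (\<lambda>(x, t). clin.prod_right (A x t))"
      using bounded_linear.continuous_on[OF clin.bounded_linear_prod_right A] by (simp add: split_def)
    fix x s assume x: "x \<in> V"
    show "(f x) integrable_on cbox 0 1"
      using integrable_continuous_real[OF f[OF x]] by simp
    assume "s \<in> cbox (0::real) 1"
    then show "((\<lambda>x. f x s) has_derivative blinfun_apply (clin.prod_right (A x s))) (at x within V)"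
      using has_derivative_at_withinI[OF d[OF x]] by (simp add: clin.prod_right.rep_eq)
  qed (use V in simp_all)
  \<comment> \<open>The library rule integrates a path of bounded linear maps;
    \<open>clin.prod_right\<close> is bounded linear in the gradient, so the integral can be taken
    of the gradient itself.\<close>
  also have "integral (cbox 0 1) (\<lambda>s. clin.prod_right (A x s)) = clin.prod_right (integral {0..1} (A x))"
    using integral_linear[OF integrable_continuous_real[OF Ax] clin.bounded_linear_prod_right]
    unfolding comp_def cbox_interval .
  finally show ?thesis by (simp add: at_within_open[OF V(3,1)])
qed

lemma integral_vec_nth:
  fixes A :: "real \<Rightarrow> complex^'i::finite"
  assumes "A integrable_on S"
  shows "integral S A $ j = integral S (\<lambda>s. A s $ j)"
  using integral_linear[OF assms bounded_linear_vec_nth[of j]] unfolding comp_def by (rule sym)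

text \<open>Cauchy's kernel du / (2 pi i u^2) in the parameter s of the circle u = \<rho> exp(2 pi i
  s): since du = 2 pi i u ds, what remains is 1 / u.\<close>

definition circ_kernel :: "real \<Rightarrow> real \<Rightarrow> complex" where
  "circ_kernel \<rho> s = exp (- (2 * of_real pi * \<i> * of_real s)) / of_real \<rho>"

text \<open>Cauchy's formula for the first derivative, on a circle in the i-th coordinate alone. It
  expresses a derivative by values of f, which is where all gain of regularity comes from.\<close>

lemma pd_circle_integral:
  fixes f :: "complex^'i::finite \<Rightarrow> complex"
  assumes U: "holo_on f U" and \<rho>: "\<rho> > 0" and sub: "\<And>t. t \<in> cball 0 \<rho> \<Longrightarrow> x + t *s axis i 1 \<in> U"
  shows "pd i f x = integral {0..1} (\<lambda>s. f (x + circlepath 0 \<rho> s *s axis i 1) * circ_kernel \<rho> s)"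
proof -
  let ?g = "\<lambda>t. f (x + t *s axis i 1)"
  have d: "(?g has_field_derivative pd i f (x + t *s axis i 1)) (at t)" if "t \<in> cball 0 \<rho>" for t
    using has_derivative_line[OF holo_on_has_derivative[OF U sub[OF that]]] by simp
  have "(?g has_field_derivative (1 / (2 * of_real pi * \<i>) * contour_integral(circlepath 0 \<rho>) (\<lambda>u. ?g u / (u - 0)^2))) (at 0)"
  proof (rule Cauchy_derivative_integral_circlepath)
    show "continuous_on (cball 0 \<rho>) ?g"
      by (rule DERIV_continuous_on, rule has_field_derivative_at_within, rule d)
    show "?g holomorphic_on ball 0 \<rho>"
    proof (rule holomorphic_onI)
      fix t :: complex assume "t \<in> ball 0 \<rho>"
      then have "t \<in> cball 0 \<rho>" by simp
      from has_field_derivative_at_within[OF d[OF this]]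
      show "?g field_differentiable (at t within ball 0 \<rho>)" unfolding field_differentiable_def ..
    qed
  qed (use \<rho> in auto)
  from DERIV_imp_deriv[OF this]
  have "pd i f x = 1 / (2 * of_real pi * \<i>) * contour_integral(circlepath 0 \<rho>) (\<lambda>u. ?g u / u^2)"
    by (simp add: pd_def)
  also have "contour_integral(circlepath 0 \<rho>) (\<lambda>u. ?g u / u^2)
     = integral {0..1} (\<lambda>s. (2 * of_real pi * \<i>) * (?g (circlepath 0 \<rho> s) * circ_kernel \<rho> s))"
    unfolding contour_integral_integral vector_derivative_circlepath
    by (rule integral_cong)
       (use \<rho> in \<open>simp add: circlepath power2_eq_square circ_kernel_def field_simps exp_minus\<close>)
  finally show ?thesis by simp
qed

lemma continuous_on_vector_smult [continuous_intros]:
  fixes a :: "'b::topological_space \<Rightarrow> complex"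
  assumes "continuous_on S a" "continuous_on S b"
  shows "continuous_on S (\<lambda>x. a x *s b x)"
  unfolding vector_scalar_mult_def by (intro continuous_intros assms)

lemma norm_smult_axis: "norm (t *s axis i (1::complex)) = norm t"
proof -
  have "(\<Sum>j\<in>UNIV. (norm ((t *s axis i (1::complex)) $ j))\<^sup>2) = (\<Sum>j\<in>UNIV. if j = i then (norm t)\<^sup>2 else 0)"
    by (rule sum.cong) (auto simp: axis_def)
  then show ?thesis by (simp add: norm_vec_def L2_set_def)
qed

text \<open>The radius is doubled so that circles of one radius \<rho> serve all centres in a ball
  of radius \<rho>, as a parameter integral requires.\<close>

lemma translate_in:
  assumes "cball x0 (2 * \<rho>) \<subseteq> U" "x \<in> ball x0 \<rho>" "norm t \<le> \<rho>"
  shows "x + t *s axis i (1::complex) \<in> U"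
proof -
  have "dist x0 (x + t *s axis i 1) \<le> dist x0 x + norm t"
    using dist_triangle[of x0 "x + t *s axis i 1" x] by (simp add: dist_norm norm_smult_axis)
  then have "x + t *s axis i (1::complex) \<in> cball x0 (2 * \<rho>)" using assms(2,3) by (simp add: dist_commute)
  with assms(1) show ?thesis by blast
qed

lemma continuous_on_circ_kernel: "continuous_on S (\<lambda>x. circ_kernel \<rho> (s x))" if "continuous_on S s" "\<rho> > 0"
  unfolding circ_kernel_def
  by (intro continuous_on_divide continuous_on_exp continuous_on_minus continuous_on_mult continuous_on_const
      continuous_on_of_real that(1)) (use that(2) in simp)

lemma circlepath_norm: "\<rho> > 0 \<Longrightarrow> norm (circlepath 0 \<rho> s) = \<rho>"
  by (simp add: circlepath norm_mult)

lemma continuous_on_circlepath: "continuous_on S (\<lambda>x. circlepath 0 \<rho> (s x))" if "continuous_on S s"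
  unfolding circlepath
  by (intro continuous_on_add continuous_on_exp continuous_on_mult continuous_on_const continuous_on_of_real that)

lemma continuous_on_circle_integrand:
  fixes h :: "complex^'i::finite \<Rightarrow> 'b::real_normed_vector"
  assumes h: "continuous_on U h" and sub: "cball x0 (2 * \<rho>) \<subseteq> U" and \<rho>: "\<rho> > 0"
  shows "continuous_on (ball x0 \<rho> \<times> T) (\<lambda>(x,s). h (x + circlepath 0 \<rho> s *s axis i 1))"
  unfolding split_def
proof (rule continuous_on_compose2[OF h])
  show "continuous_on (ball x0 \<rho> \<times> T) (\<lambda>p. fst p + circlepath 0 \<rho> (snd p) *s axis i 1)"
    by (intro continuous_on_add continuous_on_vector_smult continuous_on_circlepath continuous_on_fst
        continuous_on_snd continuous_on_id continuous_on_const)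
  show "(\<lambda>p. fst p + circlepath 0 \<rho> (snd p) *s axis i 1) ` (ball x0 \<rho> \<times> T) \<subseteq> U"
    using translate_in[OF sub] circlepath_norm[OF \<rho>] by fastforce
qed

lemma cball2_exists:
  fixes x0 :: "'a::metric_space"
  assumes "open U" "x0 \<in> U"
  obtains \<rho> where "\<rho> > 0" "cball x0 (2 * \<rho>) \<subseteq> U"
proof -
  obtain e where "e > 0" "cball x0 e \<subseteq> U" using assms open_contains_cball by blast
  then show ?thesis using that[of "e/2"] by auto
qed

lemma pd_circle_integral_ball:
  assumes "holo_on f U" "\<rho> > 0" "cball x0 (2 * \<rho>) \<subseteq> U" "x \<in> ball x0 \<rho>"
  shows "pd i f x = integral {0..1} (\<lambda>s. f (x + circlepath 0 \<rho> s *s axis i 1) * circ_kernel \<rho> s)"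
  by (rule pd_circle_integral[OF assms(1,2)], rule translate_in[OF assms(3,4)]) simp

lemma continuous_on_pd:
  assumes U: "open U" and f: "holo_on f U"
  shows "continuous_on U (pd i f)"
proof (rule continuous_at_imp_continuous_on, rule ballI)
  fix x0 assume "x0 \<in> U"
  then obtain \<rho> where \<rho>: "\<rho> > 0" "cball x0 (2 * \<rho>) \<subseteq> U" using cball2_exists U by metis
  let ?h = "\<lambda>x s. f (x + circlepath 0 \<rho> s *s axis i 1) * circ_kernel \<rho> s"
  have "continuous_on (ball x0 \<rho>) (\<lambda>x. integral (cbox 0 1) (?h x))"
    using continuous_on_circle_integrand[OF holo_on_continuous_on[OF f] \<rho>(2,1)] \<rho>(1)
    unfolding split_def
    by (intro integral_continuous_on_param, unfold split_def)
       (intro continuous_on_mult continuous_on_circ_kernel continuous_on_snd continuous_on_id; assumption)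
  then have "continuous_on (ball x0 \<rho>) (pd i f)"
    by (rule continuous_on_eq) (simp add: pd_circle_integral_ball[OF f \<rho>])
  then show "isCont (pd i f) x0" using \<rho>(1) by (simp add: continuous_on_eq_continuous_at)
qed

text \<open>Differentiating the circle integral for \<open>pd i f\<close> under the integral sign
  puts \<open>pd j f\<close> on the same circle. The integral form is kept because it also yields
  the symmetry of second derivatives.\<close>

lemma has_derivative_pd_circle:
  assumes U: "open U" and f: "holo_on f U" and \<rho>: "\<rho> > 0" "cball x0 (2 * \<rho>) \<subseteq> U"
  shows "(pd i f has_derivative clin (\<chi> j. integral {0..1}
     (\<lambda>s. pd j f (x0 + circlepath 0 \<rho> s *s axis i 1) * circ_kernel \<rho> s))) (at x0)"
proof -
  let ?p = "\<lambda>x s. x + circlepath 0 \<rho> s *s axis i 1"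
  define A where "A x s = circ_kernel \<rho> s *s (\<chi> j. pd j f (?p x s))" for x s
  have p: "?p x s \<in> U" if "x \<in> ball x0 \<rho>" for x s
    using translate_in[OF \<rho>(2) that] \<rho>(1) by (simp add: circlepath_norm)
  have A: "continuous_on (ball x0 \<rho> \<times> {0..1}) (\<lambda>(x,s). A x s)"
    using continuous_on_circle_integrand[OF continuous_on_pd[OF U f] \<rho>(2,1)] \<rho>(1)
    unfolding A_def split_def
    by (intro continuous_on_vector_smult continuous_on_vec_lambda continuous_on_circ_kernel
        continuous_on_snd[OF continuous_on_id])
  have "((\<lambda>x. integral {0..1} (\<lambda>s. f (?p x s) * circ_kernel \<rho> s)) has_derivative clin (integral {0..1} (A x0))) (at x0)"
  proof (rule leibniz_clin[of "ball x0 \<rho>"])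
    show "continuous_on {0..1} (\<lambda>s. f (?p x s) * circ_kernel \<rho> s)" if "x \<in> ball x0 \<rho>" for x
      using \<rho> p[OF that]
      by (intro continuous_on_mult continuous_on_add continuous_on_vector_smult continuous_on_const continuous_on_id
          continuous_on_circ_kernel continuous_on_compose2[OF holo_on_continuous_on[OF f]] continuous_on_circlepath) auto
    fix x s assume "x \<in> ball x0 \<rho>"
    have "((\<lambda>x. f (?p x s)) has_derivative clin (\<chi> j. pd j f (?p x s))) (at x)"
      by (rule has_derivative_compose[where f="\<lambda>x. ?p x s" and f'="\<lambda>v. v", OF _ holo_on_has_derivative[OF f p[OF \<open>x \<in> _\<close>]]])
         (rule has_derivative_add[OF has_derivative_ident has_derivative_const, simplified])
    moreover have "clin (A x s) = (\<lambda>v. clin (\<chi> j. pd j f (?p x s)) v * circ_kernel \<rho> s)"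
      by (simp add: A_def clin_smult_left fun_eq_iff)
    ultimately show "((\<lambda>x. f (?p x s) * circ_kernel \<rho> s) has_derivative clin (A x s)) (at x)"
      by (simp only: has_derivative_mult_left)
  qed (use \<rho> A in auto)
  then have "(pd i f has_derivative clin (integral {0..1} (A x0))) (at x0)"
    by (rule has_derivative_transform_within_open[of _ _ _ _ "ball x0 \<rho>"])
       (use \<rho> pd_circle_integral_ball[OF f \<rho>] in auto)
  moreover have "integral {0..1} (A x0) = (\<chi> j. integral {0..1} (\<lambda>s. pd j f (?p x0 s) * circ_kernel \<rho> s))"
  proof -
    have "continuous_on {0..1} (A x0)"
      using continuous_on_compose2[OF A, of "{0..1}" "\<lambda>s. (x0, s)"] \<rho>(1)
      by (simp add: continuous_on_Pair continuous_on_const continuous_on_id image_subset_iff)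
    from integral_vec_nth[OF integrable_continuous_real[OF this]]
    show ?thesis by (simp add: vec_eq_iff A_def mult.commute)
  qed
  ultimately show ?thesis by simp
qed

lemma holo_on_pd:
  assumes "open U" "holo_on f U"
  shows "holo_on (pd i f) U"
proof -
  have "\<exists>A. (pd i f has_derivative clin A) (at x)" if x: "x \<in> U" for x
  proof -
    obtain \<rho> where "\<rho> > 0" "cball x (2 * \<rho>) \<subseteq> U" using cball2_exists[OF assms(1) x] by metis
    from has_derivative_pd_circle[OF assms this] show ?thesis by blast
  qed
  then show ?thesis by (simp add: holo_on_iff)
qed

text \<open>The derivative along j of the circle integral for \<open>pd i f\<close> is the very
  circle integral that computes \<open>pd i\<close> of \<open>pd j f\<close>.\<close>

lemma pd_commute:
  assumes U: "open U" and f: "holo_on f U" and x0: "x0 \<in> U"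
  shows "pd j (pd i f) x0 = pd i (pd j f) x0"
proof -
  obtain \<rho> where \<rho>: "\<rho> > 0" "cball x0 (2 * \<rho>) \<subseteq> U" using cball2_exists U x0 by metis
  have "pd j (pd i f) x0 = integral {0..1} (\<lambda>s. pd j f (x0 + circlepath 0 \<rho> s *s axis i 1) * circ_kernel \<rho> s)"
    using has_derivative_pd_unique[OF has_derivative_pd_circle[OF U f \<rho>], where i=j] by simp
  also have "\<dots> = pd i (pd j f) x0"
    using pd_circle_integral_ball[OF holo_on_pd[OF U f] \<rho>, of x0] \<rho>(1) by simp
  finally show ?thesis .
qed

section \<open>Differentiation rules for gradients and partial derivatives\<close>

lemma clin_sum_left: "clin (\<Sum>k\<in>K. A k) v = (\<Sum>k\<in>K. clin (A k) v)"
  by (induction K rule: infinite_finite_induct) (simp_all add: clin.add_left clin.zero_left)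

lemma cd_const: "((\<lambda>x. c) has_derivative clin 0) (at x)"
  by (simp add: clin_def[abs_def])

lemma cd_coord: "((\<lambda>x. x $ i) has_derivative clin (axis i 1)) (at x)"
  by (simp add: clin_axis_left[abs_def] bounded_linear_imp_has_derivative bounded_linear_vec_nth)

lemma cd_add: "\<lbrakk>(f has_derivative clin A) (at x); (g has_derivative clin B) (at x)\<rbrakk>
    \<Longrightarrow> ((\<lambda>x. f x + g x) has_derivative clin (A + B)) (at x)"
  using has_derivative_add[of f "clin A" "at x" g "clin B"] by (simp add: clin.add_left[abs_def])

lemma cd_diff: "\<lbrakk>(f has_derivative clin A) (at x); (g has_derivative clin B) (at x)\<rbrakk>
    \<Longrightarrow> ((\<lambda>x. f x - g x) has_derivative clin (A - B)) (at x)"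
  using has_derivative_diff[of f "clin A" "at x" g "clin B"] by (simp add: clin.diff_left[abs_def])

lemma cd_cmult: "(f has_derivative clin A) (at x) \<Longrightarrow> ((\<lambda>x. c * f x) has_derivative clin (c *s A)) (at x)"
  using has_derivative_mult_right[of f "clin A" "at x" c] by (simp add: clin_smult_left[abs_def])

lemma cd_mult: "\<lbrakk>(f has_derivative clin A) (at x); (g has_derivative clin B) (at x)\<rbrakk>
    \<Longrightarrow> ((\<lambda>x. f x * g x) has_derivative clin (f x *s B + g x *s A)) (at x)"
  using has_derivative_mult[of f "clin A" x UNIV g "clin B"]
  by (simp add: clin.add_left[abs_def] clin_smult_left[abs_def] mult.commute[of "g x"])

lemma cd_sum: "(\<And>k. k \<in> K \<Longrightarrow> (f k has_derivative clin (A k)) (at x))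
    \<Longrightarrow> ((\<lambda>x. \<Sum>k\<in>K. f k x) has_derivative clin (\<Sum>k\<in>K. A k)) (at x)"
  using has_derivative_sum[of K f "\<lambda>k. clin (A k)" "at x"] by (simp add: clin_sum_left[abs_def])

lemma pd_add:
  assumes "holo_on f U" "holo_on g U" "x \<in> U"
  shows "pd i (\<lambda>x. f x + g x) x = pd i f x + pd i g x"
  using has_derivative_pd_unique[OF cd_add[OF assms(1,2)[THEN holo_on_has_derivative, OF assms(3)]]] by simp

lemma pd_diff:
  assumes "holo_on f U" "holo_on g U" "x \<in> U"
  shows "pd i (\<lambda>x. f x - g x) x = pd i f x - pd i g x"
  using has_derivative_pd_unique[OF cd_diff[OF assms(1,2)[THEN holo_on_has_derivative, OF assms(3)]]] by simp

lemma pd_cmult: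
  assumes "holo_on f U" "x \<in> U"
  shows "pd i (\<lambda>x. c * f x) x = c * pd i f x"
  using has_derivative_pd_unique[OF cd_cmult[OF assms(1)[THEN holo_on_has_derivative, OF assms(2)]]] by simp

lemma pd_mult:
  assumes "holo_on f U" "holo_on g U" "x \<in> U"
  shows "pd i (\<lambda>x. f x * g x) x = f x * pd i g x + pd i f x * g x"
  using has_derivative_pd_unique[OF cd_mult[OF assms(1,2)[THEN holo_on_has_derivative, OF assms(3)]]]
  by (simp add: mult.commute)

lemma pd_sum:
  assumes "\<And>k. k \<in> K \<Longrightarrow> holo_on (f k) U" "x \<in> U"
  shows "pd i (\<lambda>x. \<Sum>k\<in>K. f k x) x = (\<Sum>k\<in>K. pd i (f k) x)"
proof -
  have "((\<lambda>x. \<Sum>k\<in>K. f k x) has_derivative clin (\<Sum>k\<in>K. \<chi> i. pd i (f k) x)) (at x)"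
    by (intro cd_sum holo_on_has_derivative[OF assms(1) assms(2)])
  from has_derivative_pd_unique[OF this] show ?thesis by (simp add: sum_component)
qed

lemma pd_const [simp]: "pd i (\<lambda>x. c) x = 0"
  using has_derivative_pd_unique[OF cd_const] by simp

lemma holo_on_const [intro]: "holo_on (\<lambda>x. c) U"
  by (rule holo_onI[OF cd_const])

lemma holo_on_coord [intro]: "holo_on (\<lambda>x. x $ i) U"
  by (rule holo_onI[OF cd_coord])

lemma holo_on_add [intro]: "holo_on f U \<Longrightarrow> holo_on g U \<Longrightarrow> holo_on (\<lambda>x. f x + g x) U"
  by (rule holo_onI[OF cd_add[OF holo_on_has_derivative holo_on_has_derivative]])

lemma holo_on_diff [intro]: "holo_on f U \<Longrightarrow> holo_on g U \<Longrightarrow> holo_on (\<lambda>x. f x - g x) U"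
  by (rule holo_onI[OF cd_diff[OF holo_on_has_derivative holo_on_has_derivative]])

lemma holo_on_mult [intro]: "holo_on f U \<Longrightarrow> holo_on g U \<Longrightarrow> holo_on (\<lambda>x. f x * g x) U"
  by (rule holo_onI[OF cd_mult[OF holo_on_has_derivative holo_on_has_derivative]])

lemma holo_on_sum [intro]: "(\<And>k. k \<in> K \<Longrightarrow> holo_on (f k) U) \<Longrightarrow> holo_on (\<lambda>x. \<Sum>k\<in>K. f k x) U"
  by (induction K rule: infinite_finite_induct) auto

lemma holo_on_eq_const:
  assumes W: "open W" "connected W" and f: "holo_on f W" "\<And>x i. x \<in> W \<Longrightarrow> pd i f x = 0"
    and xy: "x \<in> W" "y \<in> W"
  shows "f x = f y"
proof -
  have "(f has_derivative (\<lambda>v. 0)) (at z)" if "z \<in> W" for z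
    using holo_on_has_derivative[OF f(1) that] by (simp add: f(2)[OF that] clin_def[abs_def])
  from has_derivative_zero_unique_connected[OF W this xy] show ?thesis .
qed

text \<open>The primitive is the line integral of the form along the segment from the centre, which
  stays in the ball.\<close>

lemma poincare_ball:
  fixes \<psi> :: "'i::finite \<Rightarrow> complex^'i \<Rightarrow> complex"
  assumes h: "\<And>a. holo_on (\<psi> a) (ball w0 e)"
    and closed: "\<And>a b w. w \<in> ball w0 e \<Longrightarrow> pd b (\<psi> a) w = pd a (\<psi> b) w"
  shows "\<exists>\<phi>. \<forall>w\<in>ball w0 e. (\<phi> has_derivative clin (\<chi> a. \<psi> a w)) (at w)"
proof (intro exI ballI)
  let ?V = "ball w0 e"
  let ?p = "\<lambda>w s. w0 + s *\<^sub>R (w - w0)"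
  \<comment> \<open>Gradient in w of the integrand at parameter s, by the product and chain
    rules.\<close>
  define A where "A w s = (\<Sum>a\<in>UNIV. \<psi> a (?p w s) *s axis a 1 + (w $ a - w0 $ a) *s (complex_of_real s *s (\<chi> b. pd b (\<psi> a) (?p w s))))" for w s
  have p: "?p w s \<in> ?V" if "w \<in> ?V" "s \<in> {0..1}" for w s
  proof -
    have "s * norm (w - w0) \<le> 1 * norm (w - w0)" using that by (intro mult_right_mono) auto
    then show ?thesis using that by (auto simp: dist_norm norm_minus_commute)
  qed
  have pc: "continuous_on (?V \<times> {0..1}) (\<lambda>(w,s). ?p w s)"
    unfolding split_def by (intro continuous_intros)
  have comp: "continuous_on (?V \<times> {0..1}) (\<lambda>(w,s). g (?p w s))" if "continuous_on ?V g" for g :: "complex^'i \<Rightarrow> complex"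
    using continuous_on_compose2[OF that pc] p by (auto simp: split_def image_subset_iff)
  have pcw: "continuous_on {0..1} (\<lambda>s. g (?p w s))" if "continuous_on ?V g" "w \<in> ?V" for w and g :: "complex^'i \<Rightarrow> complex"
  proof (rule continuous_on_compose2[OF that(1)])
    show "continuous_on {0..1} (?p w)" by (intro continuous_intros)
  qed (use p[OF that(2)] in auto)
  have contA: "continuous_on (?V \<times> {0..1}) (\<lambda>(w,s). A w s)"
  proof -
    have 1: "continuous_on (?V \<times> {0..1}) (\<lambda>x. \<psi> a (?p (fst x) (snd x)))" for a
      using comp[OF holo_on_continuous_on[OF h[of a]]] by (simp add: split_def)
    have 2: "continuous_on (?V \<times> {0..1}) (\<lambda>x. pd b (\<psi> a) (?p (fst x) (snd x)))" for a b
      using comp[OF continuous_on_pd[OF _ h[of a]]] by (simp add: split_def)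
    show ?thesis unfolding A_def split_def
      by (intro continuous_on_sum continuous_on_add continuous_on_vector_smult continuous_on_const 1 2
          continuous_on_vec_lambda continuous_on_diff continuous_on_of_real continuous_intros)
  qed
  fix w assume w: "w \<in> ?V"
  have "((\<lambda>w. integral {0..1} (\<lambda>s. \<Sum>a\<in>UNIV. \<psi> a (?p w s) * (w $ a - w0 $ a))) has_derivative clin (integral {0..1} (A w))) (at w)"
  proof (rule leibniz_clin[of ?V])
    show "open ?V" "convex ?V" "w \<in> ?V" using w by auto
    show "continuous_on {0..1} (\<lambda>s. \<Sum>a\<in>UNIV. \<psi> a (?p w s) * (w $ a - w0 $ a))" if "w \<in> ?V" for w
      by (intro continuous_on_sum continuous_on_mult continuous_on_const pcw holo_on_continuous_on h that)
    show "continuous_on (?V \<times> {0..1}) (\<lambda>(w,s). A w s)" by (rule contA)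
    fix w s assume ws: "w \<in> ?V" "s \<in> {0..1::real}"
    have "((\<lambda>w. \<psi> a (?p w s)) has_derivative clin (complex_of_real s *s (\<chi> b. pd b (\<psi> a) (?p w s)))) (at w)" for a
    proof -
      have "((\<lambda>w. ?p w s) has_derivative (\<lambda>v. s *\<^sub>R v)) (at w)"
        by (auto intro!: derivative_eq_intros)
      from has_derivative_compose[OF this holo_on_has_derivative[OF h p[OF ws]]]
      show ?thesis by (simp add: clin_smult_left[abs_def] clin.scaleR_right scaleR_conv_of_real[where 'a=complex])
    qed
    moreover have "((\<lambda>w. w $ a - w0 $ a) has_derivative clin (axis a 1)) (at w)" for a
      using cd_diff[OF cd_coord cd_const] by simp
    ultimately show "((\<lambda>w. \<Sum>a\<in>UNIV. \<psi> a (?p w s) * (w $ a - w0 $ a)) has_derivative clin (A w s)) (at w)"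
      unfolding A_def by (intro cd_sum cd_mult)
  qed
  moreover have "integral {0..1} (A w) = (\<chi> b. \<psi> b w)"
  proof -
    have "continuous_on {0..1} (A w)"
      using continuous_on_compose2[OF contA, of "{0..1}" "\<lambda>s. (w, s)"] w
      by (simp add: continuous_on_Pair continuous_on_const continuous_on_id image_subset_iff)
    note nth = integral_vec_nth[OF integrable_continuous_real[OF this]]
    \<comment> \<open>By closedness the b-th component of \<open>A\<close> is the derivative of s
      times \<open>\<psi> b\<close> along the segment; the boundary term at s = 0 vanishes.\<close>
    have "((\<lambda>s. A w s $ b) has_integral \<psi> b (?p w 1) * of_real 1 - \<psi> b (?p w 0) * of_real 0) {0..1}" for b
    proof (rule fundamental_theorem_of_calculus)
      fix s :: real assume s: "s \<in> {0..1}"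
      have "((\<lambda>s. ?p w s) has_derivative (\<lambda>t. t *\<^sub>R (w - w0))) (at s)"
        by (auto intro!: derivative_eq_intros)
      from has_derivative_compose[OF this holo_on_has_derivative[OF h p[OF w s]]]
      have "((\<lambda>s. \<psi> b (?p w s)) has_vector_derivative clin (\<chi> a. pd a (\<psi> b) (?p w s)) (w - w0)) (at s)"
        by (simp add: has_vector_derivative_def clin.scaleR_right)
      then have "((\<lambda>s. \<psi> b (?p w s) * of_real s) has_vector_derivative
          \<psi> b (?p w s) * 1 + clin (\<chi> a. pd a (\<psi> b) (?p w s)) (w - w0) * of_real s) (at s)"
        by (rule has_vector_derivative_mult)
           (auto intro!: derivative_eq_intros)
      moreover have "A w s $ b = \<psi> b (?p w s) * 1 + clin (\<chi> a. pd a (\<psi> b) (?p w s)) (w - w0) * of_real s"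
        using closed[OF p[OF w s], of b]
        by (simp add: A_def sum.distrib clin_def axis_def sum_distrib_left sum_distrib_right mult_ac if_distrib if_distribR
             cong: if_cong)
      ultimately show "((\<lambda>s. \<psi> b (?p w s) * of_real s) has_vector_derivative A w s $ b) (at s within {0..1})"
        by (simp add: has_vector_derivative_at_within)
    qed simp
    from integral_unique[OF this] show ?thesis by (simp add: vec_eq_iff nth)
  qed
  ultimately show "((\<lambda>w. integral {0..1} (\<lambda>s. \<Sum>a\<in>UNIV. \<psi> a (?p w s) * (w $ a - w0 $ a))) has_derivative clin (\<chi> a. \<psi> a w)) (at w)"
    by simp
qed

section \<open>The projection forgetting the unit coordinate \<open>x\<^sub>0\<close>\<close>

lemma sum_option_UNIV: "(\<Sum>\<alpha>\<in>UNIV. f \<alpha>) = f None + (\<Sum>a\<in>UNIV. f (Some a))" for f :: "'a::finite option \<Rightarrow> 'b::comm_monoid_add"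
  by (simp add: UNIV_option_conv sum.reindex)

lemma drop0_nth [simp]: "drop0 x $ a = x $ Some a"
  by (simp add: drop0_def)

lemma insert0_nth [simp]: "insert0 w $ None = 0" "insert0 w $ Some a = w $ a"
  by (simp_all add: insert0_def)

lemma drop0_insert0 [simp]: "drop0 (insert0 w) = w"
  by (simp add: vec_eq_iff)

lemma bounded_linear_drop0: "bounded_linear drop0"
  by (intro linear_conv_bounded_linear[THEN iffD1] linearI) (simp_all add: vec_eq_iff)

lemma bounded_linear_insert0: "bounded_linear insert0"
  by (intro linear_conv_bounded_linear[THEN iffD1] linearI) (simp_all add: vec_eq_iff insert0_def split: option.split)

lemma open_drop0_vimage: "open W \<Longrightarrow> open (drop0 -` W)"
  by (rule open_vimage) (auto intro: linear_continuous_on bounded_linear_drop0)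

lemma open_drop0_image:
  assumes "open U" shows "open (drop0 ` U)"
proof -
  \<comment> \<open>The image is the union of the images of the slices with \<open>x\<^sub>0\<close>
    = t, each open as a preimage of U under a continuous section.\<close>
  have "drop0 ` U = (\<Union>t. (\<lambda>w. insert0 w + t *s axis None 1) -` U)"
  proof safe
    fix x :: "complex^('a option)" assume "x \<in> U"
    moreover have "insert0 (drop0 x) + x $ None *s axis None 1 = x"
      by (simp add: vec_eq_iff insert0_def axis_def split: option.split)
    ultimately show "drop0 x \<in> (\<Union>t. (\<lambda>w. insert0 w + t *s axis None 1) -` U)"
      by (metis UN_I UNIV_I vimageI2)
  next
    fix w t assume "insert0 w + t *s axis None 1 \<in> U"
    moreover have "drop0 (insert0 w + t *s axis None 1) = w" by (simp add: vec_eq_iff axis_def)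
    ultimately show "w \<in> drop0 ` U" by (metis image_eqI)
  qed
  moreover have "open ((\<lambda>w. insert0 w + t *s axis None 1) -` U)" for t
    by (rule open_vimage[OF assms])
       (intro continuous_on_add continuous_on_const linear_continuous_on bounded_linear_insert0)
  ultimately show ?thesis by auto
qed

lemma clin_drop0: "clin A (drop0 v) = clin (insert0 A) v"
  by (simp add: clin_def sum_option_UNIV)

lemma cd_drop0:
  assumes "(f has_derivative clin A) (at (drop0 x))"
  shows "((\<lambda>x. f (drop0 x)) has_derivative clin (insert0 A)) (at x)"
  using has_derivative_compose[OF bounded_linear_imp_has_derivative[OF bounded_linear_drop0] assms]
  by (simp add: clin_drop0[abs_def])

lemma cd_insert0:
  assumes "(f has_derivative clin A) (at (insert0 w + c))"
  shows "((\<lambda>w. f (insert0 w + c)) has_derivative clin (drop0 A)) (at w)"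
proof -
  have "((\<lambda>w. insert0 w + c) has_derivative insert0) (at w)"
    using has_derivative_add[OF bounded_linear_imp_has_derivative[OF bounded_linear_insert0] has_derivative_const]
    by simp
  from has_derivative_compose[OF this assms] show ?thesis
    by (simp add: clin_def[abs_def] sum_option_UNIV)
qed

section \<open>Frobenius algebras and their eigenvectors\<close>

text \<open>The product with its upper index lowered. In this form total symmetry of C is invariance
  of the bilinear form; raising the index by the inverse form gives the algebra product.\<close>

definition cvec :: "('i \<Rightarrow> 'i \<Rightarrow> 'i \<Rightarrow> complex) \<Rightarrow> complex^'i::finite \<Rightarrow> complex^'i \<Rightarrow> complex^'i" where
  "cvec C u v = (\<chi> \<delta>. \<Sum>\<alpha>\<in>UNIV. \<Sum>\<beta>\<in>UNIV. u $ \<alpha> * v $ \<beta> * C \<alpha> \<beta> \<delta>)"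

lemma cvec_add: "cvec C (u + u') v = cvec C u v + cvec C u' v" "cvec C u (v + v') = cvec C u v + cvec C u v'"
  by (simp_all add: cvec_def vec_eq_iff algebra_simps sum.distrib)

lemma cvec_smult: "cvec C (t *s u) v = t *s cvec C u v" "cvec C u (t *s v) = t *s cvec C u v"
  by (simp_all add: cvec_def vec_eq_iff sum_distrib_left mult_ac)

lemma cvec_zero: "cvec C 0 v = 0" "cvec C u 0 = 0"
  by (simp_all add: cvec_def vec_eq_iff)

lemma cvec_sum: "cvec C (\<Sum>k\<in>K. f k) v = (\<Sum>k\<in>K. cvec C (f k) v)" "cvec C u (\<Sum>k\<in>K. f k) = (\<Sum>k\<in>K. cvec C u (f k))"
  by (induction K rule: infinite_finite_induct) (simp_all add: cvec_add cvec_zero)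

lemma cvec_axis: "cvec C (axis \<alpha> 1) (axis \<beta> 1) $ \<delta> = C \<alpha> \<beta> \<delta>"
proof -
  have "cvec C (axis \<alpha> 1) (axis \<beta> 1) $ \<delta>
      = (\<Sum>\<alpha>'\<in>UNIV. axis \<alpha> 1 $ \<alpha>' * (\<Sum>\<beta>'\<in>UNIV. axis \<beta> 1 $ \<beta>' * C \<alpha>' \<beta>' \<delta>))"
    by (simp add: cvec_def sum_distrib_left mult.assoc)
  then show ?thesis by (simp add: axis_def mult_delta_left)
qed

lemma cvec_commute: "(\<And>\<alpha> \<beta> \<gamma>. C \<alpha> \<beta> \<gamma> = C \<beta> \<alpha> \<gamma>) \<Longrightarrow> cvec C u v = cvec C v u"
  unfolding cvec_def vec_eq_iff vec_lambda_beta
  by (intro allI, subst sum.swap, intro sum.cong refl) (metis mult.commute)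

lemma sum_rotate: "(\<Sum>x\<in>A. \<Sum>y\<in>B. \<Sum>z\<in>C. f x y z) = (\<Sum>y\<in>B. \<Sum>z\<in>C. \<Sum>x\<in>A. f x y z)"
proof -
  have "(\<Sum>x\<in>A. \<Sum>y\<in>B. \<Sum>z\<in>C. f x y z) = (\<Sum>y\<in>B. \<Sum>x\<in>A. \<Sum>z\<in>C. f x y z)" by (rule sum.swap)
  also have "\<dots> = (\<Sum>y\<in>B. \<Sum>z\<in>C. \<Sum>x\<in>A. f x y z)" by (rule sum.cong[OF refl], rule sum.swap)
  finally show ?thesis .
qed

lemma clin_cvec: "clin (cvec C u v) w = (\<Sum>\<alpha>\<in>UNIV. \<Sum>\<beta>\<in>UNIV. \<Sum>\<delta>\<in>UNIV. u $ \<alpha> * v $ \<beta> * w $ \<delta> * C \<alpha> \<beta> \<delta>)"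
proof -
  have "clin (cvec C u v) w = (\<Sum>\<delta>\<in>UNIV. \<Sum>\<alpha>\<in>UNIV. \<Sum>\<beta>\<in>UNIV. u $ \<alpha> * v $ \<beta> * w $ \<delta> * C \<alpha> \<beta> \<delta>)"
    by (simp add: clin_def cvec_def sum_distrib_right sum_distrib_left mult_ac)
  also have "\<dots> = (\<Sum>\<alpha>\<in>UNIV. \<Sum>\<beta>\<in>UNIV. \<Sum>\<delta>\<in>UNIV. u $ \<alpha> * v $ \<beta> * w $ \<delta> * C \<alpha> \<beta> \<delta>)"
    by (rule sum_rotate)
  finally show ?thesis .
qed

text \<open>The Frobenius property: invariance of the form under multiplication.\<close>

lemma clin_cvec_swap:
  assumes "\<And>\<alpha> \<beta> \<gamma>. C \<alpha> \<beta> \<gamma> = C \<alpha> \<gamma> \<beta>"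
  shows "clin (cvec C u v) w = clin (cvec C u w) v"
  unfolding clin_cvec
  by (rule sum.cong[OF refl], subst sum.swap, intro sum.cong refl) (simp add: assms mult_ac)

lemma clin_commute: "clin a b = clin b a"
  by (simp add: clin_def mult.commute)

lemma clin_matrix: "clin z (A *v v) = clin (transpose A *v z) v"
proof -
  have "clin z (A *v v) = (\<Sum>i\<in>UNIV. \<Sum>j\<in>UNIV. z $ i * (A $ i $ j * v $ j))"
    by (simp add: clin_def matrix_vector_mult_def sum_distrib_left)
  also have "\<dots> = (\<Sum>j\<in>UNIV. \<Sum>i\<in>UNIV. z $ i * (A $ i $ j * v $ j))" by (rule sum.swap)
  also have "\<dots> = clin (transpose A *v z) v"
    by (simp add: clin_def matrix_vector_mult_def transpose_def sum_distrib_left mult_ac)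
  finally show ?thesis .
qed

lemma clin_eq_0_iff: "(\<forall>v. clin z v = 0) \<longleftrightarrow> z = 0"
proof
  assume "\<forall>v. clin z v = 0"
  then have "clin z (axis i 1) = 0" for i by blast
  then show "z = 0" by (simp add: vec_eq_iff)
qed (simp add: clin.zero_left)

text \<open>The family is indexed like the coordinates, so the matrix with columns
  \<open>z i\<close> is square; being injective, it is invertible.\<close>

lemma independent_family_spans:
  fixes z :: "'i::finite \<Rightarrow> complex^'i"
  assumes "\<And>c. (\<Sum>i\<in>UNIV. c i *s z i) = 0 \<Longrightarrow> \<forall>i. c i = 0"
  shows "\<exists>c. v = (\<Sum>i\<in>UNIV. c i *s z i)"
proof -
  define A :: "complex^'i^'i" where "A = (\<chi> \<alpha> i. z i $ \<alpha>)"
  have A: "A *v c = (\<Sum>i\<in>UNIV. c $ i *s z i)" for c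
    by (simp add: A_def matrix_mult_sum column_def)
  have "\<forall>x. A *v x = 0 \<longrightarrow> x = 0"
  proof (intro allI impI)
    fix x assume "A *v x = 0"
    with assms[of "\<lambda>i. x $ i"] show "x = 0" by (simp add: A vec_eq_iff)
  qed
  then obtain B where "B ** A = mat 1" using matrix_left_invertible_ker by metis
  then have "A ** B = mat 1" by (rule matrix_left_right_inverse1)
  then have "A *v (B *v v) = v" by (simp add: matrix_vector_mul_assoc)
  then show ?thesis unfolding A by metis
qed

text \<open>With b = \<open>a k\<close> one term disappears, which is the induction step for
  independence; with b the eigenvalue of the combination itself the whole sum vanishes.\<close>

lemma eigen_combination:
  fixes z :: "'i \<Rightarrow> complex^'j::finite"
  assumes ev: "\<And>i. K *v z i = a i *s z i"
  shows "(\<Sum>i\<in>I. (c i * (a i - b)) *s z i) = K *v (\<Sum>i\<in>I. c i *s z i) - b *s (\<Sum>i\<in>I. c i *s z i)"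
proof -
  have "K *v (\<Sum>i\<in>I. c i *s z i) = (\<Sum>i\<in>I. c i *s (a i *s z i))" by (simp add: vec.sum vec.scale ev)
  then show ?thesis
    by (simp add: vec_eq_iff sum_component sum_distrib_left sum_subtractf[symmetric] right_diff_distrib mult_ac)
qed

lemma eigenvectors_independent:
  fixes z :: "'i \<Rightarrow> complex^'j::finite"
  assumes ev: "\<And>i. K *v z i = a i *s z i" and nz: "\<And>i. z i \<noteq> 0" and inj: "inj a"
    and "finite I" "(\<Sum>i\<in>I. c i *s z i) = 0"
  shows "\<forall>i\<in>I. c i = 0"
  using assms(4,5)
proof (induction I arbitrary: c rule: finite_induct)
  case (insert k I)
  have "(\<Sum>i\<in>insert k I. (c i * (a i - a k)) *s z i) = K *v (\<Sum>i\<in>insert k I. c i *s z i) - a k *s (\<Sum>i\<in>insert k I. c i *s z i)"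
    by (rule eigen_combination[OF ev])
  also have "\<dots> = 0" by (simp only: insert.prems vec.zero vec.scale_zero_right diff_zero)
  finally have "(\<Sum>i\<in>I. (c i * (a i - a k)) *s z i) = 0" using insert.hyps by simp
  from insert.IH[OF this] have I: "\<forall>i\<in>I. c i = 0"
    using insert.hyps inj by (auto simp: inj_def)
  with insert show ?case using nz by simp
qed simp

text \<open>As many distinct eigenvalues as the dimension leave only one-dimensional eigenspaces.
  Consequently an operator commuting with K preserves each eigenline, and eigenvectors are
  determined up to order and scaling.\<close>

lemma eigenspace_line:
  fixes z :: "'i::finite \<Rightarrow> complex^'i"
  assumes ev: "\<And>i. K *v z i = a i *s z i" and nz: "\<And>i. z i \<noteq> 0" and inj: "inj a"
    and w: "K *v w = b *s w" "w \<noteq> 0"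
  shows "\<exists>i t. b = a i \<and> t \<noteq> 0 \<and> w = t *s z i"
proof -
  note ind = eigenvectors_independent[OF ev nz inj finite]
  obtain c where c: "w = (\<Sum>i\<in>UNIV. c i *s z i)"
    using independent_family_spans[of z w] ind by blast
  have "(\<Sum>i\<in>UNIV. (c i * (a i - b)) *s z i) = K *v w - b *s w"
    unfolding c by (rule eigen_combination[OF ev])
  then have "(\<Sum>i\<in>UNIV. (c i * (a i - b)) *s z i) = 0" using w(1) by simp
  from ind[OF this] have z: "c i * (a i - b) = 0" for i by blast
  obtain k where k: "c k \<noteq> 0" using w(2) c by fastforce
  with z[of k] have b: "b = a k" by simp
  then have "c i = 0" if "i \<noteq> k" for i using z[of i] that inj by (auto simp: inj_def)
  then have "(\<Sum>i\<in>UNIV. c i *s z i) = (\<Sum>i\<in>UNIV. if i = k then c k *s z k else 0)"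
    by (intro sum.cong) auto
  with c have "w = c k *s z k" by simp
  with b k show ?thesis by blast
qed

text \<open>G is the Gram matrix of the form and S its inverse: G lowers vectors, S raises
  covectors. The direction \<open>e0\<close> is meant to be the unit; that it is one depends on the
  tensor and is assumed or proved lemma by lemma.\<close>

locale frobenius =
  fixes S G :: "complex^'i::finite^'i" and e0 :: 'i
  assumes GS: "G ** S = mat 1" and symS: "transpose S = S"
begin

lemma SG: "S ** G = mat 1"
  using GS by (rule matrix_left_right_inverse1)

lemma symG: "transpose G = G"
proof -
  have "transpose G = transpose G ** (S ** G)" by (simp add: SG)
  also have "\<dots> = (transpose G ** S) ** G" by (rule matrix_mul_assoc)
  also have "transpose G ** S = transpose (S ** G)" by (simp add: matrix_transpose_mul symS)
  finally show ?thesis by (simp add: SG transpose_mat)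
qed

lemma G_S [simp]: "G *v (S *v v) = v" and S_G [simp]: "S *v (G *v v) = v"
  by (simp_all add: matrix_vector_mul_assoc GS SG)

lemma clin_S: "clin z (S *v w) = clin (S *v z) w"
  by (simp add: clin_matrix symS)

lemma clin_G: "clin z (G *v w) = clin (G *v z) w"
  by (simp add: clin_matrix symG)

definition mult :: "('i \<Rightarrow> 'i \<Rightarrow> 'i \<Rightarrow> complex) \<Rightarrow> complex^'i \<Rightarrow> complex^'i \<Rightarrow> complex^'i" where
  "mult C u v = S *v cvec C u v"

lemma mult_sum: "mult C (\<Sum>k\<in>K. f k) v = (\<Sum>k\<in>K. mult C (f k) v)" "mult C u (\<Sum>k\<in>K. f k) = (\<Sum>k\<in>K. mult C u (f k))"
  by (simp_all add: mult_def cvec_sum vec.sum)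

lemma mult_smult: "mult C (t *s u) v = t *s mult C u v" "mult C u (t *s v) = t *s mult C u v"
  by (simp_all add: mult_def cvec_smult vec.scale)

lemma G_mult [simp]: "G *v mult C u v = cvec C u v"
  by (simp add: mult_def)

text \<open>By orthogonality the matrix with rows \<open>z i\<close> and the matrix with columns
  \<open>S *v z i\<close> divided by \<open>\<eta> i\<close> are inverse on one side, hence on both;
  the other side is the expansion.\<close>

lemma
  fixes z :: "'i \<Rightarrow> complex^'i"
  assumes orth: "\<And>i j. clin (z i) (S *v z j) = (if i = j then \<eta> i else 0)" and nz: "\<And>i. \<eta> i \<noteq> 0"
  shows frame_expand: "v = (\<Sum>i\<in>UNIV. (clin (z i) v / \<eta> i) *s (S *v z i))"
    and frame_G: "(G *v v) $ \<alpha> = (\<Sum>i\<in>UNIV. z i $ \<alpha> * clin (z i) v / \<eta> i)"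
    and frame_entry: "G $ \<alpha> $ \<beta> = (\<Sum>i\<in>UNIV. z i $ \<alpha> * z i $ \<beta> / \<eta> i)"
proof -
  define Z :: "complex^'i^'i" where "Z = (\<chi> i \<alpha>. z i $ \<alpha>)"
  define B :: "complex^'i^'i" where "B = (\<chi> \<alpha> i. (S *v z i) $ \<alpha> / \<eta> i)"
  have "(Z ** B) $ i $ j = clin (z i) (S *v z j) / \<eta> j" for i j
    by (simp add: Z_def B_def matrix_matrix_mult_def clin_def sum_divide_distrib)
  then have "Z ** B = mat 1" by (simp add: vec_eq_iff orth nz mat_def)
  then have "B ** Z = mat 1" by (rule matrix_left_right_inverse1)
  then have v: "v = B *v (Z *v v)" for v by (simp add: matrix_vector_mul_assoc)
  have Zv: "(Z *v v) $ i = clin (z i) v" for i v by (simp add: Z_def clin_def matrix_vector_mult_def)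
  have Bw: "B *v w = (\<Sum>i\<in>UNIV. (w $ i / \<eta> i) *s (S *v z i))" for w
    by (simp add: B_def matrix_mult_sum column_def vec_eq_iff sum_component)
  have e: "v = (\<Sum>i\<in>UNIV. (clin (z i) v / \<eta> i) *s (S *v z i))" for v
    using v[of v] by (simp add: Bw Zv)
  have Gv: "(G *v v) $ \<alpha> = (\<Sum>i\<in>UNIV. z i $ \<alpha> * clin (z i) v / \<eta> i)" for v
  proof -
    have "G *v v = G *v (\<Sum>i\<in>UNIV. (clin (z i) v / \<eta> i) *s (S *v z i))" using e[of v] by simp
    then show ?thesis by (simp add: vec.sum vec.scale sum_component mult.commute)
  qed
  show "v = (\<Sum>i\<in>UNIV. (clin (z i) v / \<eta> i) *s (S *v z i))"
    and "(G *v v) $ \<alpha> = (\<Sum>i\<in>UNIV. z i $ \<alpha> * clin (z i) v / \<eta> i)" by (rule e, rule Gv)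
  have "G $ \<alpha> $ \<beta> = (G *v axis \<beta> 1) $ \<alpha>"
    by (simp add: matrix_vector_mult_def axis_def if_distrib cong: if_cong)
  then show "G $ \<alpha> $ \<beta> = (\<Sum>i\<in>UNIV. z i $ \<alpha> * z i $ \<beta> / \<eta> i)" by (simp add: Gv)
qed

end

text \<open>An ideal of dimension one is minimal, and the given lines together span.\<close>

lemma lines_semisimple:
  fixes u :: "'i::finite \<Rightarrow> complex^'i"
  assumes ideal: "\<And>v i. m v (u i) = \<chi>' i v *s u i" and scl: "\<And>v w t. m v (t *s w) = t *s m v w"
    and nz: "\<And>i. u i \<noteq> 0" and span: "\<And>v. \<exists>c. v = (\<Sum>i\<in>UNIV. c i *s u i)"
  shows "semisimple_alg m"
proof -
  have min: "minimal_ideal m (vec.span {u i})" for i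
    unfolding minimal_ideal_def alg_ideal_def
  proof (intro conjI allI impI ballI)
    show "vec.subspace (vec.span {u i})" by (rule vec.subspace_span)
    show "vec.span {u i} \<noteq> {0}" using nz[of i] vec.span_base[of "u i" "{u i}"] by auto
    fix v w assume "w \<in> vec.span {u i}"
    then obtain t where t: "w = t *s u i" by (auto simp: vec.span_singleton)
    show "m v w \<in> vec.span {u i}"
      unfolding t scl ideal by (intro vec.span_scale vec.span_base) simp
  next
    fix J assume J: "(vec.subspace J \<and> (\<forall>v. \<forall>w\<in>J. m v w \<in> J)) \<and> J \<subseteq> vec.span {u i}"
    show "J = {0} \<or> J = vec.span {u i}"
    proof (cases "J \<subseteq> {0}")
      case True
      then show ?thesis using J vec.subspace_0 by blast
    next
      case False
      then obtain w where w: "w \<in> J" "w \<noteq> 0" by blast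
      with J obtain t where t: "w = t *s u i" by (auto simp: vec.span_singleton)
      with w have "t \<noteq> 0" by auto
      then have "u i = (1 / t) *s w" by (simp add: t)
      then have "u i \<in> J" using J w vec.subspace_scale by metis
      then have "vec.span {u i} \<subseteq> J" using J by (intro vec.span_minimal) auto
      with J show ?thesis by blast
    qed
  qed
  have "v \<in> vec.span (\<Union>{I. minimal_ideal m I})" for v
  proof -
    obtain c where "v = (\<Sum>i\<in>UNIV. c i *s u i)" using span by blast
    moreover have "u i \<in> \<Union>{I. minimal_ideal m I}" for i
      using min[of i] vec.span_base[of "u i" "{u i}"] by blast
    ultimately show ?thesis
      by (simp only:) (rule vec.span_sum, rule vec.span_scale, rule vec.span_base)
  qed
  from UNIV_eq_I[OF this, symmetric] show ?thesis unfolding semisimple_alg_def .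
qed

text \<open>Among the nonzero p and the nonzero v in J with p(T) v = 0, take a pair with p of least
  degree. A root a of p splits off a linear factor; by minimality the cofactor does not kill v, and
  its value at v is an eigenvector for a.\<close>

lemma polynomial_eigenvector:
  fixes T :: "complex^'i::finite \<Rightarrow> complex^'i"
  assumes lin: "Vector_Spaces.linear (*s) (*s) T" and w: "w \<noteq> 0" "vec.subspace J" "w \<in> J" "\<And>x. x \<in> J \<Longrightarrow> T x \<in> J"
  shows "\<exists>v\<in>J. v \<noteq> 0 \<and> (\<exists>a. T v = a *s v)"
proof -
  interpret T: Vector_Spaces.linear "(*s)" "(*s)" T by (rule lin)
  \<comment> \<open>\<open>ap p v\<close> is p(T) v.\<close>
  define ap where "ap p v = (\<Sum>k\<le>degree p. coeff p k *s (T ^^ k) v)" for p v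
  have ap_ge: "ap p v = (\<Sum>k\<le>n. coeff p k *s (T ^^ k) v)" if "degree p \<le> n" for p v n
    unfolding ap_def using that
    by (intro sum.mono_neutral_left) (auto simp: coeff_eq_0)
  have ap_lin: "ap ([:- a, 1:] * q) v = T (ap q v) - a *s ap q v" for a q v
  proof -
    have "degree ([:- a, 1:] * q) \<le> Suc (degree q)"
      using degree_mult_le[of "[:- a, 1:]" q] by simp
    then have "ap ([:- a, 1:] * q) v = (\<Sum>k\<le>Suc (degree q). coeff ([:- a, 1:] * q) k *s (T ^^ k) v)"
      by (rule ap_ge)
    also have "\<dots> = (\<Sum>k\<le>Suc (degree q). coeff (pCons 0 q) k *s (T ^^ k) v) - (\<Sum>k\<le>Suc (degree q). (a * coeff q k) *s (T ^^ k) v)"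
    proof -
      have "coeff ([:- a, 1:] * q) k = coeff (pCons 0 q) k - a * coeff q k" for k
        by (simp add: mult_pCons_left)
      then show ?thesis by (simp only: vec.scale_left_diff_distrib sum_subtractf)
    qed
    also have "(\<Sum>k\<le>Suc (degree q). coeff (pCons 0 q) k *s (T ^^ k) v) = (\<Sum>k\<le>degree q. coeff q k *s (T ^^ Suc k) v)"
      by (subst sum.atMost_Suc_shift) simp
    also have "\<dots> = T (ap q v)"
      by (simp add: ap_def T.sum T.scale)
    also have "(\<Sum>k\<le>Suc (degree q). (a * coeff q k) *s (T ^^ k) v) = a *s ap q v"
      by (simp add: ap_def coeff_eq_0 vec.scale_sum_right)
    finally show ?thesis .
  qed
  have apJ: "ap p v \<in> J" if "v \<in> J" for p v
  proof -
    have "(T ^^ k) v \<in> J" for k by (induction k) (use that w(4) in auto)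
    then show ?thesis unfolding ap_def by (intro vec.subspace_sum w(2) vec.subspace_scale)
  qed
  have "\<exists>p. p \<noteq> 0 \<and> ap p w = 0"
  proof -
    let ?N = "CARD('i)"
    define g where "g k = (T ^^ k) w" for k
    show ?thesis
    \<comment> \<open>Independence is a property of sets, so two equal iterates are treated apart;
      they give the relation X^k - X^l.\<close>
    proof (cases "inj_on g {..?N}")
      case False
      then obtain k l where kl: "k \<le> ?N" "l \<le> ?N" "k \<noteq> l" "g k = g l" by (auto simp: inj_on_def)
      let ?p = "monom 1 k - monom (1::complex) l"
      have c: "coeff ?p j = (if j = k then 1 else 0) - (if j = l then 1 else 0)" for j
        by (simp only: coeff_diff coeff_monom) (simp add: eq_commute)
      have "coeff ?p k \<noteq> 0" using kl by (simp only: c) simp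
      then have p0: "?p \<noteq> 0" by (metis coeff_0)
      have "ap ?p w = (\<Sum>j\<le>?N. coeff ?p j *s (T ^^ j) w)"
        by (rule ap_ge, rule degree_le) (use kl in \<open>auto simp: c\<close>)
      moreover have "coeff ?p j *s (T ^^ j) w = (if j = k then g j else 0) - (if j = l then g j else 0)" for j
        by (simp only: c g_def vec.scale_left_diff_distrib) simp
      ultimately have "ap ?p w = (\<Sum>j\<le>?N. if j = k then g j else 0) - (\<Sum>j\<le>?N. if j = l then g j else 0)"
        by (simp only: sum_subtractf)
      then have "ap ?p w = 0" using kl by simp
      with p0 show ?thesis by blast
    next
      case True
      have "\<not> vec.independent (g ` {..?N})"
      proof
        assume "vec.independent (g ` {..?N})"
        from vec.independent_card_le_dim[OF subset_UNIV this] True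
        show False by (simp add: card_image card_cart_basis)
      qed
      then obtain f where f: "\<exists>v\<in>g ` {..?N}. f v \<noteq> 0" "(\<Sum>v\<in>g ` {..?N}. f v *s v) = 0"
        by (subst (asm) vec.dependent_finite) auto
      define p where "p = (\<Sum>k\<le>?N. monom (f (g k)) k)"
      have c: "coeff p j = (if j \<le> ?N then f (g j) else 0)" for j
        unfolding p_def coeff_sum by simp
      obtain k where "k \<le> ?N" "f (g k) \<noteq> 0" using f(1) by auto
      then have "p \<noteq> 0" using c[of k] by force
      moreover have "ap p w = (\<Sum>j\<le>?N. coeff p j *s (T ^^ j) w)"
        by (rule ap_ge, rule degree_le) (auto simp: c)
      then have "ap p w = (\<Sum>j\<le>?N. f (g j) *s g j)" by (simp add: c g_def)
      then have "ap p w = 0" using f(2) True by (simp add: sum.reindex)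
      ultimately show ?thesis by blast
    qed
  qed
  then obtain p0 v0 where "p0 \<noteq> 0 \<and> v0 \<in> J \<and> v0 \<noteq> 0 \<and> ap p0 v0 = 0" using w by blast
  then have ex: "\<exists>n p v. p \<noteq> 0 \<and> v \<in> J \<and> v \<noteq> 0 \<and> ap p v = 0 \<and> degree p = n" by blast
  define n where "n = (LEAST n. \<exists>p v. p \<noteq> 0 \<and> v \<in> J \<and> v \<noteq> 0 \<and> ap p v = 0 \<and> degree p = n)"
  have "\<exists>p v. p \<noteq> 0 \<and> v \<in> J \<and> v \<noteq> 0 \<and> ap p v = 0 \<and> degree p = n"
    unfolding n_def using ex by (rule LeastI_ex)
  then obtain p v where p: "p \<noteq> 0" "v \<in> J" "v \<noteq> 0" "ap p v = 0" "degree p = n" by blast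
  have least: "ap q v \<noteq> 0" if "q \<noteq> 0" "degree q < n" for q
    using that not_less_Least[of "degree q" "\<lambda>n. \<exists>p v. p \<noteq> 0 \<and> v \<in> J \<and> v \<noteq> 0 \<and> ap p v = 0 \<and> degree p = n"] p(2,3)
    unfolding n_def[symmetric] by blast
  have "degree p \<noteq> 0"
  proof
    assume "degree p = 0"
    then obtain t where "p = [:t:]" using degree_eq_zeroE by blast
    with p show False by (simp add: ap_def)
  qed
  then have "\<not> constant (poly p)" by (simp add: constant_degree)
  from fundamental_theorem_of_algebra[OF this] obtain a where "poly p a = 0" ..
  then obtain q where q: "p = [:- a, 1:] * q" by (auto simp: poly_eq_0_iff_dvd)
  with p have q0: "q \<noteq> 0" by auto
  then have "degree p = Suc (degree q)" unfolding q by (subst degree_mult_eq) auto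
  then have "ap q v \<noteq> 0" using least q0 p(5) by simp
  moreover have "T (ap q v) = a *s ap q v" using p(4) ap_lin[of a q v] q by simp
  ultimately show ?thesis by (intro bexI[OF _ apJ[OF p(2), of q]]) auto
qed

text \<open>In a minimal ideal I, a nonzero eigenspace of multiplication by x is again an ideal,
  because products commute, hence all of I. So every vector of I is a common eigenvector of all
  multiplications, and a basis can be drawn from the union of the minimal ideals.\<close>

lemma semisimple_lines:
  fixes m :: "complex^'i::finite \<Rightarrow> complex^'i \<Rightarrow> complex^'i"
  assumes lin: "\<And>u. Vector_Spaces.linear (*s) (*s) (m u)"
    and comm: "\<And>u v. m u v = m v u" and assoc: "\<And>u v w. m (m u v) w = m u (m v w)"
    and ss: "semisimple_alg m"
  obtains u :: "'i \<Rightarrow> complex^'i" and \<chi>' where "\<And>v i. m v (u i) = \<chi>' i v *s u i"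
    "\<And>c. (\<Sum>i\<in>UNIV. c i *s u i) = 0 \<Longrightarrow> \<forall>i. c i = 0"
proof -
  have line: "\<exists>t. m x v = t *s v" if I: "minimal_ideal m I" and v: "v \<in> I" for I x v
  proof (cases "v = 0")
    case True
    then show ?thesis using vec.linear_0[OF lin[of x]] by simp
  next
    case False
    note id = I[unfolded minimal_ideal_def alg_ideal_def]
    obtain v1 a where v1: "v1 \<in> I" "v1 \<noteq> 0" "m x v1 = a *s v1"
      using polynomial_eigenvector[OF lin[of x] False _ v] id by blast
    let ?J = "{w \<in> I. m x w = a *s w}"
    have "alg_ideal m ?J"
      unfolding alg_ideal_def vec.subspace_def
    proof (intro conjI allI ballI impI)
      show "0 \<in> ?J" using id vec.subspace_0 vec.linear_0[OF lin[of x]] by auto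
    next
      fix w w' assume "w \<in> ?J" "w' \<in> ?J"
      then show "w + w' \<in> ?J"
        using id vec.subspace_add vec.linear_add[OF lin[of x]] by (auto simp: vec.scale_right_distrib)
    next
      fix t w assume "w \<in> ?J"
      then show "t *s w \<in> ?J"
        using id vec.subspace_scale vec.linear_scale[OF lin[of x]] by (auto simp: mult.commute)
    next
      fix y w assume "w \<in> ?J"
      moreover have "m x (m y w) = m y (m x w)" by (metis assoc comm)
      ultimately show "m y w \<in> ?J" using id vec.linear_scale[OF lin[of y]] by auto
    qed
    moreover have "?J \<noteq> {0}" using v1 by blast
    moreover have "\<forall>J. alg_ideal m J \<and> J \<subseteq> I \<longrightarrow> J = {0} \<or> J = I"
      using I by (simp add: minimal_ideal_def)
    from spec[OF this, of ?J] have "alg_ideal m ?J \<Longrightarrow> ?J = {0} \<or> ?J = I" by simp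
    ultimately have "?J = I" by simp
    with v show ?thesis by blast
  qed
  let ?T = "\<Union>{I. minimal_ideal m I}"
  obtain B where B: "B \<subseteq> ?T" "vec.independent B" "?T \<subseteq> vec.span B"
    using vec.maximal_independent_subset by blast
  have spB: "vec.span B = UNIV"
    using ss vec.span_mono[OF B(3)] by (auto simp: semisimple_alg_def vec.span_span)
  have fB: "finite B" using B(2) vec.independent_explicit by blast
  have "card B = CARD('i)"
    using vec.basis_card_eq_dim[OF subset_UNIV _ B(2)] spB by (simp add: card_cart_basis)
  then obtain u where u: "bij_betw u (UNIV::'i set) B"
    using finite_same_card_bij[of "UNIV::'i set" B] fB by auto
  have "\<exists>t. m v (u i) = t *s u i" for v i
  proof -
    have "u i \<in> ?T" using u B(1) by (auto simp: bij_betw_def)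
    then show ?thesis using line by blast
  qed
  then have ch: "m v (u i) = (SOME t. m v (u i) = t *s u i) *s u i" for v i by (rule someI_ex)
  have ind: "\<forall>i. c i = 0" if "(\<Sum>i\<in>UNIV. c i *s u i) = 0" for c
  proof
    fix i
    have "(\<Sum>x\<in>B. c (the_inv u x) *s x) = (\<Sum>i\<in>UNIV. c (the_inv u (u i)) *s u i)"
      using u by (intro sum.reindex_bij_betw[symmetric])
    also have "\<dots> = 0" using that u by (simp add: the_inv_f_f bij_betw_def)
    finally have "c (the_inv u (u i)) = 0"
      using B(2) u unfolding vec.independent_explicit by (auto simp: bij_betw_def)
    then show "c i = 0" using u by (simp add: the_inv_f_f bij_betw_def)
  qed
  show ?thesis by (rule that[of u "\<lambda>i v. SOME t. m v (u i) = t *s u i", OF ch ind])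
qed

section \<open>Krylov matrices, Cramer's rule and the Vandermonde argument\<close>

lemma bij_index:
  obtains \<iota> :: "'i::finite \<Rightarrow> nat" where "bij_betw \<iota> UNIV {..<CARD('i)}"
  using ex_bij_betw_finite_nat[OF finite, of "UNIV :: 'i set"] by (auto simp: atLeast0LessThan)

lemma det_nonzero_iff: "det (A :: complex^'i::finite^'i) \<noteq> 0 \<longleftrightarrow> (\<forall>x. A *v x = 0 \<longrightarrow> x = 0)"
  unfolding invertible_det_nz[symmetric] invertible_left_inverse matrix_left_invertible_ker ..

definition kry :: "complex^'i::finite^'i \<Rightarrow> complex^'i \<Rightarrow> nat \<Rightarrow> complex^'i" where
  "kry L v k = ((*v) L ^^ k) v"

lemma kry_0 [simp]: "kry L v 0 = v" and kry_Suc [simp]: "kry L v (Suc k) = L *v kry L v k"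
  by (simp_all add: kry_def)

definition krylov :: "complex^'i::finite^'i \<Rightarrow> complex^'i \<Rightarrow> ('i \<Rightarrow> nat) \<Rightarrow> complex^'i^'i" where
  "krylov L v \<iota> = (\<chi> \<alpha> k. kry L v (\<iota> k) $ \<alpha>)"

lemma krylov_mult: "krylov L v \<iota> *v c = (\<Sum>k\<in>UNIV. c $ k *s kry L v (\<iota> k))"
  by (simp add: krylov_def matrix_mult_sum column_def)

text \<open>Cramer's numerator for the k-th coefficient of the basis vector \<alpha> in terms of the
  Krylov vectors; a polynomial in the entries of L for fixed v.\<close>

definition kcoef :: "complex^'i::finite^'i \<Rightarrow> complex^'i \<Rightarrow> ('i \<Rightarrow> nat) \<Rightarrow> 'i \<Rightarrow> 'i \<Rightarrow> complex" where
  "kcoef L v \<iota> \<alpha> k = det (\<chi> i j. if j = k then axis \<alpha> 1 $ i else krylov L v \<iota> $ i $ j)"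

lemma kcoef_expand:
  assumes "det (krylov L v \<iota>) \<noteq> 0"
  shows "axis \<alpha> 1 = (\<Sum>k\<in>UNIV. (kcoef L v \<iota> \<alpha> k / det (krylov L v \<iota>)) *s kry L v (\<iota> k))"
proof -
  have "krylov L v \<iota> *v (\<chi> k. kcoef L v \<iota> \<alpha> k / det (krylov L v \<iota>)) = axis \<alpha> 1"
    unfolding cramer[OF assms] by (simp add: kcoef_def)
  then show ?thesis by (simp add: krylov_mult)
qed

text \<open>The Vandermonde determinant in disguise: a nonzero polynomial of degree below N has
  fewer than N roots.\<close>

lemma distinct_roots_zero:
  fixes a :: "'i::finite \<Rightarrow> complex"
  assumes a: "inj a" and \<iota>: "bij_betw \<iota> (UNIV :: 'i set) {..<CARD('i)}"
    and z: "\<And>i. (\<Sum>k\<in>UNIV. c k * a i ^ \<iota> k) = 0"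
  shows "c k = 0"
proof -
  define p where "p = (\<Sum>k\<in>UNIV. monom (c k) (\<iota> k))"
  have coeff: "coeff p (\<iota> k) = c k" for k
  proof -
    have "coeff p (\<iota> k) = (\<Sum>l\<in>UNIV. if l = k then c k else 0)"
      unfolding p_def coeff_sum using \<iota> by (intro sum.cong) (auto simp: bij_betw_def inj_eq)
    then show ?thesis by simp
  qed
  have "p = 0"
  proof (rule ccontr)
    assume p: "p \<noteq> 0"
    have "degree p \<le> CARD('i) - 1"
      unfolding p_def
    proof (rule degree_sum_le)
      fix k :: 'i
      have "\<iota> k < CARD('i)" using \<iota> by (auto simp: bij_betw_def)
      then show "degree (monom (c k) (\<iota> k)) \<le> CARD('i) - 1"
        using degree_monom_le[of "c k" "\<iota> k"] by linarith
    qed simp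
    moreover have "range a \<subseteq> {x. poly p x = 0}"
      using z by (auto simp: p_def poly_sum poly_monom)
    then have "card (range a) \<le> card {x. poly p x = 0}"
      by (rule card_mono[OF poly_roots_finite[OF p]])
    then have "CARD('i) \<le> degree p"
      using card_poly_roots_bound[OF p] by (simp add: card_image[OF a])
    moreover have "CARD('i) > 0" by (rule zero_less_card_finite)
    ultimately show False by linarith
  qed
  with coeff[of k] show ?thesis by simp
qed

lemma sum_product3:
  "(\<Sum>k\<in>K. f k) * (\<Sum>l\<in>L. g l) * (\<Sum>p\<in>P. h p) * c = (\<Sum>k\<in>K. \<Sum>l\<in>L. \<Sum>p\<in>P. f k * g l * h p * c)"
  for c :: complex
proof -
  have "(\<Sum>k\<in>K. f k) * (\<Sum>l\<in>L. g l) * (\<Sum>p\<in>P. h p) * c = (\<Sum>k\<in>K. f k) * ((\<Sum>l\<in>L. g l) * (\<Sum>p\<in>P. h p * c))"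
    by (simp only: mult.assoc sum_distrib_right[of h])
  also have "\<dots> = (\<Sum>k\<in>K. \<Sum>l\<in>L. \<Sum>p\<in>P. f k * (g l * (h p * c)))"
    by (simp only: sum_product) (simp only: sum_distrib_left)
  finally show ?thesis by (simp only: mult.assoc)
qed

context frobenius
begin

text \<open>A product of two different \<open>u i\<close> lies in two independent lines and
  vanishes, so invariance makes the lines orthogonal: <u_i, u_j> = <u_i u_j, 1> = 0. Nondegeneracy
  of the form then gives \<open>\<eta> i \<noteq> 0\<close>, pairing with the unit identifies the
  character \<open>\<chi>' i\<close>, and expanding two basis vectors in the frame gives C.\<close>

lemma ideal_frame:
  fixes u :: "'i \<Rightarrow> complex^'i"
  assumes sym: "\<And>\<alpha> \<beta> \<gamma>. C \<alpha> \<beta> \<gamma> = C \<beta> \<alpha> \<gamma>" "\<And>\<alpha> \<beta> \<gamma>. C \<alpha> \<beta> \<gamma> = C \<alpha> \<gamma> \<beta>"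
    and unit: "\<And>v. mult C (axis e0 1) v = v"
    and ideal: "\<And>v i. mult C v (u i) = \<chi>' i v *s u i"
    and ind: "\<And>c. (\<Sum>i\<in>UNIV. c i *s u i) = 0 \<Longrightarrow> \<forall>i. c i = 0"
  defines "z \<equiv> \<lambda>i. G *v u i" and "\<eta> \<equiv> \<lambda>i. clin (G *v u i) (u i)"
  shows "clin (z i) (u j) = (if i = j then \<eta> i else 0)" "\<eta> i \<noteq> 0" "z i $ e0 \<noteq> 0"
    and "\<chi>' i v = clin (z i) v / z i $ e0"
    and "C \<alpha> \<beta> \<gamma> = (\<Sum>i\<in>UNIV. z i $ \<alpha> * z i $ \<beta> * z i $ \<gamma> / (\<eta> i * z i $ e0))"
proof -
  let ?e = "axis e0 1"
  have comm: "mult C v w = mult C w v" for v w by (simp add: mult_def cvec_commute[of C, OF sym(1)])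
  have G: "clin (G *v mult C v w) x = clin (cvec C v w) x" for v w x by simp
  note sw = clin_cvec_swap[of C, OF sym(2)] and cm = cvec_commute[of C, OF sym(1)]
  have uz: "u i \<noteq> 0" for i
  proof
    assume "u i = 0"
    then have "(\<Sum>j\<in>UNIV. (if j = i then 1 else 0) *s u j) = 0"
      by (intro sum.neutral) auto
    from ind[OF this] show False by (metis zero_neq_one)
  qed
  have orth: "clin (G *v u i) (u j) = 0" if "i \<noteq> j" for i j
  proof -
    have "\<chi>' j (u i) *s u j = \<chi>' i (u j) *s u i" using comm[of "u i" "u j"] by (simp add: ideal)
    \<comment> \<open>The equality of the two products is written as a vanishing combination of the
      whole family, to which independence applies.\<close>
    moreover have "(\<Sum>k\<in>UNIV. (if k = j then \<chi>' j (u i) else if k = i then - \<chi>' i (u j) else 0) *s u k)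
      = (\<Sum>k\<in>{i, j}. (if k = j then \<chi>' j (u i) else if k = i then - \<chi>' i (u j) else 0) *s u k)"
      by (rule sum.mono_neutral_right) auto
    ultimately have "(\<Sum>k\<in>UNIV. (if k = j then \<chi>' j (u i) else if k = i then - \<chi>' i (u j) else 0) *s u k) = 0"
      using that by simp
    from ind[OF this] have "\<chi>' j (u i) = 0" by (metis (full_types))
    then have 0: "mult C (u i) (u j) = 0" by (simp add: ideal)
    have "clin (G *v u i) (u j) = clin (cvec C ?e (u i)) (u j)" using G[of ?e "u i"] by (simp add: unit)
    also have "\<dots> = clin (cvec C (u i) (u j)) ?e" using sw cm by metis
    also have "\<dots> = 0" using G[of "u i" "u j" ?e] 0 by (simp add: clin.zero_left)
    finally show ?thesis .
  qed
  have eta: "\<eta> i \<noteq> 0" for i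
  proof
    assume "\<eta> i = 0"
    then have 0: "clin (G *v u i) (u j) = 0" for j using orth[of i j] by (cases "i = j") (auto simp: \<eta>_def)
    have "clin (G *v u i) v = 0" for v
    proof -
      obtain c where "v = (\<Sum>i\<in>UNIV. c i *s u i)" using independent_family_spans[OF ind] by blast
      then show ?thesis by (simp add: clin.sum_right clin_smult 0)
    qed
    then have "G *v u i = 0" using clin_eq_0_iff by blast
    then have "S *v (G *v u i) = 0" by simp
    with uz show False by simp
  qed
  \<comment> \<open>Both sides are <v u_i, 1>.\<close>
  have chi: "clin (z i) v = \<chi>' i v * z i $ e0" for i v
  proof -
    have "\<chi>' i v * z i $ e0 = clin (G *v mult C v (u i)) ?e"
      by (simp add: ideal vec.scale z_def clin_smult_left)
    also have "\<dots> = clin (cvec C v ?e) (u i)" using sw G by metis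
    also have "\<dots> = clin (G *v v) (u i)" using G[of v ?e "u i"] unit[of v] comm by metis
    also have "\<dots> = clin (z i) v" using clin_G clin_commute z_def by metis
    finally show ?thesis ..
  qed
  have z0: "z i $ e0 \<noteq> 0" for i using chi[of i "u i"] eta[of i] by (auto simp: z_def \<eta>_def)
  show "clin (z i) (u j) = (if i = j then \<eta> i else 0)" using orth by (simp add: z_def \<eta>_def)
  show "\<eta> i \<noteq> 0" by (rule eta)
  show "z i $ e0 \<noteq> 0" by (rule z0)
  show chi': "\<chi>' i v = clin (z i) v / z i $ e0" for i v using chi[of i v] z0[of i] by simp
  have fr: "clin (z i) (S *v z j) = (if i = j then \<eta> i else 0)" for i j
    using orth by (simp add: z_def \<eta>_def)
  have "axis \<beta> 1 = (\<Sum>i\<in>UNIV. (z i $ \<beta> / \<eta> i) *s u i)"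
    using frame_expand[of z \<eta> "axis \<beta> 1", OF fr eta] by (simp add: z_def)
  then have "mult C (axis \<alpha> 1) (axis \<beta> 1) = (\<Sum>i\<in>UNIV. (z i $ \<beta> / \<eta> i) *s ((z i $ \<alpha> / z i $ e0) *s u i))"
    by (simp add: mult_sum mult_smult ideal chi')
  then have "cvec C (axis \<alpha> 1) (axis \<beta> 1) = (\<Sum>i\<in>UNIV. (z i $ \<beta> / \<eta> i) *s ((z i $ \<alpha> / z i $ e0) *s z i))"
    using G_mult[of C "axis \<alpha> 1" "axis \<beta> 1"] by (simp add: vec.sum vec.scale z_def)
  then have "C \<alpha> \<beta> \<gamma> = (\<Sum>i\<in>UNIV. (z i $ \<beta> / \<eta> i) *s ((z i $ \<alpha> / z i $ e0) *s z i)) $ \<gamma>"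
    using cvec_axis by metis
  then show "C \<alpha> \<beta> \<gamma> = (\<Sum>i\<in>UNIV. z i $ \<alpha> * z i $ \<beta> * z i $ \<gamma> / (\<eta> i * z i $ e0))"
    by (simp add: sum_component mult_ac)
qed

text \<open>By total symmetry the Euler field may be contracted into any slot of C.\<close>

lemma mult_Euler:
  assumes sym: "\<And>\<alpha> \<beta> \<gamma>. C \<alpha> \<beta> \<gamma> = C \<beta> \<alpha> \<gamma>" "\<And>\<alpha> \<beta> \<gamma>. C \<alpha> \<beta> \<gamma> = C \<alpha> \<gamma> \<beta>"
    and M: "\<And>\<alpha> \<beta>. M $ \<alpha> $ \<beta> = (\<Sum>\<gamma>\<in>UNIV. E $ \<gamma> * C \<alpha> \<beta> \<gamma>)"
  shows "mult C E v = (S ** M) *v v"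
proof -
  have "cvec C E v $ \<delta> = (M *v v) $ \<delta>" for \<delta>
  proof -
    have "cvec C E v $ \<delta> = (\<Sum>\<beta>\<in>UNIV. \<Sum>\<alpha>\<in>UNIV. E $ \<alpha> * v $ \<beta> * C \<alpha> \<beta> \<delta>)"
      unfolding cvec_def vec_lambda_beta by (rule sum.swap)
    also have "\<dots> = (\<Sum>\<beta>\<in>UNIV. \<Sum>\<alpha>\<in>UNIV. E $ \<alpha> * C \<delta> \<beta> \<alpha> * v $ \<beta>)"
    proof (intro sum.cong refl)
      fix \<alpha> \<beta>
      have "C \<alpha> \<beta> \<delta> = C \<delta> \<beta> \<alpha>" using sym by metis
      then show "E $ \<alpha> * v $ \<beta> * C \<alpha> \<beta> \<delta> = E $ \<alpha> * C \<delta> \<beta> \<alpha> * v $ \<beta>" by simp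
    qed
    also have "\<dots> = (M *v v) $ \<delta>" by (simp add: matrix_vector_mult_def M sum_distrib_right)
    finally show ?thesis .
  qed
  then have "cvec C E v = M *v v" by (simp add: vec_eq_iff)
  then show ?thesis by (simp add: mult_def matrix_vector_mul_assoc)
qed

text \<open>Every multiplication commutes with multiplication by E and so preserves its eigenspaces,
  which are lines because the eigenvalues are simple.\<close>

lemma eigen_ideals:
  fixes z :: "'i \<Rightarrow> complex^'i"
  assumes comm: "\<And>v w. mult C v w = mult C w v"
    and assoc: "\<And>v w x. mult C (mult C v w) x = mult C v (mult C w x)"
    and E: "\<And>v. mult C E v = (S ** M) *v v"
    and ev: "\<And>i. (M ** S) *v z i = a i *s z i" and nz: "\<And>i. z i \<noteq> 0" and inj: "inj a"
  shows "\<exists>\<chi>'. \<forall>v i. mult C v (S *v z i) = \<chi>' i v *s (S *v z i)"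
    and "\<And>c. (\<Sum>i\<in>UNIV. c i *s (S *v z i)) = 0 \<Longrightarrow> \<forall>i. c i = 0"
proof -
  let ?u = "\<lambda>i. S *v z i"
  have ev': "(S ** M) *v ?u i = a i *s ?u i" for i
    using arg_cong[OF ev[of i], of "(*v) S"] by (simp add: vec.scale matrix_vector_mul_assoc[symmetric])
  have nz': "?u i \<noteq> 0" for i
  proof
    assume "?u i = 0"
    then have "G *v ?u i = G *v 0" by simp
    then show False using nz[of i] by (simp only: G_S vec.zero)
  qed
  show "\<forall>i. c i = 0" if "(\<Sum>i\<in>UNIV. c i *s ?u i) = 0" for c
    using eigenvectors_independent[of "S ** M" ?u a, OF ev' nz' inj finite that] by simp
  have "\<exists>t. mult C v (?u i) = t *s ?u i" for v i
  proof (cases "mult C v (?u i) = 0")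
    case True
    then have "mult C v (?u i) = 0 *s ?u i" by simp
    then show ?thesis by blast
  next
    case False
    have "mult C E (mult C v (?u i)) = mult C v (mult C E (?u i))" using assoc comm by metis
    then have "(S ** M) *v mult C v (?u i) = a i *s mult C v (?u i)"
      by (simp only: E ev' mult_smult)
    from eigenspace_line[of "S ** M" ?u a, OF ev' nz' inj this False] obtain j t
      where "a i = a j" "mult C v (?u i) = t *s ?u j" by blast
    with inj show ?thesis by (auto simp: inj_def)
  qed
  then have "mult C v (?u i) = (SOME t. mult C v (?u i) = t *s ?u i) *s ?u i" for v i by (rule someI_ex)
  then show "\<exists>\<chi>'. \<forall>v i. mult C v (?u i) = \<chi>' i v *s ?u i"
    by (intro exI[of _ "\<lambda>i v. SOME t. mult C v (?u i) = t *s ?u i"] allI)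
qed

text \<open>\<open>M ** S\<close> is self-adjoint for the form S on covectors, so distinct
  eigenvalues give orthogonal eigenvectors.\<close>

lemma eigen_orthogonal:
  fixes z :: "'i \<Rightarrow> complex^'i"
  assumes symM: "transpose M = M" and ev: "\<And>i. (M ** S) *v z i = a i *s z i" and inj: "inj a" and "i \<noteq> j"
  shows "clin (z i) (S *v z j) = 0"
proof -
  have "a i * clin (z i) (S *v z j) = clin ((M ** S) *v z i) (S *v z j)" by (simp add: ev clin_smult_left)
  also have "\<dots> = clin (S *v z i) (M *v (S *v z j))"
    by (simp only: matrix_vector_mul_assoc[symmetric] clin_matrix[of _ M] symM)
  also have "\<dots> = clin (S *v z i) (a j *s z j)" by (simp only: matrix_vector_mul_assoc ev)
  also have "\<dots> = a j * clin (z i) (S *v z j)" by (simp add: clin_smult clin_S)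
  finally show ?thesis using inj assms(4) by (auto simp: inj_def)
qed

text \<open>The functionals sending v to \<open>clin (z i) v / z i $ e0\<close> turn the product
  into the componentwise one, take the value 1 on the unit and separate points; every algebra law is
  then checked in each component.\<close>

lemma frame_algebra:
  fixes z :: "'i \<Rightarrow> complex^'i"
  assumes orth: "\<And>i j. clin (z i) (S *v z j) = (if i = j then \<eta> i else 0)" and nz: "\<And>i. \<eta> i \<noteq> 0"
    and z0: "\<And>i. z i $ e0 \<noteq> 0"
    and C: "\<And>\<alpha> \<beta> \<gamma>. C \<alpha> \<beta> \<gamma> = (\<Sum>i\<in>UNIV. z i $ \<alpha> * z i $ \<beta> * z i $ \<gamma> / (\<eta> i * z i $ e0))"
  shows "mult C v w = mult C w v" "mult C (axis e0 1) v = v" "mult C (mult C v w) x = mult C v (mult C w x)"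
    "semisimple_alg (mult C)"
proof -
  note expand = frame_expand[of z \<eta>, OF orth nz]
  have cv: "cvec C v w $ \<gamma> = (\<Sum>i\<in>UNIV. clin (z i) v * clin (z i) w * z i $ \<gamma> / (\<eta> i * z i $ e0))" for v w \<gamma>
  proof -
    have "cvec C v w $ \<gamma> = (\<Sum>\<alpha>\<in>UNIV. \<Sum>\<beta>\<in>UNIV. \<Sum>i\<in>UNIV. v $ \<alpha> * w $ \<beta> * (z i $ \<alpha> * z i $ \<beta> * z i $ \<gamma> / (\<eta> i * z i $ e0)))"
      by (simp add: cvec_def C sum_distrib_left)
    also have "\<dots> = (\<Sum>i\<in>UNIV. \<Sum>\<alpha>\<in>UNIV. \<Sum>\<beta>\<in>UNIV. v $ \<alpha> * w $ \<beta> * (z i $ \<alpha> * z i $ \<beta> * z i $ \<gamma> / (\<eta> i * z i $ e0)))"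
      by (rule sum_rotate[symmetric])
    also have "\<dots> = (\<Sum>i\<in>UNIV. clin (z i) v * clin (z i) w * z i $ \<gamma> / (\<eta> i * z i $ e0))"
    proof (rule sum.cong[OF refl])
      fix i
      have "(\<Sum>\<alpha>\<in>UNIV. \<Sum>\<beta>\<in>UNIV. v $ \<alpha> * w $ \<beta> * (z i $ \<alpha> * z i $ \<beta> * z i $ \<gamma> / (\<eta> i * z i $ e0)))
        = (\<Sum>\<alpha>\<in>UNIV. \<Sum>\<beta>\<in>UNIV. (z i $ \<alpha> * v $ \<alpha>) * (z i $ \<beta> * w $ \<beta>) * (z i $ \<gamma> / (\<eta> i * z i $ e0)))"
        by (intro sum.cong refl) simp
      also have "\<dots> = clin (z i) v * clin (z i) w * (z i $ \<gamma> / (\<eta> i * z i $ e0))"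
        by (simp only: clin_def sum_product) (simp only: sum_distrib_right)
      finally show "(\<Sum>\<alpha>\<in>UNIV. \<Sum>\<beta>\<in>UNIV. v $ \<alpha> * w $ \<beta> * (z i $ \<alpha> * z i $ \<beta> * z i $ \<gamma> / (\<eta> i * z i $ e0)))
        = clin (z i) v * clin (z i) w * z i $ \<gamma> / (\<eta> i * z i $ e0)" by simp
    qed
    finally show ?thesis .
  qed
  have chi: "clin (z j) (mult C v w) = clin (z j) v * clin (z j) w / z j $ e0" for j v w
  proof -
    have "cvec C v w = (\<Sum>i\<in>UNIV. (clin (z i) v * clin (z i) w / (\<eta> i * z i $ e0)) *s z i)"
      by (simp add: vec_eq_iff cv sum_component)
    then have "mult C v w = (\<Sum>i\<in>UNIV. (clin (z i) v * clin (z i) w / (\<eta> i * z i $ e0)) *s (S *v z i))"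
      by (simp add: mult_def vec.sum vec.scale)
    then have "clin (z j) (mult C v w) = (\<Sum>i\<in>UNIV. if i = j then clin (z j) v * clin (z j) w / (\<eta> j * z j $ e0) * \<eta> j else 0)"
      by (simp only: clin.sum_right clin_smult orth) (intro sum.cong refl, simp)
    then show ?thesis using nz[of j] by simp
  qed
  have ext: "v = w" if "\<And>i. clin (z i) v = clin (z i) w" for v w
  proof -
    have "v = (\<Sum>i\<in>UNIV. (clin (z i) v / \<eta> i) *s (S *v z i))" by (rule expand)
    also have "\<dots> = w" unfolding that by (rule expand[symmetric])
    finally show ?thesis .
  qed
  show "mult C v w = mult C w v" for v w by (rule ext) (simp add: chi)
  show "mult C (axis e0 1) v = v" for v by (rule ext) (simp add: chi z0)
  show "mult C (mult C v w) x = mult C v (mult C w x)" for v w x by (rule ext) (simp add: chi)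
  show "semisimple_alg (mult C)"
  proof (rule lines_semisimple)
    show "mult C v (S *v z i) = (clin (z i) v / z i $ e0) *s (S *v z i)" for v i
      by (rule ext) (simp add: chi orth clin_smult)
    show "mult C v (t *s w) = t *s mult C v w" for v w t by (rule mult_smult)
    show "S *v z i \<noteq> 0" for i using orth[of i i] nz[of i] by (auto simp: clin.zero_right)
    show "\<exists>c. v = (\<Sum>i\<in>UNIV. c i *s (S *v z i))" for v using expand by metis
  qed
qed

text \<open>The Krylov vectors of the unit are the powers of the Euler field, and the functions
  \<open>\<lambda>v. clin (z i) v / z i $ e0\<close> are the characters of the algebra.\<close>

lemma clin_kry:
  fixes z :: "'i \<Rightarrow> complex^'i"
  assumes symM: "transpose M = M" and ev: "\<And>i. (M ** S) *v z i = a i *s z i"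
  shows "clin (z i) (kry (S ** M) (axis e0 1) k) = a i ^ k * z i $ e0"
proof (induction k)
  case (Suc k)
  have "clin (z i) ((S ** M) *v w) = a i * clin (z i) w" for w
  proof -
    have "transpose (S ** M) = M ** S" by (simp add: matrix_transpose_mul symM symS)
    then show ?thesis by (simp add: clin_matrix ev clin_smult_left)
  qed
  with Suc show ?case by simp
qed simp

text \<open>Evaluated on the characters, a kernel vector of the Krylov matrix becomes a polynomial
  of degree below the dimension that vanishes at all eigenvalues.\<close>

lemma det_krylov_nonzero:
  fixes z :: "'i \<Rightarrow> complex^'i"
  assumes symM: "transpose M = M" and ev: "\<And>i. (M ** S) *v z i = a i *s z i"
    and a: "inj a" and z0: "\<And>i. z i $ e0 \<noteq> 0" and \<iota>: "bij_betw \<iota> (UNIV :: 'i set) {..<CARD('i)}"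
  shows "det (krylov (S ** M) (axis e0 1) \<iota>) \<noteq> 0"
  unfolding det_nonzero_iff
proof (intro allI impI)
  fix c assume c: "krylov (S ** M) (axis e0 1) \<iota> *v c = 0"
  have "(\<Sum>k\<in>UNIV. c $ k * a i ^ \<iota> k) = 0" for i
  proof -
    have "(\<Sum>k\<in>UNIV. c $ k * a i ^ \<iota> k) * z i $ e0 = clin (z i) (krylov (S ** M) (axis e0 1) \<iota> *v c)"
      by (simp add: krylov_mult clin.sum_right clin_smult clin_kry[of M z a, OF symM ev] sum_distrib_right mult.assoc)
    then show ?thesis using z0[of i] by (simp add: c clin.zero_right)
  qed
  then have "c $ k = 0" for k by (rule distinct_roots_zero[OF a \<iota>])
  then show "c = 0" by (simp add: vec_eq_iff)
qed

text \<open>Eliminates the eigenvectors. Each coordinate of \<open>z i\<close> is a polynomial in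
  \<open>a i\<close> times the coordinate at \<open>e0\<close>, so a summand on the left is a
  polynomial in \<open>a i\<close> with the weight (\<open>z i $ e0\<close>)^2 /
  \<open>\<eta> i\<close>; the power sums with these weights are the \<open>e0\<close> entries of G
  applied to Krylov vectors.\<close>

lemma R_krylov:
  fixes z :: "'i \<Rightarrow> complex^'i"
  assumes symM: "transpose M = M" and ev: "\<And>i. (M ** S) *v z i = a i *s z i"
    and orth: "\<And>i j. clin (z i) (S *v z j) = (if i = j then \<eta> i else 0)" and nz: "\<And>i. \<eta> i \<noteq> 0"
    and z0: "\<And>i. z i $ e0 \<noteq> 0"
    and B: "\<And>\<alpha>. axis \<alpha> 1 = (\<Sum>k\<in>UNIV. b \<alpha> k *s kry (S ** M) (axis e0 1) (\<iota> k))"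
  shows "(\<Sum>i\<in>UNIV. z i $ \<alpha> * z i $ \<beta> * z i $ \<gamma> / (\<eta> i * z i $ e0))
    = (\<Sum>k\<in>UNIV. \<Sum>l\<in>UNIV. \<Sum>p\<in>UNIV. b \<alpha> k * b \<beta> l * b \<gamma> p * (G *v kry (S ** M) (axis e0 1) (\<iota> k + \<iota> l + \<iota> p)) $ e0)"
proof -
  let ?t = "\<lambda>i k l p. b \<alpha> k * b \<beta> l * b \<gamma> p * ((z i $ e0)\<^sup>2 / \<eta> i * a i ^ (\<iota> k + \<iota> l + \<iota> p))"
  note ck = clin_kry[of M z a, OF symM ev]
  have zz: "z i $ \<alpha> = (\<Sum>k\<in>UNIV. b \<alpha> k * a i ^ \<iota> k) * z i $ e0" for i \<alpha>
  proof -
    have "z i $ \<alpha> = clin (z i) (\<Sum>k\<in>UNIV. b \<alpha> k *s kry (S ** M) (axis e0 1) (\<iota> k))"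
      by (simp add: B[symmetric])
    then show ?thesis by (simp add: clin.sum_right clin_smult ck sum_distrib_right mult.assoc)
  qed
  have s: "(G *v kry (S ** M) (axis e0 1) q) $ e0 = (\<Sum>i\<in>UNIV. (z i $ e0)\<^sup>2 / \<eta> i * a i ^ q)" for q
    by (simp add: frame_G[of z \<eta>, OF orth nz] ck power2_eq_square mult_ac)
  have "(\<Sum>i\<in>UNIV. z i $ \<alpha> * z i $ \<beta> * z i $ \<gamma> / (\<eta> i * z i $ e0))
    = (\<Sum>i\<in>UNIV. (\<Sum>k\<in>UNIV. b \<alpha> k * a i ^ \<iota> k) * (\<Sum>k\<in>UNIV. b \<beta> k * a i ^ \<iota> k) * (\<Sum>k\<in>UNIV. b \<gamma> k * a i ^ \<iota> k) * ((z i $ e0)\<^sup>2 / \<eta> i))"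
    by (intro sum.cong refl) (subst zz[of _ \<alpha>], subst zz[of _ \<beta>], subst zz[of _ \<gamma>], use z0 nz in \<open>simp add: power2_eq_square field_simps\<close>)
  also have "\<dots> = (\<Sum>i\<in>UNIV. \<Sum>k\<in>UNIV. \<Sum>l\<in>UNIV. \<Sum>p\<in>UNIV. ?t i k l p)"
  proof (rule sum.cong[OF refl])
    fix i
    have "(\<Sum>k\<in>UNIV. b \<alpha> k * a i ^ \<iota> k) * (\<Sum>k\<in>UNIV. b \<beta> k * a i ^ \<iota> k) * (\<Sum>k\<in>UNIV. b \<gamma> k * a i ^ \<iota> k) * ((z i $ e0)\<^sup>2 / \<eta> i)
      = (\<Sum>k\<in>UNIV. \<Sum>l\<in>UNIV. \<Sum>p\<in>UNIV. (b \<alpha> k * a i ^ \<iota> k) * (b \<beta> l * a i ^ \<iota> l) * (b \<gamma> p * a i ^ \<iota> p) * ((z i $ e0)\<^sup>2 / \<eta> i))"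
      by (rule sum_product3)
    also have "\<dots> = (\<Sum>k\<in>UNIV. \<Sum>l\<in>UNIV. \<Sum>p\<in>UNIV. ?t i k l p)"
      by (intro sum.cong refl) (simp add: power_add mult_ac)
    finally show "(\<Sum>k\<in>UNIV. b \<alpha> k * a i ^ \<iota> k) * (\<Sum>k\<in>UNIV. b \<beta> k * a i ^ \<iota> k) * (\<Sum>k\<in>UNIV. b \<gamma> k * a i ^ \<iota> k) * ((z i $ e0)\<^sup>2 / \<eta> i)
      = (\<Sum>k\<in>UNIV. \<Sum>l\<in>UNIV. \<Sum>p\<in>UNIV. ?t i k l p)" .
  qed
  also have "\<dots> = (\<Sum>k\<in>UNIV. \<Sum>l\<in>UNIV. \<Sum>i\<in>UNIV. \<Sum>p\<in>UNIV. ?t i k l p)" by (rule sum_rotate)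
  also have "\<dots> = (\<Sum>k\<in>UNIV. \<Sum>l\<in>UNIV. \<Sum>p\<in>UNIV. \<Sum>i\<in>UNIV. ?t i k l p)"
    by (rule sum.cong[OF refl], rule sum.cong[OF refl], rule sum.swap)
  also have "\<dots> = (\<Sum>k\<in>UNIV. \<Sum>l\<in>UNIV. \<Sum>p\<in>UNIV. b \<alpha> k * b \<beta> l * b \<gamma> p * (G *v kry (S ** M) (axis e0 1) (\<iota> k + \<iota> l + \<iota> p)) $ e0)"
    by (simp only: s sum_distrib_left)
  finally show ?thesis .
qed

end

section \<open>The intersection form of a Fano manifold\<close>

definition Gmat :: "('h::comm_ring_1, 'a::finite) fano_data \<Rightarrow> complex^('a option)^('a option)" where
  "Gmat D = (\<chi> \<alpha> \<beta>. g2 D \<alpha> \<beta>)"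

definition Smat :: "('h::comm_ring_1, 'a::finite) fano_data \<Rightarrow> complex^('a option)^('a option)" where
  "Smat D = (\<chi> \<alpha> \<beta>. gbar D \<alpha> \<beta>)"

abbreviation wt :: "('h::comm_ring_1, 'a::finite) fano_data \<Rightarrow> 'a option \<Rightarrow> 'a option \<Rightarrow> complex" where
  "wt D \<alpha> \<beta> \<equiv> 1 - of_nat (dimV D) + of_nat (deg D \<alpha>) + of_nat (deg D \<beta>)"

text \<open>For homogeneous f this is multiplication by the Euler field with its index lowered, as
  \<open>Mmat_third\<close> shows.\<close>

definition Mmat :: "('h::comm_ring_1, 'a::finite) fano_data \<Rightarrow> complex^('a option)^('a option) \<Rightarrow> complex^('a option)^('a option)" where
  "Mmat D Y = (\<chi> \<alpha> \<beta>. c2 D \<alpha> \<beta> + wt D \<alpha> \<beta> * Y $ \<alpha> $ \<beta>)"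

text \<open>Second derivatives of f with an index 0 are constants that depend on the quadratic part
  of f and do not enter \<open>Ymat\<close>; 0 stands in for them.\<close>

definition hess_ext :: "complex^'a^'a \<Rightarrow> 'a option \<Rightarrow> 'a option \<Rightarrow> complex" where
  "hess_ext y \<alpha> \<beta> = (case (\<alpha>, \<beta>) of (Some a, Some b) \<Rightarrow> y $ a $ b | _ \<Rightarrow> 0)"

lemma hess_ext_simps [simp]: "hess_ext y None \<beta> = 0" "hess_ext y \<alpha> None = 0" "hess_ext y (Some a) (Some b) = y $ a $ b"
  by (simp_all add: hess_ext_def split: option.split)

lemma Smat_eq: "Smat D = matrix_inv (Gmat D)"
  by (simp add: vec_eq_iff Smat_def Gmat_def gbar_def)

lemma eigen_system_iff:
  "eigen_system D Y a z \<longleftrightarrow> inj a \<and> (\<forall>i. z i \<noteq> 0) \<and> (\<forall>i. (Mmat D Y ** Smat D) *v z i = a i *s z i)"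
proof -
  have "((Mmat D Y ** Smat D) *v \<zeta>) $ \<alpha> = (\<Sum>\<beta>\<in>UNIV. \<Sum>\<gamma>\<in>UNIV. gbar D \<beta> \<gamma> *
        (c2 D \<alpha> \<beta> + wt D \<alpha> \<beta> * Y $ \<alpha> $ \<beta>) * \<zeta> $ \<gamma>)" for \<zeta> \<alpha>
    unfolding matrix_vector_mul_assoc[symmetric]
    by (simp add: matrix_vector_mult_def Mmat_def Smat_def sum_distrib_left sum_distrib_right mult_ac)
  then show ?thesis by (simp add: eigen_system_def vec_eq_iff)
qed

lemma R_denom_eq: "R_denom D \<zeta> = clin \<zeta> (Smat D *v \<zeta>) * \<zeta> $ None"
  by (simp add: R_denom_def clin_def matrix_vector_mult_def Smat_def sum_distrib_left sum_distrib_right mult_ac)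

lemma R_denom_smult: "R_denom D (t *s \<zeta>) = t ^ 3 * R_denom D \<zeta>"
  by (simp add: R_denom_eq vec.scale clin_smult clin_smult_left power3_eq_cube)

text \<open>The eigenvectors picked by \<open>SOME\<close> are nonzero multiples of those that
  witness \<open>R_dom\<close>, and the denominator is homogeneous of degree 3 in the eigenvector,
  so it stays nonzero.\<close>

lemma R_value:
  assumes "R_dom D Y"
  shows "\<exists>a z. eigen_system D Y a z \<and> (\<forall>i. R_denom D (z i) \<noteq> 0) \<and>
    (\<forall>\<alpha> \<beta> \<gamma>. R D Y \<alpha> \<beta> \<gamma> = (\<Sum>i\<in>UNIV. z i $ \<alpha> * z i $ \<beta> * z i $ \<gamma> / R_denom D (z i)))"
proof -
  obtain a' z' where 1: "eigen_system D Y a' z'" "\<forall>i. R_denom D (z' i) \<noteq> 0"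
    using assms by (auto simp: R_dom_def)
  define z where "z = (SOME z. \<exists>a. eigen_system D Y a z)"
  have "\<exists>a. eigen_system D Y a z"
    unfolding z_def by (rule someI[of "\<lambda>z. \<exists>a. eigen_system D Y a z" z']) (use 1 in blast)
  then obtain a where a: "eigen_system D Y a z" by blast
  have "R_denom D (z i) \<noteq> 0" for i
  proof -
    obtain j t where "t \<noteq> 0" "z i = t *s z' j"
      using eigenspace_line[of "Mmat D Y ** Smat D" z' a' "z i" "a i"] 1(1) a
      unfolding eigen_system_iff by blast
    with 1(2) show ?thesis by (simp add: R_denom_smult)
  qed
  moreover have "R D Y \<alpha> \<beta> \<gamma> = (\<Sum>i\<in>UNIV. z i $ \<alpha> * z i $ \<beta> * z i $ \<gamma> / R_denom D (z i))" for \<alpha> \<beta> \<gamma>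
    unfolding R_def Let_def z_def ..
  ultimately show ?thesis using a by blast
qed

lemma R_symmetric: "R D Y \<alpha> \<beta> \<gamma> = R D Y \<beta> \<alpha> \<gamma>" "R D Y \<alpha> \<beta> \<gamma> = R D Y \<alpha> \<gamma> \<beta>"
  by (simp_all add: R_def Let_def mult_ac)

lemma g3_symmetric: "g3 D \<alpha> \<beta> \<gamma> = g3 D \<beta> \<alpha> \<gamma>" "g3 D \<alpha> \<beta> \<gamma> = g3 D \<alpha> \<gamma> \<beta>"
  by (simp_all add: g3_def mult_ac)

lemma r_symmetric: "r D w y a b c = r D w y b a c" "r D w y a b c = r D w y a c b"
proof -
  show "r D w y a b c = r D w y b a c" unfolding r_def r_full_def
    by (simp only: R_symmetric(1)[of D _ "Some a" "Some b"] g3_symmetric(1)[of D "Some a" "Some b"])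
  show "r D w y a b c = r D w y a c b" unfolding r_def r_full_def
    by (simp only: R_symmetric(2)[of D _ "Some a" "Some b" "Some c"] g3_symmetric(2)[of D "Some a" "Some b" "Some c"])
qed

locale fano_manifold =
  fixes D :: "('h::comm_ring_1, 'a::finite) fano_data"
  assumes fano: "fano D"
begin

lemma fano_parts: "graded_algebra D" "poincare_duality D" "integral_structure D" "ample_chern1 D" "adapted_basis D"
  using fano by (simp_all add: fano_def)

sublocale H: vector_space "scl D"
  using fano_parts(1) by (simp add: graded_algebra_def)

lemma scl_mult: "scl D t u * v = scl D t (u * v)" "u * scl D t v = scl D t (u * v)"
proof -
  show 1: "scl D t u * v = scl D t (u * v)" for u v
    using fano_parts(1) by (simp add: graded_algebra_def)
  show "u * scl D t v = scl D t (u * v)" using 1[of v u] by (simp add: mult.commute)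
qed

lemma intg_linear: "Vector_Spaces.linear (scl D) (*) (intg D)"
  using fano_parts(2) by (simp add: poincare_duality_def)

lemma intg_add: "intg D (u + v) = intg D u + intg D v"
  and intg_scl: "intg D (scl D t u) = t * intg D u"
proof -
  interpret intg: Vector_Spaces.linear "scl D" "(*)" "intg D" by (rule intg_linear)
  show "intg D (u + v) = intg D u + intg D v" by (rule intg.add)
  show "intg D (scl D t u) = t * intg D u" by (rule intg.scale)
qed

lemma intg_0: "intg D 0 = 0"
  using intg_add[of 0 0] by simp

lemma intg_sum: "intg D (\<Sum>k\<in>K. f k) = (\<Sum>k\<in>K. intg D (f k))"
  by (induction K rule: infinite_finite_induct) (simp_all add: intg_add intg_0)

lemma cls_None [simp]: "cls D None = 1" "deg D None = 0"
  using fano_parts(5) by (simp_all add: adapted_basis_def)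

lemma cls_Hodge: "cls D \<alpha> \<in> Hodge D (deg D \<alpha>)"
  using fano_parts(5) by (simp add: adapted_basis_def)

lemma Hodge_mult: "u \<in> Hodge D p \<Longrightarrow> v \<in> Hodge D q \<Longrightarrow> u * v \<in> Hodge D (p + q)"
  using fano_parts(1) by (simp add: graded_algebra_def)

lemma intg_Hodge: "u \<in> Hodge D p \<Longrightarrow> p \<noteq> dimV D \<Longrightarrow> intg D u = 0"
  using fano_parts(2) by (simp add: poincare_duality_def)

lemma g3_degree: "g3 D \<alpha> \<beta> \<gamma> \<noteq> 0 \<Longrightarrow> deg D \<alpha> + deg D \<beta> + deg D \<gamma> = dimV D"
  using intg_Hodge[OF Hodge_mult[OF Hodge_mult[OF cls_Hodge cls_Hodge] cls_Hodge]] by (auto simp: g3_def)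

lemma g2_degree: "g2 D \<alpha> \<beta> \<noteq> 0 \<Longrightarrow> deg D \<alpha> + deg D \<beta> = dimV D"
  using intg_Hodge[OF Hodge_mult[OF cls_Hodge cls_Hodge]] by (auto simp: g2_def)

lemma g3_None [simp]: "g3 D None \<beta> \<gamma> = g2 D \<beta> \<gamma>"
  by (simp add: g3_def g2_def)

lemma g2_commute: "g2 D \<alpha> \<beta> = g2 D \<beta> \<alpha>"
  by (simp add: g2_def mult.commute)

lemma inj_cls: "inj (cls D)"
  using fano_parts(5) by (simp add: adapted_basis_def)

lemma cls_expand: "u = (\<Sum>\<alpha>\<in>UNIV. scl D (H.representation (range (cls D)) u (cls D \<alpha>)) (cls D \<alpha>))"
proof -
  have "u = (\<Sum>v\<in>range (cls D). scl D (H.representation (range (cls D)) u v) v)"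
    using fano_parts(5) H.sum_representation_eq[of "range (cls D)" u "range (cls D)"]
    by (simp add: adapted_basis_def)
  also have "\<dots> = (\<Sum>\<alpha>\<in>UNIV. scl D (H.representation (range (cls D)) u (cls D \<alpha>)) (cls D \<alpha>))"
    by (simp add: sum.reindex[OF inj_cls])
  finally show ?thesis .
qed

lemma cls_independent:
  assumes "(\<Sum>\<alpha>\<in>UNIV. scl D (c \<alpha>) (cls D \<alpha>)) = 0"
  shows "c \<alpha> = 0"
proof -
  have "(\<Sum>v\<in>range (cls D). scl D (c (the_inv (cls D) v)) v) = 0"
    using assms by (simp add: sum.reindex[OF inj_cls] the_inv_f_f[OF inj_cls])
  moreover have "\<not> H.dependent (range (cls D))" using fano_parts(5) by (simp add: adapted_basis_def)
  ultimately have "c (the_inv (cls D) (cls D \<alpha>)) = 0"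
    by (intro H.independentD[of "range (cls D)" "range (cls D)" "\<lambda>v. c (the_inv (cls D) v)"]) auto
  then show ?thesis by (simp add: the_inv_f_f[OF inj_cls])
qed

lemma intg_point: "intg D (point_of D x * u) = (\<Sum>\<gamma>\<in>UNIV. x $ \<gamma> * intg D (cls D \<gamma> * u))"
  by (simp add: point_of_def sum_distrib_right scl_mult intg_sum intg_scl)

lemma chern1_expand: "chern1 D = (\<Sum>\<alpha>\<in>UNIV. scl D (c_coord D \<alpha>) (cls D \<alpha>))"
  unfolding c_coord_def by (rule cls_expand)

lemma c2_eq: "c2 D \<alpha> \<beta> = (\<Sum>\<gamma>\<in>UNIV. c_coord D \<gamma> * g3 D \<alpha> \<beta> \<gamma>)"
proof -
  have "c2 D \<alpha> \<beta> = (\<Sum>\<gamma>\<in>UNIV. c_coord D \<gamma> * intg D (cls D \<gamma> * cls D \<alpha> * cls D \<beta>))"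
    unfolding c2_def chern1_expand by (simp add: sum_distrib_right scl_mult intg_sum intg_scl)
  then show ?thesis by (simp add: g3_def mult_ac)
qed

text \<open>A kernel vector is a class pairing to zero with the basis, hence with every class; by
  Poincare duality it is zero.\<close>

lemma G_invertible: "invertible (Gmat D)"
proof -
  have "x = 0" if "Gmat D *v x = 0" for x
  proof -
    have "intg D (point_of D x * cls D \<beta>) = 0" for \<beta>
    proof -
      have "intg D (point_of D x * cls D \<beta>) = (Gmat D *v x) $ \<beta>"
        by (simp add: intg_point matrix_vector_mult_def Gmat_def g2_def[symmetric] g2_commute[of \<beta>]
            mult.commute[where 'a=complex])
      then show ?thesis by (simp add: that)
    qed
    then have "intg D (point_of D x * v) = 0" for v
      by (subst cls_expand[of v]) (simp add: sum_distrib_left scl_mult intg_sum intg_scl)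
    then have "point_of D x = 0" using fano_parts(2) by (simp add: poincare_duality_def)
    then show "x = 0" using cls_independent[of "\<lambda>\<alpha>. x $ \<alpha>"] by (simp add: point_of_def vec_eq_iff)
  qed
  then show ?thesis by (simp add: invertible_left_inverse matrix_left_invertible_ker)
qed

sublocale frobenius "Smat D" "Gmat D" "None :: 'a option"
proof
  have 1: "Gmat D ** Smat D = mat 1" "Smat D ** Gmat D = mat 1"
    using G_invertible someI_ex[of "\<lambda>B. Gmat D ** B = mat 1 \<and> B ** Gmat D = mat 1"]
    unfolding Smat_eq matrix_inv_def invertible_def by blast+
  show "Gmat D ** Smat D = mat 1" by (rule 1)
  have sG: "transpose (Gmat D) = Gmat D" by (simp add: transpose_def Gmat_def vec_eq_iff g2_commute)
  have "transpose (Smat D) = transpose (Smat D) ** (Gmat D ** Smat D)" by (simp add: 1)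
  also have "\<dots> = (transpose (Smat D) ** Gmat D) ** Smat D" by (rule matrix_mul_assoc)
  also have "transpose (Smat D) ** Gmat D = transpose (Gmat D ** Smat D)" by (simp add: matrix_transpose_mul sG)
  finally show "transpose (Smat D) = Smat D" by (simp add: 1 transpose_mat)
qed

text \<open>The Gram matrix pairs degree p only with degree n - p. In terms of the diagonal degree
  matrices this is P G = G Q, and multiplying by the inverse on both sides transfers it to the
  inverse.\<close>

lemma Smat_degree: "Smat D $ \<alpha> $ \<beta> * of_nat (deg D \<beta>) = (of_nat (dimV D) - of_nat (deg D \<alpha>)) * Smat D $ \<alpha> $ \<beta>"
proof -
  define P :: "complex^('a option)^('a option)" where "P = (\<chi> \<alpha> \<beta>. if \<alpha> = \<beta> then of_nat (deg D \<alpha>) else 0)"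
  define Q :: "complex^('a option)^('a option)" where "Q = (\<chi> \<alpha> \<beta>. if \<alpha> = \<beta> then of_nat (dimV D) - of_nat (deg D \<alpha>) else 0)"
  have dl: "(P ** A) $ \<alpha> $ \<beta> = of_nat (deg D \<alpha>) * A $ \<alpha> $ \<beta>"
    and dr: "(A ** P) $ \<alpha> $ \<beta> = A $ \<alpha> $ \<beta> * of_nat (deg D \<beta>)"
    and ql: "(Q ** A) $ \<alpha> $ \<beta> = (of_nat (dimV D) - of_nat (deg D \<alpha>)) * A $ \<alpha> $ \<beta>"
    and qr: "(A ** Q) $ \<alpha> $ \<beta> = A $ \<alpha> $ \<beta> * (of_nat (dimV D) - of_nat (deg D \<beta>))" for A \<alpha> \<beta>
    by (simp_all add: P_def Q_def matrix_matrix_mult_def mult_delta_left mult_delta_right)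
  have "P ** Gmat D = Gmat D ** Q"
  proof -
    have "of_nat (deg D \<alpha>) * g2 D \<alpha> \<beta> = g2 D \<alpha> \<beta> * (of_nat (dimV D) - of_nat (deg D \<beta>))" for \<alpha> \<beta>
    proof (cases "g2 D \<alpha> \<beta> = 0")
      case False
      have "(of_nat (dimV D) :: complex) = of_nat (deg D \<alpha>) + of_nat (deg D \<beta>)"
        unfolding g2_degree[OF False, symmetric] by simp
      then show ?thesis by simp
    qed simp
    then show ?thesis by (simp add: vec_eq_iff dl qr) (simp add: Gmat_def)
  qed
  then have "Smat D ** (P ** Gmat D) ** Smat D = Smat D ** (Gmat D ** Q) ** Smat D" by simp
  moreover have "Smat D ** (P ** Gmat D) ** Smat D = Smat D ** P ** (Gmat D ** Smat D)" by (simp only: matrix_mul_assoc)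
  moreover have "Smat D ** (Gmat D ** Q) ** Smat D = (Smat D ** Gmat D) ** Q ** Smat D" by (simp only: matrix_mul_assoc)
  ultimately have "Smat D ** P = Q ** Smat D" by (simp add: GS SG)
  then have "(Smat D ** P) $ \<alpha> $ \<beta> = (Q ** Smat D) $ \<alpha> $ \<beta>" by simp
  then show ?thesis by (simp only: dr ql)
qed

text \<open>In dimension 0 the point class would be a multiple of 1, against the independence of the
  basis. This permits cancelling the factor n of the additional cubic term.\<close>

lemma dim_pos: "dimV D \<noteq> 0"
proof
  assume 0: "dimV D = 0"
  have "cls D (Some (pnt D)) \<in> Hodge D 0"
    using fano_parts(5) 0 by (metis adapted_basis_def cls_Hodge)
  then obtain t where t: "cls D (Some (pnt D)) = scl D t 1"
    using fano_parts(2) by (auto simp: poincare_duality_def)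
  have "(\<Sum>\<alpha>\<in>UNIV. scl D (if \<alpha> = Some (pnt D) then 1 else if \<alpha> = None then - t else 0) (cls D \<alpha>))
     = (\<Sum>\<alpha>\<in>{None, Some (pnt D)}. scl D (if \<alpha> = Some (pnt D) then 1 else if \<alpha> = None then - t else 0) (cls D \<alpha>))"
    by (rule sum.mono_neutral_right) auto
  also have "\<dots> = 0" by (simp add: t)
  finally have "(if Some (pnt D) = Some (pnt D) then 1 else if Some (pnt D) = None then - t else 0) = (0::complex)"
    by (rule cls_independent[of "\<lambda>\<alpha>. if \<alpha> = Some (pnt D) then 1 else if \<alpha> = None then - t else 0"])
  then show False by simp
qed

section \<open>The matrix of the Euler field and its dependence on \<open>x\<^sub>0\<close>\<close>

lemma Ymat_nth: "Ymat D x y $ \<alpha> $ \<beta> = hess_ext y \<alpha> \<beta> + (\<Sum>\<gamma>\<in>UNIV. x $ \<gamma> * g3 D \<alpha> \<beta> \<gamma>)"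
  using intg_point[of x 1]
  by (cases \<alpha>; cases \<beta>) (simp_all add: Ymat_def intg_point mult.assoc g3_def g2_def mult_ac)

text \<open>Where \<open>g3\<close> is nonzero the degrees add up to n, so the weight equals 1 -
  p_\<gamma>, the coefficient of x_\<gamma> in the Euler field; the constant parts
  \<open>c_coord\<close> come from \<open>c2\<close>.\<close>

lemma Mmat_Ymat: "Mmat D (Ymat D x y) $ \<alpha> $ \<beta> = (\<Sum>\<gamma>\<in>UNIV. euler_coeff D x \<gamma> * g3 D \<alpha> \<beta> \<gamma>)
    + wt D \<alpha> \<beta> * hess_ext y \<alpha> \<beta>"
proof -
  let ?k = "wt D \<alpha> \<beta>"
  have eq: "?k * (x $ \<gamma> * g3 D \<alpha> \<beta> \<gamma>) = (1 - of_nat (deg D \<gamma>)) * x $ \<gamma> * g3 D \<alpha> \<beta> \<gamma>" for \<gamma>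
  proof (cases "g3 D \<alpha> \<beta> \<gamma> = 0")
    case False
    have "(of_nat (dimV D) :: complex) = of_nat (deg D \<alpha>) + of_nat (deg D \<beta>) + of_nat (deg D \<gamma>)"
      unfolding g3_degree[OF False, symmetric] by simp
    then have "?k = 1 - of_nat (deg D \<gamma>)" by simp
    then show ?thesis by simp
  qed simp
  then have "?k * (\<Sum>\<gamma>\<in>UNIV. x $ \<gamma> * g3 D \<alpha> \<beta> \<gamma>) = (\<Sum>\<gamma>\<in>UNIV. (1 - of_nat (deg D \<gamma>)) * x $ \<gamma> * g3 D \<alpha> \<beta> \<gamma>)"
    unfolding sum_distrib_left by (simp only: eq)
  then show ?thesis
    by (simp add: Mmat_def Ymat_nth c2_eq euler_coeff_def distrib_left distrib_right sum.distrib)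
qed

lemma transpose_Mmat: "transpose y = y \<Longrightarrow> transpose (Mmat D (Ymat D x y)) = Mmat D (Ymat D x y)"
proof -
  assume y: "transpose y = y"
  have "y $ a $ b = y $ b $ a" for a b
    by (subst y[symmetric]) (simp only: transpose_def vec_lambda_beta)
  then have "hess_ext y \<alpha> \<beta> = hess_ext y \<beta> \<alpha>" for \<alpha> \<beta> by (cases \<alpha>; cases \<beta>) auto
  then have "Mmat D (Ymat D x y) $ \<beta> $ \<alpha> = Mmat D (Ymat D x y) $ \<alpha> $ \<beta>" for \<alpha> \<beta>
    by (simp add: Mmat_Ymat g3_symmetric(1)[of D \<alpha>] add_ac)
  then show ?thesis by (simp add: transpose_def vec_eq_iff)
qed

text \<open>As p_0 = 0, the coordinate x_0 enters its Euler coefficient with factor 1, and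
  \<open>g3\<close> with an index 0 is the Gram matrix. After multiplication by the inverse form
  only x_0 times the identity has been added.\<close>

lemma Mmat_shift: "Mmat D (Ymat D x y) = Mmat D (Ymat D (insert0 (drop0 x)) y) + (\<chi> \<alpha> \<beta>. x $ None * Gmat D $ \<alpha> $ \<beta>)"
proof -
  have "g3 D \<alpha> \<beta> None = g2 D \<alpha> \<beta>" for \<alpha> \<beta> by (simp add: g3_def g2_def)
  then show ?thesis
    by (simp add: vec_eq_iff Mmat_Ymat euler_coeff_def sum_option_UNIV Gmat_def algebra_simps)
qed

lemma eigen_system_shift:
  "eigen_system D (Ymat D x y) a z \<longleftrightarrow> eigen_system D (Ymat D (insert0 (drop0 x)) y) (\<lambda>i. a i - x $ None) z"
proof -
  have "(\<chi> \<alpha> \<beta>. x $ None * Gmat D $ \<alpha> $ \<beta>) *v v = x $ None *s (Gmat D *v v)" for v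
    by (simp add: vec_eq_iff matrix_vector_mult_def sum_distrib_left mult.assoc)
  then have "(Mmat D (Ymat D x y) ** Smat D) *v v = (Mmat D (Ymat D (insert0 (drop0 x)) y) ** Smat D) *v v + x $ None *s v" for v
    unfolding matrix_vector_mul_assoc[symmetric] Mmat_shift[of x y] matrix_vector_mult_add_rdistrib
    by simp
  moreover have "inj (\<lambda>i. a i - x $ None) \<longleftrightarrow> inj a" by (simp add: inj_def)
  moreover have "v + x $ None *s w = t *s w \<longleftrightarrow> v = (t - x $ None) *s w" for v w :: "complex^('a option)" and t
    by (simp add: vec.scale_left_diff_distrib eq_diff_eq)
  ultimately show ?thesis by (simp add: eigen_system_iff)
qed

lemma ex_eigen_system_shift:
  "(\<exists>a. eigen_system D (Ymat D x y) a z) \<longleftrightarrow> (\<exists>a. eigen_system D (Ymat D (insert0 (drop0 x)) y) a z)"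
proof
  assume "\<exists>a. eigen_system D (Ymat D (insert0 (drop0 x)) y) a z"
  then obtain a where "eigen_system D (Ymat D (insert0 (drop0 x)) y) a z" ..
  then have "eigen_system D (Ymat D x y) (\<lambda>i. a i + x $ None) z"
    by (subst eigen_system_shift) simp
  then show "\<exists>a. eigen_system D (Ymat D x y) a z" by (rule exI[of _ "\<lambda>i. a i + x $ None"])
next
  assume "\<exists>a. eigen_system D (Ymat D x y) a z"
  then obtain a where "eigen_system D (Ymat D x y) a z" ..
  then have "eigen_system D (Ymat D (insert0 (drop0 x)) y) (\<lambda>i. a i - x $ None) z"
    by (rule iffD1[OF eigen_system_shift])
  then show "\<exists>a. eigen_system D (Ymat D (insert0 (drop0 x)) y) a z"
    by (rule exI[of _ "\<lambda>i. a i - x $ None"])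
qed

lemma R_dom_shift: "R_dom D (Ymat D x y) \<longleftrightarrow> R_dom D (Ymat D (insert0 (drop0 x)) y)"
  unfolding R_dom_def using ex_eigen_system_shift[of x y] by blast

text \<open>Adding a multiple of the identity moves the eigenvalues and keeps the eigenvectors. The
  predicates from which \<open>SOME\<close> chooses are therefore the same, and both sides use the
  same chosen eigenvectors.\<close>

lemma R_shift: "R D (Ymat D x y) = R D (Ymat D (insert0 (drop0 x)) y)"
  unfolding R_def ex_eigen_system_shift[of x y] ..

lemma r_full_eq: "r_full D x y a b c = r D (drop0 x) y a b c"
  by (simp add: r_def r_full_def R_shift[of x])

lemma eigen_frame:
  assumes y: "transpose y = y" and es: "eigen_system D (Ymat D x y) a z" and nz: "\<And>i. R_denom D (z i) \<noteq> 0"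
  shows "clin (z i) (Smat D *v z j) = (if i = j then clin (z i) (Smat D *v z i) else 0)"
    "clin (z i) (Smat D *v z i) \<noteq> 0" "z i $ None \<noteq> 0"
proof -
  show "clin (z i) (Smat D *v z j) = (if i = j then clin (z i) (Smat D *v z i) else 0)"
    using eigen_orthogonal[OF transpose_Mmat[OF y], of x z a i j] es by (auto simp: eigen_system_iff)
  show "clin (z i) (Smat D *v z i) \<noteq> 0" "z i $ None \<noteq> 0"
    using nz[of i] by (auto simp: R_denom_eq)
qed

text \<open>The unit law for R: the coordinate of \<open>z i\<close> at index 0 cancels against the
  denominator and leaves the expansion of the Gram matrix in the orthogonal frame.\<close>

lemma R_None:
  assumes y: "transpose y = y" and R: "R_dom D (Ymat D x y)"
  shows "R D (Ymat D x y) None \<beta> \<gamma> = g2 D \<beta> \<gamma>"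
proof -
  obtain a z where z: "eigen_system D (Ymat D x y) a z" "\<And>i. R_denom D (z i) \<noteq> 0"
    "\<And>\<alpha> \<beta> \<gamma>. R D (Ymat D x y) \<alpha> \<beta> \<gamma> = (\<Sum>i\<in>UNIV. z i $ \<alpha> * z i $ \<beta> * z i $ \<gamma> / R_denom D (z i))"
    using R_value[OF R] by blast
  note fr = eigen_frame[OF y z(1,2)]
  have "g2 D \<beta> \<gamma> = (\<Sum>i\<in>UNIV. z i $ \<beta> * z i $ \<gamma> / clin (z i) (Smat D *v z i))"
    using frame_entry[of z "\<lambda>i. clin (z i) (Smat D *v z i)", OF fr(1,2), of \<beta> \<gamma>] by (simp add: Gmat_def)
  also have "\<dots> = R D (Ymat D x y) None \<beta> \<gamma>"
    unfolding z(3) by (intro sum.cong refl) (use fr(3) in \<open>simp add: R_denom_eq\<close>)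
  finally show ?thesis ..
qed

end

section \<open>Rationality\<close>

lemma poly_fun_sum: "(\<And>k. k \<in> K \<Longrightarrow> poly_fun (f k)) \<Longrightarrow> poly_fun (\<lambda>x y. \<Sum>k\<in>K. f k x y)"
  by (induction K rule: infinite_finite_induct) (simp_all add: poly_fun.const poly_fun.add)

lemma poly_fun_prod: "(\<And>k. k \<in> K \<Longrightarrow> poly_fun (f k)) \<Longrightarrow> poly_fun (\<lambda>x y. \<Prod>k\<in>K. f k x y)"
  by (induction K rule: infinite_finite_induct) (simp_all add: poly_fun.const poly_fun.mult)

lemma poly_fun_power: "poly_fun f \<Longrightarrow> poly_fun (\<lambda>x y. f x y ^ n)"
  by (induction n) (simp_all add: poly_fun.const poly_fun.mult)

lemma poly_fun_diff: "poly_fun f \<Longrightarrow> poly_fun g \<Longrightarrow> poly_fun (\<lambda>x y. f x y - g x y)"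
  using poly_fun.add[of f "\<lambda>x y. (- 1) * g x y"] poly_fun.mult[OF poly_fun.const[of "- 1"], of g] by simp

lemma poly_fun_det:
  assumes "\<And>i j. poly_fun (\<lambda>x y. A x y $ i $ j)"
  shows "poly_fun (\<lambda>x y. det (A x y))"
  unfolding det_def by (intro poly_fun_sum poly_fun.mult poly_fun.const poly_fun_prod assms)

lemma poly_fun_mat_vec:
  assumes "\<And>i j. poly_fun (\<lambda>x y. A x y $ i $ j)" "\<And>j. poly_fun (\<lambda>x y. v x y $ j)"
  shows "poly_fun (\<lambda>x y. (A x y *v v x y) $ i)"
  unfolding matrix_vector_mult_def vec_lambda_beta by (intro poly_fun_sum poly_fun.mult assms)

lemma poly_fun_kry:
  assumes "\<And>i j. poly_fun (\<lambda>x y. A x y $ i $ j)"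
  shows "poly_fun (\<lambda>x y. kry (A x y) v k $ i)"
  by (induction k arbitrary: i) (simp_all add: poly_fun.const poly_fun_mat_vec assms)

context fano_manifold
begin

lemma poly_fun_Mmat: "poly_fun (\<lambda>w y. Mmat D (Ymat D (insert0 w) y) $ \<alpha> $ \<beta>)"
proof -
  have 1: "poly_fun (\<lambda>w y. insert0 w $ \<gamma>)" for \<gamma> :: "'a option"
    by (cases \<gamma>) (simp_all add: poly_fun.const poly_fun.var_x)
  have 2: "poly_fun (\<lambda>w y. hess_ext y \<alpha> \<beta>)"
    by (cases \<alpha>; cases \<beta>) (simp_all add: poly_fun.const poly_fun.var_y)
  show ?thesis unfolding Mmat_Ymat euler_coeff_def
    by (intro poly_fun.add poly_fun.mult poly_fun_sum poly_fun.const 1 2)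
qed

lemma poly_fun_L: "poly_fun (\<lambda>w y. (Smat D ** Mmat D (Ymat D (insert0 w) y)) $ \<alpha> $ \<beta>)"
  unfolding matrix_matrix_mult_def vec_lambda_beta
  by (intro poly_fun_sum poly_fun.mult poly_fun.const poly_fun_Mmat)

text \<open>Each of the three indices is expanded by Cramer's rule and contributes one factor 1 /
  \<open>B\<close>, so the common denominator is the cube of the Krylov determinant
  \<open>B\<close>, which is nonzero on \<open>r_dom\<close>.\<close>

lemma r_rational:
  "\<exists>P Q. poly_fun P \<and> poly_fun Q \<and> (\<forall>w y. r_dom D w y \<longrightarrow> Q w y \<noteq> 0 \<and> r D w y a b c = P w y / Q w y)"
proof -
  obtain \<iota> :: "'a option \<Rightarrow> nat" where \<iota>: "bij_betw \<iota> UNIV {..<CARD('a option)}" by (rule bij_index)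
  let ?e = "axis None 1 :: complex^('a option)"
  define L where "L w y = Smat D ** Mmat D (Ymat D (insert0 w) y)" for w y
  define B where "B w y = det (krylov (L w y) ?e \<iota>)" for w y
  define K where "K w y \<alpha> k = kcoef (L w y) ?e \<iota> \<alpha> k" for w y \<alpha> k
  define s where "s w y q = (Gmat D *v kry (L w y) ?e q) $ None" for w y q
  define P where "P w y = (\<Sum>k\<in>UNIV. \<Sum>l\<in>UNIV. \<Sum>p\<in>UNIV. K w y (Some a) k * K w y (Some b) l * K w y (Some c) p * s w y (\<iota> k + \<iota> l + \<iota> p))
      - g3 D (Some a) (Some b) (Some c) * B w y ^ 3" for w y
  have L: "poly_fun (\<lambda>w y. L w y $ \<alpha> $ \<beta>)" for \<alpha> \<beta> unfolding L_def by (rule poly_fun_L)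
  note kry = poly_fun_kry[of L, OF L]
  have B: "poly_fun B" unfolding B_def krylov_def
    by (rule poly_fun_det) (simp add: kry)
  have K: "poly_fun (\<lambda>w y. K w y \<alpha> k)" for \<alpha> k unfolding K_def kcoef_def krylov_def
  proof (rule poly_fun_det)
    fix i j
    show "poly_fun (\<lambda>w y. (\<chi> i j. if j = k then axis \<alpha> 1 $ i else (\<chi> \<alpha> k. kry (L w y) ?e (\<iota> k) $ \<alpha>) $ i $ j) $ i $ j)"
      by (cases "j = k") (simp_all add: kry poly_fun.const)
  qed
  have s: "poly_fun (\<lambda>w y. s w y q)" for q unfolding s_def
    by (rule poly_fun_mat_vec) (simp_all add: kry poly_fun.const)
  have "poly_fun P" unfolding P_def
    by (intro poly_fun_diff poly_fun_sum poly_fun.mult poly_fun.const poly_fun_power K B s)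
  moreover have "poly_fun (\<lambda>w y. B w y ^ 3)" by (rule poly_fun_power[OF B])
  moreover have "B w y ^ 3 \<noteq> 0 \<and> r D w y a b c = P w y / B w y ^ 3" if "r_dom D w y" for w y
  proof -
    let ?x = "insert0 w" and ?M = "Mmat D (Ymat D (insert0 w) y)"
    have y: "transpose y = y" and R: "R_dom D (Ymat D ?x y)" using that by (auto simp: r_dom_def)
    obtain ev z where z: "eigen_system D (Ymat D ?x y) ev z" "\<And>i. R_denom D (z i) \<noteq> 0"
      "\<And>\<alpha> \<beta> \<gamma>. R D (Ymat D ?x y) \<alpha> \<beta> \<gamma> = (\<Sum>i\<in>UNIV. z i $ \<alpha> * z i $ \<beta> * z i $ \<gamma> / R_denom D (z i))"
      using R_value[OF R] by blast
    note fr = eigen_frame[OF y z(1,2)]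
    have ev: "(?M ** Smat D) *v z i = ev i *s z i" "inj ev" for i
      using z(1) by (simp_all add: eigen_system_iff)
    note tM = transpose_Mmat[OF y, of ?x]
    have B0: "B w y \<noteq> 0" unfolding B_def L_def
      by (rule det_krylov_nonzero[of ?M z ev, OF tM ev(1) ev(2) fr(3) \<iota>])
    have ex: "axis \<alpha> 1 = (\<Sum>k\<in>UNIV. (K w y \<alpha> k / B w y) *s kry (Smat D ** ?M) ?e (\<iota> k))" for \<alpha>
      using kcoef_expand[of "L w y" ?e \<iota> \<alpha>] B0 unfolding B_def K_def L_def by blast
    have "R D (Ymat D ?x y) (Some a) (Some b) (Some c)
      = (\<Sum>k\<in>UNIV. \<Sum>l\<in>UNIV. \<Sum>p\<in>UNIV. (K w y (Some a) k / B w y) * (K w y (Some b) l / B w y) * (K w y (Some c) p / B w y)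
          * (Gmat D *v kry (Smat D ** ?M) ?e (\<iota> k + \<iota> l + \<iota> p)) $ None)"
      unfolding z(3) R_denom_eq
      by (rule R_krylov[of ?M z ev "\<lambda>i. clin (z i) (Smat D *v z i)" "\<lambda>\<alpha> k. K w y \<alpha> k / B w y" \<iota>, OF tM ev(1) fr(1,2,3) ex])
    also have "\<dots> = (\<Sum>k\<in>UNIV. \<Sum>l\<in>UNIV. \<Sum>p\<in>UNIV. K w y (Some a) k * K w y (Some b) l * K w y (Some c) p * s w y (\<iota> k + \<iota> l + \<iota> p) / B w y ^ 3)"
      by (intro sum.cong refl) (simp add: s_def L_def power3_eq_cube)
    finally have "r D w y a b c = P w y / B w y ^ 3"
      using B0 by (simp add: r_def r_full_def P_def sum_divide_distrib diff_divide_distrib)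
    with B0 show ?thesis by simp
  qed
  ultimately show ?thesis by blast
qed

end

section \<open>Derivatives of the potential\<close>

abbreviation pd3 :: "(complex^'i::finite \<Rightarrow> complex) \<Rightarrow> complex^'i \<Rightarrow> 'i \<Rightarrow> 'i \<Rightarrow> 'i \<Rightarrow> complex" where
  "pd3 f x \<alpha> \<beta> \<gamma> \<equiv> pd \<alpha> (pd \<beta> (pd \<gamma> f)) x"

lemma pd_cong_fun:
  assumes "open U" "\<And>x. x \<in> U \<Longrightarrow> f x = g x" "x \<in> U"
  shows "pd i f x = pd i g x"
  using pd_cong[of U x f g] assms by blast

lemma holo_on_drop0:
  assumes "holo_on \<psi> W"
  shows "holo_on (\<lambda>x. \<psi> (drop0 x)) (drop0 -` W)"
  by (rule holo_onI, rule cd_drop0, rule holo_on_has_derivative[OF assms]) simp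

lemma pd_drop0:
  assumes "holo_on \<psi> W" "drop0 x \<in> W"
  shows "pd \<alpha> (\<lambda>x. \<psi> (drop0 x)) x = (case \<alpha> of None \<Rightarrow> 0 | Some a \<Rightarrow> pd a \<psi> (drop0 x))"
  using has_derivative_pd_unique[OF cd_drop0[OF holo_on_has_derivative[OF assms]], of \<alpha>]
  by (simp split: option.split)

text \<open>Third derivatives of the pullback of \<phi> along \<open>drop0\<close>: an index 0 gives
  zero.\<close>

definition d3 :: "(complex^'a::finite \<Rightarrow> complex) \<Rightarrow> complex^'a \<Rightarrow> 'a option \<Rightarrow> 'a option \<Rightarrow> 'a option \<Rightarrow> complex" where
  "d3 \<phi> w \<alpha> \<beta> \<gamma> = (case (\<alpha>, \<beta>, \<gamma>) of (Some a, Some b, Some c) \<Rightarrow> pd3 \<phi> w a b c | _ \<Rightarrow> 0)"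

lemma d3_simps [simp]: "d3 \<phi> w None \<beta> \<gamma> = 0" "d3 \<phi> w \<alpha> None \<gamma> = 0" "d3 \<phi> w \<alpha> \<beta> None = 0"
  "d3 \<phi> w (Some a) (Some b) (Some c) = pd3 \<phi> w a b c"
  by (simp_all add: d3_def split: option.split)

lemma pd3_commute:
  assumes "open W" "holo_on \<phi> W" "w \<in> W"
  shows "pd3 \<phi> w a b c = pd b (pd a (pd c \<phi>)) w" "pd3 \<phi> w a b c = pd a (pd c (pd b \<phi>)) w"
  by (rule pd_commute[OF assms(1) holo_on_pd[OF assms(1,2)] assms(3)],
      rule pd_cong_fun[OF assms(1) pd_commute[OF assms(1,2)] assms(3)])

lemma d3_symmetric:
  assumes "open W" "holo_on \<phi> W" "w \<in> W"
  shows "d3 \<phi> w \<alpha> \<beta> \<gamma> = d3 \<phi> w \<beta> \<alpha> \<gamma>" "d3 \<phi> w \<alpha> \<beta> \<gamma> = d3 \<phi> w \<alpha> \<gamma> \<beta>"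
  using pd3_commute[OF assms] by (cases \<alpha>; cases \<beta>; cases \<gamma>; simp)+

definition hessian :: "(complex^'a::finite \<Rightarrow> complex) \<Rightarrow> complex^'a \<Rightarrow> complex^'a^'a" where
  "hessian \<phi> w = (\<chi> a b. pd a (pd b \<phi>) w)"

lemma transpose_hessian: "open W \<Longrightarrow> holo_on \<phi> W \<Longrightarrow> w \<in> W \<Longrightarrow> transpose (hessian \<phi> w) = hessian \<phi> w"
  using pd_commute[of W \<phi> w] by (simp add: transpose_def hessian_def vec_eq_iff)

text \<open>The function \<phi> is only given by its values; it inherits holomorphy from f - P on
  slices of constant x_0. The third derivatives of P vanish, because P is quadratic.\<close>

lemma indep_x0_decompose:
  fixes f :: "complex^('a::finite option) \<Rightarrow> complex"
  assumes U: "open U" and f: "holo_on f U" and P: "x0_quadratic P" and dec: "\<And>x. x \<in> U \<Longrightarrow> f x = \<phi> (drop0 x) + P x"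
  shows "holo_on \<phi> (drop0 ` U)"
    and "x \<in> U \<Longrightarrow> pd (Some a) (pd (Some b) f) x = pd a (pd b \<phi>) (drop0 x)"
    and "x \<in> U \<Longrightarrow> pd3 f x \<alpha> \<beta> \<gamma> = d3 \<phi> (drop0 x) \<alpha> \<beta> \<gamma>"
proof -
  let ?W = "drop0 ` U"
  have W: "open ?W" by (rule open_drop0_image[OF U])
  obtain q m e l k where Px: "\<forall>x. P x = q * (x $ None)\<^sup>2 + x $ None * (\<Sum>a\<in>UNIV. (l::complex^'a) $ a * x $ Some a)
           + m * x $ None + (\<Sum>a\<in>UNIV. (k::complex^'a) $ a * x $ Some a) + e"
    using P unfolding x0_quadratic_def by (elim exE) (rule that)
  have P_alt: "P = (\<lambda>x. q * (x $ None * x $ None) + x $ None * (\<Sum>a\<in>UNIV. l $ a * x $ Some a)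
           + m * x $ None + (\<Sum>a\<in>UNIV. k $ a * x $ Some a) + e)"
    by (rule ext) (simp only: Px[rule_format] power2_eq_square)
  have hP: "holo_on P UNIV"
    unfolding P_alt by (intro holo_on_add holo_on_mult holo_on_sum holo_on_const holo_on_coord)
  have pdP: "pd \<alpha> P x = (case \<alpha> of None \<Rightarrow> 2 * q * x $ None + (\<Sum>a\<in>UNIV. l $ a * x $ Some a) + m
      | Some a \<Rightarrow> x $ None * l $ a + k $ a)" for \<alpha> x
  proof -
    have "(P has_derivative clin (q *s (x $ None *s axis None 1 + x $ None *s axis None 1)
        + (x $ None *s (\<Sum>a\<in>UNIV. l $ a *s axis (Some a) 1) + (\<Sum>a\<in>UNIV. l $ a * x $ Some a) *s axis None 1)
        + m *s axis None 1 + (\<Sum>a\<in>UNIV. k $ a *s axis (Some a) 1) + 0)) (at x)"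
      unfolding P_alt by (intro cd_add cd_cmult cd_mult cd_sum cd_coord cd_const)
    from has_derivative_pd_unique[OF this, of \<alpha>] show ?thesis
      by (cases \<alpha>) (simp_all add: sum_component axis_def mult_delta_right)
  qed
  show h: "holo_on \<phi> ?W"
    unfolding holo_on_iff
  proof
    fix w assume "w \<in> ?W"
    then obtain x where x: "x \<in> U" "w = drop0 x" by blast
    \<comment> \<open>The slice through x, so that w lies in its domain.\<close>
    let ?c = "x $ None *s axis None 1 :: complex^('a option)"
    have xc: "insert0 w + ?c = x"
      by (simp add: x(2) vec_eq_iff insert0_def axis_def split: option.split)
    have V: "open ((\<lambda>w. insert0 w + ?c) -` U)"
      by (rule open_vimage[OF U])
         (intro continuous_on_add continuous_on_const linear_continuous_on bounded_linear_insert0)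
    have "((\<lambda>x. f x - P x) has_derivative clin (\<chi> i. pd i (\<lambda>x. f x - P x) x)) (at (insert0 w + ?c))"
      unfolding xc by (rule holo_on_has_derivative[OF holo_on_diff[OF f holo_on_subset[OF hP]] x(1)]) simp
    from cd_insert0[OF this]
    have "(\<phi> has_derivative clin (drop0 (\<chi> i. pd i (\<lambda>x. f x - P x) x))) (at w)"
    proof (rule has_derivative_transform_within_open[OF _ V])
      show "w \<in> (\<lambda>w. insert0 w + ?c) -` U" using xc x(1) by simp
      fix w' assume "w' \<in> (\<lambda>w. insert0 w + ?c) -` U"
      moreover have "drop0 (insert0 w' + ?c) = w'" by (simp add: vec_eq_iff axis_def)
      ultimately show "f (insert0 w' + ?c) - P (insert0 w' + ?c) = \<phi> w'"
        using dec[of "insert0 w' + ?c"] by simp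
    qed
    then show "\<exists>A. (\<phi> has_derivative clin A) (at w)" by blast
  qed
  have hd: "holo_on (\<lambda>x. \<psi> (drop0 x)) U" if "holo_on \<psi> ?W" for \<psi>
    by (rule holo_on_subset[OF holo_on_drop0[OF that]]) blast
  have p1: "pd \<gamma> f x = (case \<gamma> of None \<Rightarrow> 0 | Some a \<Rightarrow> pd a \<phi> (drop0 x)) + pd \<gamma> P x" if x: "x \<in> U" for \<gamma> x
  proof -
    have "pd \<gamma> f x = pd \<gamma> (\<lambda>x. \<phi> (drop0 x) + P x) x"
      by (rule pd_cong_fun[OF U dec x])
    also have "\<dots> = pd \<gamma> (\<lambda>x. \<phi> (drop0 x)) x + pd \<gamma> P x"
      by (rule pd_add[OF hd[OF h] holo_on_subset[OF hP] x]) simp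
    finally show ?thesis using pd_drop0[OF h, of x \<gamma>] x by simp
  qed
  have lin2: "pd \<alpha> (\<lambda>x. 2 * q * x $ None + (\<Sum>a\<in>UNIV. l $ a * x $ Some a) + m) x = (case \<alpha> of None \<Rightarrow> 2 * q | Some a \<Rightarrow> l $ a)"
    and lin1: "pd \<alpha> (\<lambda>x. x $ None * t + s) x = (case \<alpha> of None \<Rightarrow> t | Some a \<Rightarrow> 0)" for \<alpha> t s and x :: "complex^('a option)"
  proof -
    have "((\<lambda>x. 2 * q * x $ None + (\<Sum>a\<in>UNIV. l $ a * x $ Some a) + m) has_derivative
        clin ((2 * q) *s axis None 1 + (\<Sum>a\<in>UNIV. l $ a *s axis (Some a) 1) + 0)) (at x)"
      by (intro cd_add cd_sum cd_cmult cd_coord cd_const)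
    from has_derivative_pd_unique[OF this, of \<alpha>]
    show "pd \<alpha> (\<lambda>x. 2 * q * x $ None + (\<Sum>a\<in>UNIV. l $ a * x $ Some a) + m) x = (case \<alpha> of None \<Rightarrow> 2 * q | Some a \<Rightarrow> l $ a)"
      by (cases \<alpha>) (simp_all add: sum_component axis_def mult_delta_right)
    have "((\<lambda>x. t * x $ None + s) has_derivative clin (t *s axis None 1 + 0)) (at x)"
      by (intro cd_add cd_cmult cd_coord cd_const)
    from has_derivative_pd_unique[OF this, of \<alpha>]
    show "pd \<alpha> (\<lambda>x. x $ None * t + s) x = (case \<alpha> of None \<Rightarrow> t | Some a \<Rightarrow> 0)"
      by (cases \<alpha>) (simp_all add: axis_def mult.commute)
  qed
  have p2: "pd \<beta> (pd \<gamma> f) x = (case (\<beta>, \<gamma>) of (Some b, Some c) \<Rightarrow> pd b (pd c \<phi>) (drop0 x)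
      | (None, None) \<Rightarrow> 2 * q | (Some b, None) \<Rightarrow> l $ b | (None, Some c) \<Rightarrow> l $ c)" if x: "x \<in> U" for \<beta> \<gamma> x
  proof (cases \<gamma>)
    case None
    have "pd \<beta> (pd \<gamma> f) x = pd \<beta> (\<lambda>x. 2 * q * x $ None + (\<Sum>a\<in>UNIV. l $ a * x $ Some a) + m) x"
      by (rule pd_cong_fun[OF U _ x]) (simp add: p1 None pdP)
    then show ?thesis by (cases \<beta>) (simp_all add: None lin2)
  next
    case (Some c)
    have "pd \<beta> (pd \<gamma> f) x = pd \<beta> (\<lambda>x. pd c \<phi> (drop0 x) + (x $ None * l $ c + k $ c)) x"
      by (rule pd_cong_fun[OF U _ x]) (simp add: p1 Some pdP)
    also have "\<dots> = pd \<beta> (\<lambda>x. pd c \<phi> (drop0 x)) x + pd \<beta> (\<lambda>x. x $ None * l $ c + k $ c) x"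
      by (rule pd_add[OF hd[OF holo_on_pd[OF W h]] _ x]) (intro holo_on_add holo_on_mult holo_on_const holo_on_coord)
    finally show ?thesis using pd_drop0[OF holo_on_pd[OF W h], of x \<beta> c] x
      by (cases \<beta>) (simp_all add: Some lin1)
  qed
  show "pd (Some a) (pd (Some b) f) x = pd a (pd b \<phi>) (drop0 x)" if "x \<in> U" for x
    using p2[OF that] by simp
  show "pd3 f x \<alpha> \<beta> \<gamma> = d3 \<phi> (drop0 x) \<alpha> \<beta> \<gamma>" if x: "x \<in> U" for x
  proof (cases "\<exists>b c. \<beta> = Some b \<and> \<gamma> = Some c")
    case True
    then obtain b c where bc: "\<beta> = Some b" "\<gamma> = Some c" by blast
    have "pd3 f x \<alpha> \<beta> \<gamma> = pd \<alpha> (\<lambda>x. pd b (pd c \<phi>) (drop0 x)) x"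
      by (rule pd_cong_fun[OF U _ x]) (simp add: p2 bc)
    then show ?thesis
      using pd_drop0[OF holo_on_pd[OF W holo_on_pd[OF W h]], of x \<alpha> b c] x
      by (cases \<alpha>) (simp_all add: bc)
  next
    case False
    then have "\<exists>t. \<forall>x\<in>U. pd \<beta> (pd \<gamma> f) x = t" by (cases \<beta>; cases \<gamma>) (auto simp: p2)
    then obtain t where t: "\<And>x. x \<in> U \<Longrightarrow> pd \<beta> (pd \<gamma> f) x = t" by blast
    have "pd3 f x \<alpha> \<beta> \<gamma> = pd \<alpha> (\<lambda>x. t) x" by (rule pd_cong_fun[OF U t x])
    with False show ?thesis by (cases \<alpha>; cases \<beta>; cases \<gamma>) auto
  qed
qed

context fano_manifold
begin

text \<open>Commuting two derivatives past the Euler field produces 1 - p_\<alpha> and 1 -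
  p_\<beta>; together with -(3 - n) they add up to minus the weight \<open>wt\<close>.\<close>

lemma pd_euler:
  assumes U: "open U" and f: "holo_on f U" and x: "x \<in> U"
  shows "pd \<alpha> (pd \<beta> (\<lambda>x. euler D f x - (3 - of_nat (dimV D)) * f x)) x
    = (\<Sum>\<gamma>\<in>UNIV. euler_coeff D x \<gamma> * pd3 f x \<alpha> \<beta> \<gamma>)
      - wt D \<alpha> \<beta> * pd \<alpha> (pd \<beta> f) x"
proof -
  have hE: "holo_on (\<lambda>x. euler_coeff D x \<gamma>) V" for \<gamma> V
    unfolding euler_coeff_def by (intro holo_on_add holo_on_mult holo_on_const holo_on_coord)
  have pE: "pd \<alpha> (\<lambda>x. euler_coeff D x \<gamma>) x = (if \<alpha> = \<gamma> then 1 - of_nat (deg D \<gamma>) else 0)" for \<alpha> \<gamma> x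
  proof -
    have "((\<lambda>x. euler_coeff D x \<gamma>) has_derivative clin (0 + (1 - of_nat (deg D \<gamma>)) *s axis \<gamma> 1)) (at x)"
      unfolding euler_coeff_def by (intro cd_add cd_cmult cd_coord cd_const)
    from has_derivative_pd_unique[OF this, of \<alpha>] show ?thesis by (auto simp: axis_def)
  qed
  have hp: "holo_on (pd \<gamma> f) U" "holo_on (pd \<beta> (pd \<gamma> f)) U" for \<beta> \<gamma>
    using holo_on_pd[OF U] f by blast+
  have E: "pd \<alpha> (\<lambda>x. \<Sum>\<gamma>\<in>UNIV. euler_coeff D x \<gamma> * h \<gamma> x) x
      = (\<Sum>\<gamma>\<in>UNIV. euler_coeff D x \<gamma> * pd \<alpha> (h \<gamma>) x) + (1 - of_nat (deg D \<alpha>)) * h \<alpha> x"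
    if h: "\<And>\<gamma>. holo_on (h \<gamma>) U" and x: "x \<in> U" for h \<alpha> x
  proof -
    have "pd \<alpha> (\<lambda>x. \<Sum>\<gamma>\<in>UNIV. euler_coeff D x \<gamma> * h \<gamma> x) x = (\<Sum>\<gamma>\<in>UNIV. pd \<alpha> (\<lambda>x. euler_coeff D x \<gamma> * h \<gamma> x) x)"
      by (rule pd_sum[OF _ x]) (intro holo_on_mult hE h)
    also have "\<dots> = (\<Sum>\<gamma>\<in>UNIV. euler_coeff D x \<gamma> * pd \<alpha> (h \<gamma>) x + (if \<alpha> = \<gamma> then 1 - of_nat (deg D \<gamma>) else 0) * h \<gamma> x)"
      by (intro sum.cong refl) (simp only: pd_mult[OF hE h x] pE)
    finally show ?thesis by (simp add: sum.distrib mult_delta_left)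
  qed
  let ?c = "3 - of_nat (dimV D) :: complex"
  have 1: "pd \<beta> (\<lambda>x. euler D f x - ?c * f x) x
      = (\<Sum>\<gamma>\<in>UNIV. euler_coeff D x \<gamma> * pd \<beta> (pd \<gamma> f) x) + ((1 - of_nat (deg D \<beta>)) - ?c) * pd \<beta> f x" if x: "x \<in> U" for x
  proof -
    have "pd \<beta> (\<lambda>x. euler D f x - ?c * f x) x = pd \<beta> (\<lambda>x. euler D f x) x - pd \<beta> (\<lambda>x. ?c * f x) x"
      unfolding euler_def
      by (rule pd_diff[OF _ _ x]) (intro holo_on_sum holo_on_mult holo_on_const hE hp f)+
    then show ?thesis
      unfolding euler_def E[of "\<lambda>\<gamma>. pd \<gamma> f", OF hp(1) x] pd_cmult[OF f x] by (simp add: left_diff_distrib)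
  qed
  have "pd \<alpha> (pd \<beta> (\<lambda>x. euler D f x - ?c * f x)) x
    = pd \<alpha> (\<lambda>x. (\<Sum>\<gamma>\<in>UNIV. euler_coeff D x \<gamma> * pd \<beta> (pd \<gamma> f) x) + ((1 - of_nat (deg D \<beta>)) - ?c) * pd \<beta> f x) x"
    by (rule pd_cong_fun[OF U 1 x])
  also have "\<dots> = pd \<alpha> (\<lambda>x. \<Sum>\<gamma>\<in>UNIV. euler_coeff D x \<gamma> * pd \<beta> (pd \<gamma> f) x) x
      + pd \<alpha> (\<lambda>x. ((1 - of_nat (deg D \<beta>)) - ?c) * pd \<beta> f x) x"
    by (rule pd_add[OF _ _ x]) (intro holo_on_sum holo_on_mult holo_on_const hE hp)+
  also have "\<dots> = (\<Sum>\<gamma>\<in>UNIV. euler_coeff D x \<gamma> * pd3 f x \<alpha> \<beta> \<gamma>) + (1 - of_nat (deg D \<alpha>)) * pd \<beta> (pd \<alpha> f) x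
      + ((1 - of_nat (deg D \<beta>)) - ?c) * pd \<alpha> (pd \<beta> f) x"
    unfolding E[of "\<lambda>\<gamma>. pd \<beta> (pd \<gamma> f)", OF hp(2) x] pd_cmult[OF hp(1) x] by simp
  also have "pd \<beta> (pd \<alpha> f) x = pd \<alpha> (pd \<beta> f) x" by (rule pd_commute[OF U f x])
  finally show ?thesis by (simp add: algebra_simps)
qed

text \<open>The contractions of \<open>g3\<close> with x: \<open>lin3\<close> gives the second
  derivatives of the classical potential, and half of \<open>quad3\<close> the first ones.\<close>

definition lin3 :: "'a option \<Rightarrow> 'a option \<Rightarrow> complex^('a option) \<Rightarrow> complex" where
  "lin3 \<alpha> \<beta> x = (\<Sum>\<gamma>\<in>UNIV. g3 D \<alpha> \<beta> \<gamma> * x $ \<gamma>)"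

definition quad3 :: "'a option \<Rightarrow> complex^('a option) \<Rightarrow> complex" where
  "quad3 \<alpha> x = (\<Sum>\<beta>\<in>UNIV. lin3 \<alpha> \<beta> x * x $ \<beta>)"

lemma lin3_commute: "lin3 \<alpha> \<beta> x = lin3 \<beta> \<alpha> x"
  by (simp add: lin3_def g3_symmetric(1)[of D \<alpha> \<beta>])

lemma cd_lin3: "(lin3 \<alpha> \<beta> has_derivative clin (\<chi> \<gamma>. g3 D \<alpha> \<beta> \<gamma>)) (at x)"
proof -
  have "(lin3 \<alpha> \<beta> has_derivative clin (\<Sum>\<gamma>\<in>UNIV. g3 D \<alpha> \<beta> \<gamma> *s axis \<gamma> 1)) (at x)"
    unfolding lin3_def[abs_def] by (intro cd_sum cd_cmult cd_coord)
  moreover have "(\<Sum>\<gamma>\<in>UNIV. g3 D \<alpha> \<beta> \<gamma> *s axis \<gamma> 1) = (\<chi> \<gamma>. g3 D \<alpha> \<beta> \<gamma>)"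
    by (simp add: vec_eq_iff sum_component axis_def mult_delta_right)
  ultimately show ?thesis by simp
qed

lemma cd_quad3: "(quad3 \<alpha> has_derivative clin (\<chi> \<gamma>. 2 * lin3 \<alpha> \<gamma> x)) (at x)"
proof -
  have "(quad3 \<alpha> has_derivative clin (\<Sum>\<beta>\<in>UNIV. lin3 \<alpha> \<beta> x *s axis \<beta> 1 + x $ \<beta> *s (\<chi> \<gamma>. g3 D \<alpha> \<beta> \<gamma>))) (at x)"
    unfolding quad3_def[abs_def] by (intro cd_sum cd_mult cd_coord cd_lin3)
  moreover have "(\<Sum>\<beta>\<in>UNIV. lin3 \<alpha> \<beta> x *s axis \<beta> 1 + x $ \<beta> *s (\<chi> \<gamma>. g3 D \<alpha> \<beta> \<gamma>)) = (\<chi> \<gamma>. 2 * lin3 \<alpha> \<gamma> x)"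
  proof -
    have "(\<Sum>\<beta>\<in>UNIV. x $ \<beta> * g3 D \<alpha> \<beta> \<gamma>) = lin3 \<alpha> \<gamma> x" for \<gamma>
      by (simp add: lin3_def g3_symmetric(2)[of D \<alpha> _ \<gamma>] mult.commute)
    then show ?thesis by (simp add: vec_eq_iff sum_component axis_def mult_delta_right sum.distrib)
  qed
  ultimately show ?thesis by simp
qed

lemma cubic_eq: "intg D (point_of D x ^ 3) = (\<Sum>\<alpha>\<in>UNIV. quad3 \<alpha> x * x $ \<alpha>)"
proof -
  have 1: "intg D (cls D \<alpha> * (cls D \<beta> * point_of D x)) = lin3 \<alpha> \<beta> x" for \<alpha> \<beta>
  proof -
    have "cls D \<alpha> * (cls D \<beta> * point_of D x) = point_of D x * (cls D \<alpha> * cls D \<beta>)" by (simp only: mult_ac)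
    moreover have "intg D (cls D \<gamma> * (cls D \<alpha> * cls D \<beta>)) = g3 D \<alpha> \<beta> \<gamma>" for \<gamma> by (simp only: g3_def mult_ac)
    ultimately show ?thesis by (simp only: intg_point lin3_def mult.commute)
  qed
  have 2: "intg D (cls D \<alpha> * (point_of D x * point_of D x)) = quad3 \<alpha> x" for \<alpha>
  proof -
    have "cls D \<alpha> * (point_of D x * point_of D x) = point_of D x * (cls D \<alpha> * point_of D x)" by (simp only: mult_ac)
    moreover have "cls D \<gamma> * (cls D \<alpha> * point_of D x) = cls D \<alpha> * (cls D \<gamma> * point_of D x)" for \<gamma> by (simp only: mult_ac)
    ultimately show ?thesis by (simp only: intg_point 1 quad3_def) (simp only: mult.commute)
  qed
  have "point_of D x ^ 3 = point_of D x * (point_of D x * point_of D x)" by (simp add: power3_eq_cube mult.assoc)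
  then show ?thesis by (simp only: intg_point 2) (simp only: mult.commute)
qed

lemma cd_cubic: "((\<lambda>x. intg D (point_of D x ^ 3) / 6) has_derivative clin (\<chi> \<gamma>. quad3 \<gamma> x / 2)) (at x)"
proof -
  have "((\<lambda>x. 1 / 6 * (\<Sum>\<alpha>\<in>UNIV. quad3 \<alpha> x * x $ \<alpha>)) has_derivative
     clin ((1 / 6) *s (\<Sum>\<alpha>\<in>UNIV. quad3 \<alpha> x *s axis \<alpha> 1 + x $ \<alpha> *s (\<chi> \<gamma>. 2 * lin3 \<alpha> \<gamma> x)))) (at x)"
    by (intro cd_cmult cd_sum cd_mult cd_coord cd_quad3)
  moreover have "(1 / 6) *s (\<Sum>\<alpha>\<in>UNIV. quad3 \<alpha> x *s axis \<alpha> 1 + x $ \<alpha> *s (\<chi> \<gamma>. 2 * lin3 \<alpha> \<gamma> x)) = (\<chi> \<gamma>. quad3 \<gamma> x / 2)"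
  proof -
    have "(\<Sum>\<alpha>\<in>UNIV. x $ \<alpha> * (2 * lin3 \<alpha> \<gamma> x)) = 2 * quad3 \<gamma> x" for \<gamma>
      by (simp add: quad3_def lin3_commute[of _ \<gamma>] sum_distrib_left mult_ac)
    then show ?thesis by (simp add: vec_eq_iff sum_component axis_def mult_delta_right sum.distrib)
  qed
  ultimately show ?thesis by (simp add: cubic_eq)
qed

lemma pd3_potential:
  assumes U: "open U" and f: "holo_on f U" and x: "x \<in> U"
  shows "pd3 (potential D f) x \<alpha> \<beta> \<gamma> = g3 D \<alpha> \<beta> \<gamma> + pd3 f x \<alpha> \<beta> \<gamma>"
proof -
  have hp: "holo_on (pd \<gamma> f) U" "holo_on (pd \<beta> (pd \<gamma> f)) U" for \<beta> \<gamma>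
    using holo_on_pd[OF U] f by blast+
  have 1: "pd \<gamma> (potential D f) x = 1 / 2 * quad3 \<gamma> x + pd \<gamma> f x" if "x \<in> U" for x
    unfolding potential_def[abs_def]
    using has_derivative_pd_unique[OF cd_add[OF cd_cubic holo_on_has_derivative[OF f that]], of \<gamma>] by simp
  have 2: "pd \<beta> (pd \<gamma> (potential D f)) x = lin3 \<gamma> \<beta> x + pd \<beta> (pd \<gamma> f) x" if "x \<in> U" for x
  proof -
    have "pd \<beta> (pd \<gamma> (potential D f)) x = pd \<beta> (\<lambda>x. 1 / 2 * quad3 \<gamma> x + pd \<gamma> f x) x"
      by (rule pd_cong_fun[OF U 1 that])
    then show ?thesis
      using has_derivative_pd_unique[OF cd_add[OF cd_cmult[OF cd_quad3] holo_on_has_derivative[OF hp(1) that]], of \<beta> "1/2" \<gamma> \<gamma>] by simp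
  qed
  have "pd3 (potential D f) x \<alpha> \<beta> \<gamma> = pd \<alpha> (\<lambda>x. lin3 \<gamma> \<beta> x + pd \<beta> (pd \<gamma> f) x) x"
    by (rule pd_cong_fun[OF U 2 x])
  also have "\<dots> = g3 D \<gamma> \<beta> \<alpha> + pd3 f x \<alpha> \<beta> \<gamma>"
    using has_derivative_pd_unique[OF cd_add[OF cd_lin3 holo_on_has_derivative[OF hp(2) x]], of \<alpha> \<gamma> \<beta> \<beta> \<gamma>] by simp
  also have "g3 D \<gamma> \<beta> \<alpha> = g3 D \<alpha> \<beta> \<gamma>" by (metis g3_symmetric)
  finally show ?thesis .
qed

end

section \<open>Semi-simple solutions and the Pfaff system\<close>

context fano_manifold
begin

lemma tangent_mult_eq: "tangent_mult D F x u v = mult (pd3 F x) u v"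
proof -
  let ?C = "pd3 F x"
  have "(Smat D *v cvec ?C u v) $ \<gamma> = (\<Sum>\<alpha>\<in>UNIV. \<Sum>\<beta>\<in>UNIV. u $ \<alpha> * v $ \<beta> * (\<Sum>\<delta>\<in>UNIV. gbar D \<gamma> \<delta> * ?C \<alpha> \<beta> \<delta>))" for \<gamma>
  proof -
    have "(Smat D *v cvec ?C u v) $ \<gamma> = (\<Sum>\<delta>\<in>UNIV. \<Sum>\<alpha>\<in>UNIV. \<Sum>\<beta>\<in>UNIV. u $ \<alpha> * v $ \<beta> * (gbar D \<gamma> \<delta> * ?C \<alpha> \<beta> \<delta>))"
      by (simp add: matrix_vector_mult_def Smat_def cvec_def sum_distrib_left mult_ac)
    also have "\<dots> = (\<Sum>\<alpha>\<in>UNIV. \<Sum>\<beta>\<in>UNIV. \<Sum>\<delta>\<in>UNIV. u $ \<alpha> * v $ \<beta> * (gbar D \<gamma> \<delta> * ?C \<alpha> \<beta> \<delta>))"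
      by (rule sum_rotate)
    finally show ?thesis by (simp only: sum_distrib_left)
  qed
  then show ?thesis by (simp add: tangent_mult_def mult_def vec_eq_iff)
qed

definition algebra_at :: "('a option \<Rightarrow> 'a option \<Rightarrow> 'a option \<Rightarrow> complex) \<Rightarrow> bool" where
  "algebra_at C \<longleftrightarrow> (\<forall>u v. mult C u v = mult C v u) \<and> (\<forall>u. mult C (axis None 1) u = u) \<and>
     (\<forall>u v w. mult C (mult C u v) w = mult C u (mult C v w)) \<and> semisimple_alg (mult C)"

lemma semisimple_associative_iff:
  "semisimple_associative D U F \<longleftrightarrow> (\<forall>x\<in>U. algebra_at (pd3 F x))"
proof -
  have "tangent_mult D F x = mult (pd3 F x)" for x
    by (rule ext, rule ext, rule tangent_mult_eq)
  then show ?thesis by (simp only: semisimple_associative_def algebra_at_def Let_def)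
qed

text \<open>Simple eigenvalues make the raised eigenvectors span ideals, to which
  \<open>ideal_frame\<close> applies. That the denominators do not vanish is a conclusion, so for an
  algebra of this kind simple eigenvalues already place Y in \<open>R_dom\<close>.\<close>

lemma algebra_eigen:
  assumes sym: "\<And>\<alpha> \<beta> \<gamma>. C \<alpha> \<beta> \<gamma> = C \<beta> \<alpha> \<gamma>" "\<And>\<alpha> \<beta> \<gamma>. C \<alpha> \<beta> \<gamma> = C \<alpha> \<gamma> \<beta>"
    and M: "\<And>\<alpha> \<beta>. Mmat D Y $ \<alpha> $ \<beta> = (\<Sum>\<gamma>\<in>UNIV. E $ \<gamma> * C \<alpha> \<beta> \<gamma>)"
    and alg: "algebra_at C" and es: "eigen_system D Y a z"
  shows "R_denom D (z i) \<noteq> 0" "C \<alpha> \<beta> \<gamma> = (\<Sum>i\<in>UNIV. z i $ \<alpha> * z i $ \<beta> * z i $ \<gamma> / R_denom D (z i))"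
proof -
  have comm: "mult C u v = mult C v u" and unit: "mult C (axis None 1) u = u"
    and assoc: "mult C (mult C u v) w = mult C u (mult C v w)" for u v w
    using alg unfolding algebra_at_def by blast+
  have ev: "(Mmat D Y ** Smat D) *v z i = a i *s z i" "z i \<noteq> 0" "inj a" for i
    using es by (simp_all add: eigen_system_iff)
  note E = mult_Euler[of C "Mmat D Y" E, OF sym M]
  note ei = eigen_ideals[of C E "Mmat D Y" z a, OF comm assoc E ev]
  obtain \<chi>' where chi: "\<And>v i. mult C v (Smat D *v z i) = \<chi>' i v *s (Smat D *v z i)"
    using ei(1) by blast
  note fr = ideal_frame[of C "\<lambda>i. Smat D *v z i" \<chi>', OF sym unit chi ei(2)]
  show "R_denom D (z i) \<noteq> 0" using fr(2,3)[of i] by (simp add: R_denom_eq)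
  show "C \<alpha> \<beta> \<gamma> = (\<Sum>i\<in>UNIV. z i $ \<alpha> * z i $ \<beta> * z i $ \<gamma> / R_denom D (z i))"
    using fr(5)[of \<alpha> \<beta> \<gamma>] by (simp add: R_denom_eq)
qed

text \<open>Forwards, contraction with E identifies the ideal lines of the algebra with the
  eigenvectors of \<open>Mmat\<close>; backwards, any tensor built from an orthogonal frame with
  nonzero denominators is such an algebra, by \<open>frame_algebra\<close>.\<close>

lemma algebra_iff_R:
  assumes y: "transpose y = y" and R: "R_dom D (Ymat D x y)"
    and sym: "\<And>\<alpha> \<beta> \<gamma>. C \<alpha> \<beta> \<gamma> = C \<beta> \<alpha> \<gamma>" "\<And>\<alpha> \<beta> \<gamma>. C \<alpha> \<beta> \<gamma> = C \<alpha> \<gamma> \<beta>"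
    and M: "\<And>\<alpha> \<beta>. Mmat D (Ymat D x y) $ \<alpha> $ \<beta> = (\<Sum>\<gamma>\<in>UNIV. E $ \<gamma> * C \<alpha> \<beta> \<gamma>)"
  shows "algebra_at C \<longleftrightarrow> (\<forall>\<alpha> \<beta> \<gamma>. C \<alpha> \<beta> \<gamma> = R D (Ymat D x y) \<alpha> \<beta> \<gamma>)"
proof -
  obtain a z where z: "eigen_system D (Ymat D x y) a z" "\<And>i. R_denom D (z i) \<noteq> 0"
    "\<And>\<alpha> \<beta> \<gamma>. R D (Ymat D x y) \<alpha> \<beta> \<gamma> = (\<Sum>i\<in>UNIV. z i $ \<alpha> * z i $ \<beta> * z i $ \<gamma> / R_denom D (z i))"
    using R_value[OF R] by blast
  note fr = eigen_frame[OF y z(1,2)]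
  show ?thesis
  proof
    assume "algebra_at C"
    then show "\<forall>\<alpha> \<beta> \<gamma>. C \<alpha> \<beta> \<gamma> = R D (Ymat D x y) \<alpha> \<beta> \<gamma>"
      using algebra_eigen(2)[of C "Ymat D x y" E a z, OF sym M _ z(1)] by (simp only: z(3)) blast
  next
    assume "\<forall>\<alpha> \<beta> \<gamma>. C \<alpha> \<beta> \<gamma> = R D (Ymat D x y) \<alpha> \<beta> \<gamma>"
    then have C: "C \<alpha> \<beta> \<gamma> = (\<Sum>i\<in>UNIV. z i $ \<alpha> * z i $ \<beta> * z i $ \<gamma> / (clin (z i) (Smat D *v z i) * z i $ None))" for \<alpha> \<beta> \<gamma>
      by (simp add: z(3) R_denom_eq)
    show "algebra_at C"
      unfolding algebra_at_def
      using frame_algebra[of z "\<lambda>i. clin (z i) (Smat D *v z i)" C, OF fr C] by blast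
  qed
qed

text \<open>From here on f acts only through a function \<phi> of the Latin variables.\<close>

lemma admissible_Hessian:
  assumes adm: "admissible D U f"
  obtains \<phi> where "holo_on \<phi> (drop0 ` U)"
    "\<And>x. x \<in> U \<Longrightarrow> hess f x = hessian \<phi> (drop0 x)"
    "\<And>x \<alpha> \<beta> \<gamma>. x \<in> U \<Longrightarrow> pd3 (potential D f) x \<alpha> \<beta> \<gamma> = g3 D \<alpha> \<beta> \<gamma> + d3 \<phi> (drop0 x) \<alpha> \<beta> \<gamma>"
    "\<And>x \<alpha> \<beta>. x \<in> U \<Longrightarrow> (\<Sum>\<gamma>\<in>UNIV. euler_coeff D x \<gamma> * d3 \<phi> (drop0 x) \<alpha> \<beta> \<gamma>)
        = wt D \<alpha> \<beta> * hess_ext (hess f x) \<alpha> \<beta>"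
proof -
  have U: "open U" and f: "holo_on f U" and hom: "homogeneous_mod_affine D U f"
    using adm by (simp_all add: admissible_def)
  obtain \<phi> P where P: "x0_quadratic P" and dec: "\<And>x. x \<in> U \<Longrightarrow> f x = \<phi> (drop0 x) + P x"
    using adm by (auto simp: admissible_def indep_x0_mod_quadratic_def)
  note ix = indep_x0_decompose[OF U f P dec]
  have he: "hess f x = hessian \<phi> (drop0 x)" if "x \<in> U" for x
    using ix(2)[OF _ that] by (simp add: hess_def hessian_def)
  show ?thesis
  proof (rule that[of \<phi>])
    show "holo_on \<phi> (drop0 ` U)" by (rule ix(1))
    fix x assume x: "x \<in> U"
    show "hess f x = hessian \<phi> (drop0 x)" by (rule he[OF x])
    fix \<alpha> \<beta>
    show "pd3 (potential D f) x \<alpha> \<beta> \<gamma> = g3 D \<alpha> \<beta> \<gamma> + d3 \<phi> (drop0 x) \<alpha> \<beta> \<gamma>" for \<gamma>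
      unfolding pd3_potential[OF U f x] by (subst ix(3)) (use x in auto)
    show "(\<Sum>\<gamma>\<in>UNIV. euler_coeff D x \<gamma> * d3 \<phi> (drop0 x) \<alpha> \<beta> \<gamma>)
        = wt D \<alpha> \<beta> * hess_ext (hess f x) \<alpha> \<beta>"
    \<comment> \<open>With an index 0 both sides vanish by definition of \<open>d3\<close> and
      \<open>hess_ext\<close>; the content lies in the Latin entries.\<close>
    proof (cases "\<exists>a b. \<alpha> = Some a \<and> \<beta> = Some b")
      case True
      then obtain a b where ab: "\<alpha> = Some a" "\<beta> = Some b" by blast
      have "pd \<alpha> (pd \<beta> (\<lambda>x. euler D f x - (3 - of_nat (dimV D)) * f x)) x = 0"
        using hom x by (simp add: homogeneous_mod_affine_def)
      then have "(\<Sum>\<gamma>\<in>UNIV. euler_coeff D x \<gamma> * d3 \<phi> (drop0 x) \<alpha> \<beta> \<gamma>)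
        = wt D \<alpha> \<beta> * pd \<alpha> (pd \<beta> f) x"
        unfolding pd_euler[OF U f x] ix(3)[OF _ x, rotated] using ix(3)[OF _ _] x
        by (simp add: ix(3)[OF _ x])
      then show ?thesis by (simp add: ab hess_def)
    next
      case False
      then show ?thesis by (cases \<alpha>; cases \<beta>) auto
    qed
  qed
qed

text \<open>The classical half of the contraction is \<open>Mmat_Ymat\<close>; the other half is the
  homogeneity of f.\<close>

lemma Mmat_third:
  assumes "(\<Sum>\<gamma>\<in>UNIV. euler_coeff D x \<gamma> * d3 \<phi> w \<alpha> \<beta> \<gamma>)
        = wt D \<alpha> \<beta> * hess_ext y \<alpha> \<beta>"
  shows "Mmat D (Ymat D x y) $ \<alpha> $ \<beta> = (\<Sum>\<gamma>\<in>UNIV. (\<chi> \<gamma>. euler_coeff D x \<gamma>) $ \<gamma> * (g3 D \<alpha> \<beta> \<gamma> + d3 \<phi> w \<alpha> \<beta> \<gamma>))"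
  by (simp add: Mmat_Ymat assms[symmetric] distrib_left sum.distrib)

lemma third_symmetric:
  assumes "open W" "holo_on \<phi> W" "w \<in> W"
  shows "g3 D \<alpha> \<beta> \<gamma> + d3 \<phi> w \<alpha> \<beta> \<gamma> = g3 D \<beta> \<alpha> \<gamma> + d3 \<phi> w \<beta> \<alpha> \<gamma>"
    "g3 D \<alpha> \<beta> \<gamma> + d3 \<phi> w \<alpha> \<beta> \<gamma> = g3 D \<alpha> \<gamma> \<beta> + d3 \<phi> w \<alpha> \<gamma> \<beta>"
  by (simp only: g3_symmetric(1)[of D \<alpha> \<beta>] d3_symmetric(1)[OF assms, of \<alpha> \<beta>],
      simp only: g3_symmetric(2)[of D \<alpha> \<beta> \<gamma>] d3_symmetric(2)[OF assms, of \<alpha> \<beta> \<gamma>])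

text \<open>The entries with an index 0 agree automatically: by \<open>R_None\<close> both sides are
  the Gram matrix there.\<close>

lemma third_iff_r:
  assumes W: "open W" "holo_on \<phi> W" "drop0 x \<in> W" and y: "transpose y = y" and R: "R_dom D (Ymat D x y)"
  shows "(\<forall>\<alpha> \<beta> \<gamma>. g3 D \<alpha> \<beta> \<gamma> + d3 \<phi> (drop0 x) \<alpha> \<beta> \<gamma> = R D (Ymat D x y) \<alpha> \<beta> \<gamma>)
    \<longleftrightarrow> (\<forall>a b c. pd3 \<phi> (drop0 x) a b c = r D (drop0 x) y a b c)"
proof
  assume *: "\<forall>\<alpha> \<beta> \<gamma>. g3 D \<alpha> \<beta> \<gamma> + d3 \<phi> (drop0 x) \<alpha> \<beta> \<gamma> = R D (Ymat D x y) \<alpha> \<beta> \<gamma>"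
  show "\<forall>a b c. pd3 \<phi> (drop0 x) a b c = r D (drop0 x) y a b c"
  proof (intro allI)
    fix a b c
    show "pd3 \<phi> (drop0 x) a b c = r D (drop0 x) y a b c"
      using *[rule_format, of "Some a" "Some b" "Some c"]
      unfolding r_full_eq[symmetric] r_full_def by (simp add: algebra_simps)
  qed
next
  assume *: "\<forall>a b c. pd3 \<phi> (drop0 x) a b c = r D (drop0 x) y a b c"
  have N: "R D (Ymat D x y) None \<beta> \<gamma> = g2 D \<beta> \<gamma>" "R D (Ymat D x y) \<beta> None \<gamma> = g2 D \<beta> \<gamma>" "R D (Ymat D x y) \<beta> \<gamma> None = g2 D \<beta> \<gamma>" for \<beta> \<gamma>
    using R_None[OF y R] R_symmetric by metis+
  have G: "g3 D \<beta> None \<gamma> = g2 D \<beta> \<gamma>" "g3 D \<beta> \<gamma> None = g2 D \<beta> \<gamma>" for \<beta> \<gamma>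
    by (simp_all add: g3_def g2_def)
  show "\<forall>\<alpha> \<beta> \<gamma>. g3 D \<alpha> \<beta> \<gamma> + d3 \<phi> (drop0 x) \<alpha> \<beta> \<gamma> = R D (Ymat D x y) \<alpha> \<beta> \<gamma>"
  proof (intro allI)
    fix \<alpha> \<beta> \<gamma>
    show "g3 D \<alpha> \<beta> \<gamma> + d3 \<phi> (drop0 x) \<alpha> \<beta> \<gamma> = R D (Ymat D x y) \<alpha> \<beta> \<gamma>"
    proof (cases "\<exists>a b c. \<alpha> = Some a \<and> \<beta> = Some b \<and> \<gamma> = Some c")
      case True
      then obtain a b c where "\<alpha> = Some a" "\<beta> = Some b" "\<gamma> = Some c" by blast
      then show ?thesis using *[rule_format, of a b c]
        unfolding r_full_eq[symmetric] r_full_def by simp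
    next
      case False
      then show ?thesis by (cases \<alpha>; cases \<beta>; cases \<gamma>) (simp_all add: N G)
    qed
  qed
qed

lemma algebra_iff_r:
  assumes W: "open W" "holo_on \<phi> W" "drop0 x \<in> W" and R: "R_dom D (Ymat D x (hessian \<phi> (drop0 x)))"
    and E: "\<And>\<alpha> \<beta>. (\<Sum>\<gamma>\<in>UNIV. euler_coeff D x \<gamma> * d3 \<phi> (drop0 x) \<alpha> \<beta> \<gamma>)
        = wt D \<alpha> \<beta> * hess_ext (hessian \<phi> (drop0 x)) \<alpha> \<beta>"
  shows "algebra_at (\<lambda>\<alpha> \<beta> \<gamma>. g3 D \<alpha> \<beta> \<gamma> + d3 \<phi> (drop0 x) \<alpha> \<beta> \<gamma>)
    \<longleftrightarrow> (\<forall>a b c. pd3 \<phi> (drop0 x) a b c = r D (drop0 x) (hessian \<phi> (drop0 x)) a b c)"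
proof -
  note th = transpose_hessian[OF W]
  show ?thesis
    unfolding third_iff_r[OF W th R, symmetric]
    by (rule algebra_iff_R[OF th R third_symmetric[OF W] Mmat_third[OF E]])
qed

text \<open>Pointwise, associativity says that the third derivatives of \<phi> are r. These are the
  first derivatives of its Hessian, so this is the Pfaff system for y =
  \<open>hessian \<phi>\<close>, and homogeneity then reads as the constraint.\<close>

lemma semisimple_iff_pfaff:
  assumes adm: "admissible D U f" and R: "\<And>x. x \<in> U \<Longrightarrow> R_dom D (Ymat D x (hess f x))"
  shows "semisimple_associative D U (potential D f) \<longleftrightarrow>
    (\<exists>y. pfaff_problem D (drop0 ` U) y \<and> (\<forall>x\<in>U. y (drop0 x) = hess f x))"
proof -
  have U: "open U" using adm by (simp add: admissible_def)
  let ?W = "drop0 ` U"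
  have W: "open ?W" by (rule open_drop0_image[OF U])
  obtain \<phi> where \<phi>: "holo_on \<phi> ?W" and he: "\<And>x. x \<in> U \<Longrightarrow> hess f x = hessian \<phi> (drop0 x)"
    and third: "\<And>x \<alpha> \<beta> \<gamma>. x \<in> U \<Longrightarrow> pd3 (potential D f) x \<alpha> \<beta> \<gamma> = g3 D \<alpha> \<beta> \<gamma> + d3 \<phi> (drop0 x) \<alpha> \<beta> \<gamma>"
    and E: "\<And>x \<alpha> \<beta>. x \<in> U \<Longrightarrow> (\<Sum>\<gamma>\<in>UNIV. euler_coeff D x \<gamma> * d3 \<phi> (drop0 x) \<alpha> \<beta> \<gamma>)
        = wt D \<alpha> \<beta> * hess_ext (hess f x) \<alpha> \<beta>"
    by (rule admissible_Hessian[OF adm]) (rule that)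
  have pt: "algebra_at (pd3 (potential D f) x)
    \<longleftrightarrow> (\<forall>a b c. pd3 \<phi> (drop0 x) a b c = r D (drop0 x) (hessian \<phi> (drop0 x)) a b c)" if x: "x \<in> U" for x
    unfolding third[OF x] by (rule algebra_iff_r[OF W \<phi> _ R[OF x, unfolded he[OF x]] E[OF x, unfolded he[OF x]]]) (use x in blast)
  have hd: "((\<lambda>w. hessian \<phi> w $ a $ b) has_derivative clin (\<chi> c. pd c (pd a (pd b \<phi>)) w)) (at w)" if "w \<in> ?W" for w a b
    using holo_on_has_derivative[OF holo_on_pd[OF W holo_on_pd[OF W \<phi>]] that] by (simp add: hessian_def)
  show ?thesis
  proof
    assume "semisimple_associative D U (potential D f)"
    then have third_r: "pd3 \<phi> w a b c = r D w (hessian \<phi> w) a b c" if "w \<in> ?W" for w a b c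
      using that pt unfolding semisimple_associative_iff by blast
    have "pfaff_problem D ?W (hessian \<phi>)"
      unfolding pfaff_problem_def
    proof (intro conjI ballI allI)
      show "open ?W" by (rule W)
      fix w assume w: "w \<in> ?W"
      then obtain x where x: "x \<in> U" "w = drop0 x" by blast
      show "r_dom D w (hessian \<phi> w)"
        using R[OF x(1)] transpose_hessian[OF W \<phi> w] R_dom_shift[of x] by (simp add: r_dom_def he[OF x(1)] x(2))
      fix a b
      have "(\<lambda>v. \<Sum>c\<in>UNIV. r D w (hessian \<phi> w) a b c * v $ c) = clin (\<chi> c. pd c (pd a (pd b \<phi>)) w)"
        unfolding clin_def[abs_def] third_r[OF w] vec_lambda_beta
        by (rule ext, rule sum.cong[OF refl]) (metis r_symmetric)
      then show "((\<lambda>w. hessian \<phi> w $ a $ b) has_derivative (\<lambda>v. \<Sum>c\<in>UNIV. r D w (hessian \<phi> w) a b c * v $ c)) (at w)"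
        using hd[OF w] by simp
    next
      fix w assume w: "w \<in> ?W"
      then obtain x where x: "x \<in> U" "w = drop0 x" by blast
      show "constraint D w (hessian \<phi> w)"
        unfolding constraint_def
      proof (intro allI)
        fix a b
        show "(\<Sum>c\<in>UNIV. (c_coord D (Some c) + (1 - of_nat (deg D (Some c))) * w $ c) * r D w (hessian \<phi> w) a b c)
          = wt D (Some a) (Some b) * hessian \<phi> w $ a $ b"
          using E[OF x(1), of "Some a" "Some b"]
          by (simp add: sum_option_UNIV euler_coeff_def he[OF x(1)] x(2) third_r[OF w, unfolded x(2)])
      qed
    qed
    with he show "\<exists>y. pfaff_problem D ?W y \<and> (\<forall>x\<in>U. y (drop0 x) = hess f x)" by (intro exI[of _ "hessian \<phi>"]) simp
  next
    assume "\<exists>y. pfaff_problem D ?W y \<and> (\<forall>x\<in>U. y (drop0 x) = hess f x)"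
    then obtain y where y: "pfaff_problem D ?W y" "\<And>x. x \<in> U \<Longrightarrow> y (drop0 x) = hess f x" by blast
    have yh: "y w = hessian \<phi> w" if "w \<in> ?W" for w using that y(2) he by auto
    have third_r: "pd c (pd a (pd b \<phi>)) w = r D w (hessian \<phi> w) a b c" if w: "w \<in> ?W" for w a b c
    proof -
      have "((\<lambda>w. y w $ a $ b) has_derivative clin (\<chi> c. r D w (y w) a b c)) (at w)"
      proof -
        have "\<forall>w\<in>?W. \<forall>a b. ((\<lambda>w. y w $ a $ b) has_derivative (\<lambda>v. \<Sum>c\<in>UNIV. r D w (y w) a b c * v $ c)) (at w)"
          using y(1) unfolding pfaff_problem_def by (elim conjE)
        from this[rule_format, OF w, of a b] show ?thesis by (simp only: clin_def[abs_def] vec_lambda_beta)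
      qed
      then have "((\<lambda>w. hessian \<phi> w $ a $ b) has_derivative clin (\<chi> c. r D w (y w) a b c)) (at w)"
        by (rule has_derivative_transform_within_open[OF _ W w]) (simp add: yh)
      from has_derivative_pd_unique[OF this, of c] show ?thesis
        using has_derivative_pd_unique[OF hd[OF w], of c] yh[OF w] by simp
    qed
    show "semisimple_associative D U (potential D f)"
      unfolding semisimple_associative_iff
    proof
      fix x assume x: "x \<in> U"
      have "pd3 \<phi> (drop0 x) a b c = r D (drop0 x) (hessian \<phi> (drop0 x)) a b c" for a b c
      proof -
        have "pd3 \<phi> (drop0 x) a b c = r D (drop0 x) (hessian \<phi> (drop0 x)) b c a"
          by (rule third_r) (use x in blast)
        then show ?thesis by (metis r_symmetric)
      qed
      then show "algebra_at (pd3 (potential D f) x)" using pt[OF x] by blast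
    qed
  qed
qed

section \<open>From solutions of the Pfaff system back to potentials\<close>

lemma drop0_image_vimage: "drop0 ` (drop0 -` W) = W"
proof -
  have "surj drop0" by (rule surjI[of _ insert0]) simp
  then show ?thesis by (rule surj_image_vimage_eq)
qed

text \<open>Symmetry of r in its last two indices makes each row of y a closed form on a ball;
  symmetry of y makes the family of their primitives closed in turn. The second primitive, pulled
  back along \<open>drop0\<close>, is f, and the constraint is its homogeneity.\<close>

lemma pfaff_potential:
  assumes pf: "pfaff_problem D W y" and w0: "w0 \<in> W"
  shows "\<exists>W' f. open W' \<and> w0 \<in> W' \<and> W' \<subseteq> W \<and> admissible D (drop0 -` W') f \<and>
     semisimple_associative D (drop0 -` W') (potential D f) \<and> (\<forall>x\<in>drop0 -` W'. y (drop0 x) = hess f x)"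
proof -
  have W: "open W" and rd: "\<And>w. w \<in> W \<Longrightarrow> r_dom D w (y w)"
    and dy: "\<And>w a b. w \<in> W \<Longrightarrow> ((\<lambda>w. y w $ a $ b) has_derivative clin (\<chi> c. r D w (y w) a b c)) (at w)"
    and co: "\<And>w. w \<in> W \<Longrightarrow> constraint D w (y w)"
    using pf unfolding pfaff_problem_def clin_def[abs_def] by auto
  obtain \<epsilon> where e: "\<epsilon> > 0" "ball w0 \<epsilon> \<subseteq> W" using W w0 open_contains_ball by blast
  let ?V = "ball w0 \<epsilon>"
  have sub: "w \<in> W" if "w \<in> ?V" for w using that e by blast
  have hy: "holo_on (\<lambda>w. y w $ a $ b) ?V" for a b by (rule holo_onI, rule dy, rule sub)
  have pdy: "pd c (\<lambda>w. y w $ a $ b) w = r D w (y w) a b c" if "w \<in> ?V" for a b c w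
    using has_derivative_pd_unique[OF dy[OF sub[OF that]]] by simp
  have "\<exists>\<psi>. \<forall>w\<in>?V. (\<psi> has_derivative clin (\<chi> b. y w $ a $ b)) (at w)" for a
    by (rule poincare_ball[of "\<lambda>b w. y w $ a $ b", OF hy]) (simp add: pdy r_symmetric(2)[of D _ _ a])
  then obtain \<psi> where psi: "\<And>a w. w \<in> ?V \<Longrightarrow> (\<psi> a has_derivative clin (\<chi> b. y w $ a $ b)) (at w)" by metis
  have hpsi: "holo_on (\<psi> a) ?V" for a by (rule holo_onI, rule psi)
  have ysym: "y w $ a $ b = y w $ b $ a" if "w \<in> ?V" for w a b
  proof -
    have "transpose (y w) = y w" using rd[OF sub[OF that]] by (simp add: r_dom_def)
    then have "y w $ a $ b = transpose (y w) $ a $ b" by simp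
    then show ?thesis by (simp add: transpose_def)
  qed
  have pdpsi: "pd b (\<psi> a) w = y w $ a $ b" if "w \<in> ?V" for a b w
    using has_derivative_pd_unique[OF psi[OF that]] by simp
  have "\<exists>\<phi>. \<forall>w\<in>?V. (\<phi> has_derivative clin (\<chi> a. \<psi> a w)) (at w)"
    by (rule poincare_ball[of \<psi>, OF hpsi]) (simp add: pdpsi ysym)
  then obtain \<phi> where phi: "\<And>w. w \<in> ?V \<Longrightarrow> (\<phi> has_derivative clin (\<chi> a. \<psi> a w)) (at w)" by blast
  have hphi: "holo_on \<phi> ?V" by (rule holo_onI, rule phi)
  have p1: "pd a \<phi> w = \<psi> a w" if "w \<in> ?V" for a w
    using has_derivative_pd_unique[OF phi[OF that]] by simp
  have p2: "pd b (pd a \<phi>) w = y w $ a $ b" if "w \<in> ?V" for a b w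
    using pd_cong_fun[OF open_ball p1 that] pdpsi[OF that] by simp
  have p3: "pd c (pd b (pd a \<phi>)) w = r D w (y w) a b c" if "w \<in> ?V" for a b c w
    using pd_cong_fun[OF open_ball p2 that] pdy[OF that] by simp
  let ?U = "drop0 -` ?V :: (complex^('a option)) set" and ?f = "\<lambda>x. \<phi> (drop0 x)"
  have U: "open ?U" by (rule open_drop0_vimage) simp
  have hf: "holo_on ?f ?U" by (rule holo_on_drop0[OF hphi])
  have P: "x0_quadratic (\<lambda>x :: complex^('a option). 0)"
    unfolding x0_quadratic_def by (intro exI[of _ 0]) simp
  note ix = indep_x0_decompose[OF U hf P, of \<phi>, simplified]
  have he: "hess ?f x = y (drop0 x)" if "x \<in> ?U" for x
    using ix(2)[of x] that p2[of "drop0 x"] ysym[of "drop0 x"] by (simp add: hess_def vec_eq_iff)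
  have q1: "pd \<gamma> ?f x = (case \<gamma> of None \<Rightarrow> 0 | Some a \<Rightarrow> pd a \<phi> (drop0 x))" if "x \<in> ?U" for \<gamma> x
    by (rule pd_drop0[OF hphi]) (use that in simp)
  have q2: "pd \<alpha> (pd \<beta> ?f) x = hess_ext (y (drop0 x)) \<alpha> \<beta>" if x: "x \<in> ?U" for \<alpha> \<beta> x
  proof (cases \<beta>)
    case None
    have "pd \<alpha> (pd \<beta> ?f) x = pd \<alpha> (\<lambda>x. 0) x"
      by (rule pd_cong_fun[OF U _ x]) (simp add: q1 None)
    then show ?thesis by (simp add: None)
  next
    case (Some b)
    have "pd \<alpha> (pd \<beta> ?f) x = pd \<alpha> (\<lambda>x. pd b \<phi> (drop0 x)) x"
      by (rule pd_cong_fun[OF U _ x]) (simp add: q1 Some)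
    also have "\<dots> = (case \<alpha> of None \<Rightarrow> 0 | Some a \<Rightarrow> pd a (pd b \<phi>) (drop0 x))"
      by (rule pd_drop0[OF holo_on_pd[OF open_ball hphi]]) (use x in simp)
    finally show ?thesis using p2[of "drop0 x"] ysym[of "drop0 x"] x by (cases \<alpha>) (simp_all add: Some)
  qed
  have adm: "admissible D ?U ?f"
    unfolding admissible_def
  proof (intro conjI)
    show "indep_x0_mod_quadratic ?U ?f"
      unfolding indep_x0_mod_quadratic_def using P by (intro exI[of _ \<phi>] exI[of _ "\<lambda>x. 0"]) simp
    show "homogeneous_mod_affine D ?U ?f"
      unfolding homogeneous_mod_affine_def
    proof (intro ballI allI)
      fix x \<alpha> \<beta> assume x: "x \<in> ?U"
      then have w: "drop0 x \<in> ?V" by simp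
      have 3: "pd \<alpha> (pd \<beta> (pd \<gamma> ?f)) x = d3 \<phi> (drop0 x) \<alpha> \<beta> \<gamma>" for \<gamma> using ix(3)[of x] x by simp
      show "pd \<alpha> (pd \<beta> (\<lambda>x. euler D ?f x - (3 - of_nat (dimV D)) * ?f x)) x = 0"
        unfolding pd_euler[OF U hf x] 3 q2[OF x]
      proof (cases "\<exists>a b. \<alpha> = Some a \<and> \<beta> = Some b")
        case True
        then obtain a b where ab: "\<alpha> = Some a" "\<beta> = Some b" by blast
        have "r D (drop0 x) (y (drop0 x)) c b a = r D (drop0 x) (y (drop0 x)) a b c" for c by (metis r_symmetric)
        then show "(\<Sum>\<gamma>\<in>UNIV. euler_coeff D x \<gamma> * d3 \<phi> (drop0 x) \<alpha> \<beta> \<gamma>)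
            - wt D \<alpha> \<beta> * hess_ext (y (drop0 x)) \<alpha> \<beta> = 0"
          using co[OF sub[OF w]] unfolding constraint_def
          by (simp add: ab sum_option_UNIV euler_coeff_def p3[OF w])
      next
        case False
        then show "(\<Sum>\<gamma>\<in>UNIV. euler_coeff D x \<gamma> * d3 \<phi> (drop0 x) \<alpha> \<beta> \<gamma>)
            - wt D \<alpha> \<beta> * hess_ext (y (drop0 x)) \<alpha> \<beta> = 0"
          by (cases \<alpha>; cases \<beta>) auto
      qed
    qed
  qed (use U hf in auto)
  have Rd: "R_dom D (Ymat D x (hess ?f x))" if x: "x \<in> ?U" for x
  proof -
    have "drop0 x \<in> W" using sub x by simp
    then show ?thesis using rd[of "drop0 x"] by (simp only: r_dom_def he[OF x] R_dom_shift[of x])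
  qed
  have "pfaff_problem D (drop0 ` ?U) y"
    unfolding drop0_image_vimage using pf sub unfolding pfaff_problem_def by auto
  then have "\<exists>y. pfaff_problem D (drop0 ` ?U) y \<and> (\<forall>x\<in>?U. y (drop0 x) = hess ?f x)"
    by (intro exI[of _ y] conjI ballI) (simp_all only: he)
  then have "semisimple_associative D ?U (potential D ?f)"
    using semisimple_iff_pfaff[OF adm] Rd by blast
  then show ?thesis using adm he e sub by (intro exI[of _ ?V] exI[of _ ?f]) auto
qed

text \<open>On a connected set the gradients of the two functions of the Latin variables differ by a
  constant vector k, so the functions differ by \<open>clin k\<close> plus a constant; both are
  absorbed in the polynomial.\<close>

lemma potential_unique:
  fixes f f' :: "complex^('a option) \<Rightarrow> complex"
  assumes W: "connected W" and adm: "admissible D (drop0 -` W) f" "admissible D (drop0 -` W) f'"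
    and he: "\<And>x. x \<in> drop0 -` W \<Longrightarrow> hess f x = hess f' x"
  shows "\<exists>P. x0_quadratic P \<and> (\<forall>x\<in>drop0 -` W. f x = f' x + P x)"
proof -
  let ?U = "drop0 -` W :: (complex^('a option)) set"
  have U: "open ?U" and f: "holo_on f ?U" "holo_on f' ?U"
    using adm by (simp_all add: admissible_def)
  have oW: "open W" using open_drop0_image[OF U] by (simp only: drop0_image_vimage)
  obtain \<phi> P where P: "x0_quadratic P" and dec: "\<And>x. x \<in> ?U \<Longrightarrow> f x = \<phi> (drop0 x) + P x"
    using adm(1) by (auto simp: admissible_def indep_x0_mod_quadratic_def)
  obtain \<phi>' P' where P': "x0_quadratic P'" and dec': "\<And>x. x \<in> ?U \<Longrightarrow> f' x = \<phi>' (drop0 x) + P' x"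
    using adm(2) by (auto simp: admissible_def indep_x0_mod_quadratic_def)
  note i = indep_x0_decompose[OF U f(1) P dec, unfolded drop0_image_vimage]
  note i' = indep_x0_decompose[OF U f(2) P' dec', unfolded drop0_image_vimage]
  have he': "pd a (pd b \<phi>) w = pd a (pd b \<phi>') w" if "w \<in> W" for a b w
  proof -
    have x: "insert0 w \<in> ?U" using that by simp
    have "hess f (insert0 w) $ a $ b = hess f' (insert0 w) $ a $ b" using he[OF x] by simp
    then show ?thesis using i(2)[OF _ x, of a b] i'(2)[OF _ x, of a b] by (simp add: hess_def)
  qed
  define \<delta> where "\<delta> b w = pd b \<phi> w - pd b \<phi>' w" for b w
  have hd: "holo_on (\<delta> b) W" for b
    unfolding \<delta>_def by (intro holo_on_diff holo_on_pd oW i(1) i'(1))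
  have "pd a (\<delta> b) w = 0" if "w \<in> W" for a b w
    unfolding \<delta>_def[abs_def]
    using pd_diff[OF holo_on_pd[OF oW i(1)] holo_on_pd[OF oW i'(1)] that, of a b b] he'[OF that] by simp
  note const1 = holo_on_eq_const[OF oW W hd this]
  obtain k where k: "\<And>b w. w \<in> W \<Longrightarrow> \<delta> b w = k $ b"
  proof (cases "W = {}")
    case False
    then obtain w1 where w1: "w1 \<in> W" by blast
    show thesis by (rule that[of "\<chi> b. \<delta> b w1"]) (simp only: vec_lambda_beta const1[OF _ w1])
  qed (use that in blast)
  define \<epsilon> where "\<epsilon> w = \<phi> w - \<phi>' w - clin k w" for w
  have "(\<epsilon> has_derivative clin 0) (at w)" if w: "w \<in> W" for w
  proof -
    have "(clin k has_derivative clin k) (at w)"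
      by (rule bounded_linear_imp_has_derivative[OF clin.bounded_linear_right])
    from cd_diff[OF cd_diff[OF holo_on_has_derivative[OF i(1) w] holo_on_has_derivative[OF i'(1) w]] this]
    have "(\<epsilon> has_derivative clin ((\<chi> i. pd i \<phi> w) - (\<chi> i. pd i \<phi>' w) - k)) (at w)"
      unfolding \<epsilon>_def[abs_def] .
    moreover have "(\<chi> i. pd i \<phi> w) - (\<chi> i. pd i \<phi>' w) - k = 0"
      using k[OF w] by (simp add: vec_eq_iff \<delta>_def)
    ultimately show ?thesis by simp
  qed
  then have "holo_on \<epsilon> W" "\<And>w a. w \<in> W \<Longrightarrow> pd a \<epsilon> w = 0"
    using holo_onI[of W \<epsilon> "\<lambda>w. 0"] has_derivative_pd_unique[of \<epsilon> 0] by auto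
  note const2 = holo_on_eq_const[OF oW W this]
  obtain t where t: "\<And>w. w \<in> W \<Longrightarrow> \<epsilon> w = t"
  proof (cases "W = {}")
    case False
    then obtain w1 where w1: "w1 \<in> W" by blast
    show thesis by (rule that[of "\<epsilon> w1"]) (simp only: const2[OF _ w1])
  qed (use that in blast)
  let ?P = "\<lambda>x. P x - P' x + clin k (drop0 x) + t"
  have "x0_quadratic ?P"
  proof -
    obtain q m e l k1 where 1: "\<forall>x. P x = q * (x $ None)\<^sup>2 + x $ None * (\<Sum>a\<in>UNIV. (l::complex^'a) $ a * x $ Some a)
           + m * x $ None + (\<Sum>a\<in>UNIV. (k1::complex^'a) $ a * x $ Some a) + e"
      using P unfolding x0_quadratic_def by (elim exE) (rule that)
    obtain q' m' e' l' k' where 2: "\<forall>x. P' x = q' * (x $ None)\<^sup>2 + x $ None * (\<Sum>a\<in>UNIV. (l'::complex^'a) $ a * x $ Some a)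
           + m' * x $ None + (\<Sum>a\<in>UNIV. (k'::complex^'a) $ a * x $ Some a) + e'"
      using P' unfolding x0_quadratic_def by (elim exE) (rule that)
    show ?thesis unfolding x0_quadratic_def
      by (intro exI[of _ "q - q'"] exI[of _ "m - m'"] exI[of _ "e - e' + t"] exI[of _ "l - l'"] exI[of _ "k1 - k' + k"])
         (simp add: 1 2 clin_def algebra_simps sum.distrib sum_subtractf)
  qed
  moreover have "f x = f' x + ?P x" if x: "x \<in> ?U" for x
  proof -
    have "\<phi> (drop0 x) = \<phi>' (drop0 x) + (clin k (drop0 x) + t)"
      using t[of "drop0 x"] x by (simp add: \<epsilon>_def diff_eq_eq add_ac)
    then show ?thesis using dec[OF x] dec'[OF x] by simp
  qed
  ultimately show ?thesis by blast
qed

text \<open>Subtracting the constraint leaves n times a linear form in w for each pair a, b.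
  Vanishing on a nonempty open set kills the coefficients of the form, as its derivative
  shows.\<close>

lemma cubic_term_iff:
  assumes pf: "pfaff_problem D W y" and ne: "W \<noteq> {}"
  shows "(\<forall>w\<in>W. constraint_with_cubic_term D w (y w)) \<longleftrightarrow> (\<forall>a b c. g3 D (Some a) (Some b) (Some c) = 0)"
proof -
  have W: "open W" and co: "\<And>w. w \<in> W \<Longrightarrow> constraint D w (y w)"
    using pf by (simp_all add: pfaff_problem_def)
  have iff: "constraint_with_cubic_term D w (y w) \<longleftrightarrow> (\<forall>a b. (\<Sum>c\<in>UNIV. g3 D (Some a) (Some b) (Some c) * w $ c) = 0)" if "w \<in> W" for w
    using co[OF that] dim_pos by (simp add: constraint_def constraint_with_cubic_term_def)
  show ?thesis
  proof
    assume *: "\<forall>w\<in>W. constraint_with_cubic_term D w (y w)"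
    show "\<forall>a b c. g3 D (Some a) (Some b) (Some c) = 0"
    proof (intro allI)
      fix a b c
      obtain w0 where w0: "w0 \<in> W" using ne by blast
      let ?h = "\<lambda>w. clin (\<chi> c. g3 D (Some a) (Some b) (Some c)) w"
      have "?h w = 0" if "w \<in> W" for w using * iff[OF that] that by (simp add: clin_def)
      then have "pd c ?h w0 = pd c (\<lambda>w. 0) w0" by (intro pd_cong_fun[OF W _ w0])
      moreover have "(?h has_derivative ?h) (at w0)"
        by (rule bounded_linear_imp_has_derivative[OF clin.bounded_linear_right])
      from has_derivative_pd_unique[OF this] have "pd c ?h w0 = g3 D (Some a) (Some b) (Some c)" by simp
      ultimately show "g3 D (Some a) (Some b) (Some c) = 0" by simp
    qed
  qed (use iff in simp)
qed

end

section \<open>Simplicity of the eigenvalues on a dense set\<close>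

lemma pderiv_sum': "pderiv (\<Sum>k\<in>K. p k) = (\<Sum>k\<in>K. pderiv (p k))"
  by (induction K rule: infinite_finite_induct) (simp_all add: pderiv_add)

text \<open>The product rule for L^k w, where L has derivative L' and w is constant.\<close>

primrec dkry :: "complex^'i::finite^'i \<Rightarrow> complex^'i^'i \<Rightarrow> complex^'i \<Rightarrow> nat \<Rightarrow> complex^'i" where
  "dkry L L' w 0 = 0"
| "dkry L L' w (Suc k) = L' *v kry L w k + L *v dkry L L' w k"

lemma kry_has_derivative:
  fixes L :: "complex \<Rightarrow> complex^'i::finite^'i"
  assumes "\<And>\<alpha> \<beta>. ((\<lambda>t. L t $ \<alpha> $ \<beta>) has_field_derivative L' $ \<alpha> $ \<beta>) (at t0)"
  shows "((\<lambda>t. kry (L t) w k $ \<alpha>) has_field_derivative dkry (L t0) L' w k $ \<alpha>) (at t0)"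
proof (induction k arbitrary: \<alpha>)
  case (Suc k)
  have "((\<lambda>t. \<Sum>\<beta>\<in>UNIV. L t $ \<alpha> $ \<beta> * kry (L t) w k $ \<beta>) has_field_derivative
     (\<Sum>\<beta>\<in>UNIV. L t0 $ \<alpha> $ \<beta> * dkry (L t0) L' w k $ \<beta> + L' $ \<alpha> $ \<beta> * kry (L t0) w k $ \<beta>)) (at t0)"
    by (intro DERIV_sum DERIV_mult' assms Suc.IH)
  then show ?case by (simp add: matrix_vector_mult_def sum.distrib add.commute)
qed simp

lemma field_differentiable_prod':
  fixes f :: "'k \<Rightarrow> complex \<Rightarrow> complex"
  assumes "\<And>k. k \<in> K \<Longrightarrow> f k field_differentiable (at z within T)"
  shows "(\<lambda>t. \<Prod>k\<in>K. f k t) field_differentiable (at z within T)"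
  using assms
  by (induction K rule: infinite_finite_induct) (auto intro!: field_differentiable_mult field_differentiable_const)

lemma field_differentiable_det:
  fixes A :: "complex \<Rightarrow> complex^'i::finite^'i"
  assumes "\<And>i j. (\<lambda>t. A t $ i $ j) field_differentiable (at z within T)"
  shows "(\<lambda>t. det (A t)) field_differentiable (at z within T)"
  unfolding det_def
  by (intro field_differentiable_sum field_differentiable_mult field_differentiable_const field_differentiable_prod' assms)

lemma continuous_on_det:
  fixes A :: "'b::topological_space \<Rightarrow> complex^'i::finite^'i"
  assumes "\<And>i j. continuous_on U (\<lambda>x. A x $ i $ j)"
  shows "continuous_on U (\<lambda>x. det (A x))"
  unfolding det_def by (intro continuous_on_sum continuous_on_mult continuous_on_const continuous_on_prod assms)

lemma continuous_on_kry:
  fixes L :: "'b::topological_space \<Rightarrow> complex^'i::finite^'i"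
  assumes "\<And>\<alpha> \<beta>. continuous_on U (\<lambda>x. L x $ \<alpha> $ \<beta>)"
  shows "continuous_on U (\<lambda>x. kry (L x) w k $ \<alpha>)"
proof (induction k arbitrary: \<alpha>)
  case (Suc k)
  show ?case unfolding kry_Suc matrix_vector_mult_def vec_lambda_beta
    by (intro continuous_on_sum continuous_on_mult assms Suc.IH)
qed (simp add: continuous_on_const)

text \<open>The columns outside K are free and complete the Krylov vectors to a square matrix.
  Independence of these vectors becomes nonvanishing of a determinant, which persists near a point
  and gives access to Cramer's rule.\<close>

definition part_krylov :: "complex^'i::finite^'i \<Rightarrow> complex^'i \<Rightarrow> 'i set \<Rightarrow> ('i \<Rightarrow> nat) \<Rightarrow> complex^'i^'i \<Rightarrow> complex^'i^'i" where
  "part_krylov L v K \<iota> W = (\<chi> \<alpha> k. if k \<in> K then kry L v (\<iota> k) $ \<alpha> else W $ \<alpha> $ k)"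

lemma part_krylov_mult:
  assumes "\<And>k. k \<notin> K \<Longrightarrow> c $ k = 0"
  shows "part_krylov L v K \<iota> W *v c = (\<Sum>k\<in>K. c $ k *s kry L v (\<iota> k))"
proof -
  have "part_krylov L v K \<iota> W *v c = (\<Sum>k\<in>UNIV. c $ k *s column k (part_krylov L v K \<iota> W))"
    by (rule matrix_mult_sum)
  also have "\<dots> = (\<Sum>k\<in>K. c $ k *s column k (part_krylov L v K \<iota> W))"
    by (rule sum.mono_neutral_right) (auto simp: assms)
  also have "\<dots> = (\<Sum>k\<in>K. c $ k *s kry L v (\<iota> k))"
    by (rule sum.cong) (auto simp: part_krylov_def column_def vec_eq_iff)
  finally show ?thesis .
qed

context frobenius
begin

text \<open>The frame comes from semi-simplicity, so the eigenvalues \<open>\<chi>' i E\<close> may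
  coincide; this is the situation that the density argument has to exclude.\<close>

lemma semisimple_frame:
  assumes sym: "\<And>\<alpha> \<beta> \<gamma>. C \<alpha> \<beta> \<gamma> = C \<beta> \<alpha> \<gamma>" "\<And>\<alpha> \<beta> \<gamma>. C \<alpha> \<beta> \<gamma> = C \<alpha> \<gamma> \<beta>"
    and comm: "\<And>v w. mult C v w = mult C w v" and unit: "\<And>v. mult C (axis e0 1) v = v"
    and assoc: "\<And>v w x. mult C (mult C v w) x = mult C v (mult C w x)" and ss: "semisimple_alg (mult C)"
    and E: "\<And>v. mult C E v = (S ** M) *v v"
  obtains u :: "'i \<Rightarrow> complex^'i" and \<chi>' \<eta> where "\<And>v i. mult C v (u i) = \<chi>' i v *s u i"
    "\<And>i. (M ** S) *v (G *v u i) = \<chi>' i E *s (G *v u i)"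
    "\<And>i j. clin (G *v u i) (u j) = (if i = j then \<eta> i else 0)" "\<And>i. \<eta> i \<noteq> 0"
    "\<And>i. (G *v u i) $ e0 \<noteq> 0" "\<And>i v. \<chi>' i v = clin (G *v u i) v / (G *v u i) $ e0"
proof -
  have lin: "Vector_Spaces.linear (*s) (*s) (mult C v)" for v
    by unfold_locales (simp_all add: mult_def cvec_add cvec_smult vec.add vec.scale)
  show ?thesis
  proof (rule semisimple_lines[OF lin comm assoc ss])
    fix u :: "'i \<Rightarrow> complex^'i" and \<chi>'
    assume chi: "\<And>v i. mult C v (u i) = \<chi>' i v *s u i"
      and ind: "\<And>c. (\<Sum>i\<in>UNIV. c i *s u i) = 0 \<Longrightarrow> \<forall>i. c i = 0"
    note fr = ideal_frame[of C u \<chi>', OF sym unit chi ind]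
    have ev: "(M ** S) *v (G *v u i) = \<chi>' i E *s (G *v u i)" for i
    proof -
      have "(M ** S) *v (G *v u i) = G *v ((S ** M) *v u i)"
        by (simp add: matrix_vector_mul_assoc[symmetric])
      also have "\<dots> = G *v (\<chi>' i E *s u i)" by (simp only: E[symmetric] chi)
      finally show ?thesis by (simp add: vec.scale)
    qed
    show ?thesis by (rule that[OF chi ev fr(1) fr(2) fr(3) fr(4)])
  qed
qed

text \<open>Iterating the operator amounts to multiplying by a power of the Euler field, so a
  relation among these powers applied to the unit transfers to every vector w.\<close>

lemma kry_mult:
  assumes unit: "\<And>v. mult C (axis e0 1) v = v"
    and assoc: "\<And>v w x. mult C (mult C v w) x = mult C v (mult C w x)"
    and E: "\<And>v. mult C E v = (S ** M) *v v"
  shows "kry (S ** M) w k = mult C (kry (S ** M) (axis e0 1) k) w"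
  by (induction k) (simp_all add: unit E[symmetric] assoc)

text \<open>Converse of \<open>det_krylov_nonzero\<close>: for equal eigenvalues the functionals of
  \<open>z i\<close> and \<open>z j\<close>, each divided by its value on the unit, agree on all
  Krylov vectors, so their difference lies in the kernel of the transposed Krylov matrix.\<close>

lemma det_krylov_simple:
  fixes z :: "'i \<Rightarrow> complex^'i"
  assumes symM: "transpose M = M" and ev: "\<And>i. (M ** S) *v z i = a i *s z i"
    and orth: "\<And>i j. clin (z i) (S *v z j) = (if i = j then \<eta> i else 0)" and nz: "\<And>i. \<eta> i \<noteq> 0"
    and z0: "\<And>i. z i $ e0 \<noteq> 0"
    and det: "det (krylov (S ** M) (axis e0 1) \<iota>) \<noteq> 0"
  shows "inj a"
proof (rule injI, rule ccontr)
  fix i j assume ij: "a i = a j" "i \<noteq> j"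
  let ?B = "krylov (S ** M) (axis e0 1) \<iota>"
  define x where "x = (1 / z i $ e0) *s z i - (1 / z j $ e0) *s z j"
  have "(transpose ?B *v x) $ k = 0" for k
  proof -
    have "(transpose ?B *v x) $ k = clin (transpose ?B *v x) (axis k 1)" by simp
    also have "\<dots> = clin x (?B *v axis k 1)" by (rule clin_matrix[symmetric])
    also have "?B *v axis k 1 = kry (S ** M) (axis e0 1) (\<iota> k)"
      by (simp add: vec_eq_iff matrix_vector_mult_def krylov_def axis_def mult_delta_right)
    also have "clin x \<dots> = 0"
      unfolding x_def clin.diff_left clin_smult_left clin_kry[of M z a, OF symM ev]
      using z0 ij by simp
    finally show ?thesis .
  qed
  then have "transpose ?B *v x = 0" by (simp add: vec_eq_iff)
  moreover have "det (transpose ?B) \<noteq> 0" using det by (simp only: det_transpose not_False_eq_True)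
  ultimately have "x = 0" using det_nonzero_iff by blast
  then have "clin x (S *v z i) = 0" by (simp add: clin.zero_left)
  moreover have "clin x (S *v z i) = \<eta> i / z i $ e0"
    unfolding x_def clin.diff_left clin_smult_left orth using ij by simp
  ultimately show False using nz z0 by simp
qed

text \<open>Between a left and a right eigenvector of the same eigenvalue, each of the k terms of
  the product rule contributes a^(k-1) d. For k = 0 the truncated exponent is harmless, as the
  factor k is 0.\<close>

lemma clin_dkry:
  assumes symM: "transpose M = M" and ev: "(M ** S) *v z = a *s z" and u: "u = S *v z"
    and d: "clin z (L' *v u) = d"
  shows "clin z (dkry (S ** M) L' u k) = of_nat k * a ^ (k - 1) * d" "kry (S ** M) u k = a ^ k *s u"
proof -
  have uL: "(S ** M) *v u = a *s u"
    using arg_cong[OF ev, of "(*v) S"] by (simp add: u vec.scale matrix_vector_mul_assoc[symmetric])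
  show kr: "kry (S ** M) u k = a ^ k *s u" for k
    by (induction k) (simp_all add: vec.scale uL mult.commute)
  have zL: "clin z ((S ** M) *v w) = a * clin z w" for w
  proof -
    have "transpose (S ** M) = M ** S" by (simp add: matrix_transpose_mul symM symS)
    then show ?thesis by (simp add: clin_matrix ev clin_smult_left)
  qed
  show "clin z (dkry (S ** M) L' u k) = of_nat k * a ^ (k - 1) * d"
  proof (induction k)
    case (Suc k)
    have "clin z (dkry (S ** M) L' u (Suc k)) = a ^ k * d + a * (of_nat k * a ^ (k - 1) * d)"
      by (simp add: clin.add_right zL Suc kr vec.scale clin_smult d)
    also have "\<dots> = of_nat (Suc k) * a ^ (Suc k - 1) * d"
      by (cases k) (simp_all add: algebra_simps)
    finally show ?case .
  qed (simp add: clin.zero_right)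
qed

text \<open>The left hand side is \<open>q'(a i)\<close> for the minimal polynomial \<open>q\<close> of the Euler field; \<open>q\<close> has no
  multiple roots as the powers of the Euler field below \<open>m\<close> are linearly independent.\<close>

lemma minimal_polynomial_simple:
  fixes z :: "'i \<Rightarrow> complex^'i"
  assumes symM: "transpose M = M" and ev: "\<And>i. (M ** S) *v z i = a i *s z i"
    and orth: "\<And>i j. clin (z i) (S *v z j) = (if i = j then \<eta> i else 0)" and nz: "\<And>i. \<eta> i \<noteq> 0"
    and z0: "\<And>i. z i $ e0 \<noteq> 0"
    and \<iota>: "bij_betw \<iota> K {..<m}" and det: "det (part_krylov (S ** M) (axis e0 1) K \<iota> W) \<noteq> 0"
    and rel: "kry (S ** M) (axis e0 1) m = (\<Sum>k\<in>K. c k *s kry (S ** M) (axis e0 1) (\<iota> k))"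
  shows "of_nat m * a i ^ (m - 1) - (\<Sum>k\<in>K. c k * (of_nat (\<iota> k) * a i ^ (\<iota> k - 1))) \<noteq> 0"
proof
  assume 0: "of_nat m * a i ^ (m - 1) - (\<Sum>k\<in>K. c k * (of_nat (\<iota> k) * a i ^ (\<iota> k - 1))) = 0"
  note ck = clin_kry[of M z a, OF symM ev]
  define q where "q = monom 1 m - (\<Sum>k\<in>K. monom (c k) (\<iota> k))"
  have lt: "\<iota> k < m" if "k \<in> K" for k using \<iota> that by (auto simp: bij_betw_def)
  have root: "poly q (a j) = 0" for j
  proof -
    have "a j ^ m * z j $ e0 = (\<Sum>k\<in>K. c k * a j ^ \<iota> k) * z j $ e0"
      using arg_cong[OF rel, of "clin (z j)"]
      by (simp add: ck clin.sum_right clin_smult sum_distrib_right mult.assoc)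
    then show ?thesis using z0[of j] by (simp add: q_def poly_monom poly_sum)
  qed
  have "coeff q m = 1"
    unfolding q_def coeff_diff coeff_sum using lt by (simp add: less_imp_neq)
  then have qn: "q \<noteq> 0" by auto
  have degq: "degree q \<le> m"
    unfolding q_def
    by (intro degree_diff_le degree_sum_le) (auto intro: finite order.trans[OF degree_monom_le] less_imp_le lt simp: degree_monom_le)
  have "poly (pderiv q) (a i) = of_nat m * a i ^ (m - 1) - (\<Sum>k\<in>K. c k * (of_nat (\<iota> k) * a i ^ (\<iota> k - 1)))"
    by (simp add: q_def pderiv_diff pderiv_sum' pderiv_monom poly_monom poly_sum mult_ac)
  with 0 have dq: "poly (pderiv q) (a i) = 0" by simp
  obtain q1 where q1: "q = [:- a i, 1:] * q1" using root[of i] by (auto simp: poly_eq_0_iff_dvd)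
  \<comment> \<open>At a double root \<open>a i\<close> the quotient \<open>q1\<close> would still
    vanish at all eigenvalues, and its coefficients would give a nontrivial relation among the
    powers below m.\<close>
  have "poly q1 (a i) = 0" using dq unfolding q1 pderiv_mult by (simp add: pderiv_pCons)
  then have root1: "poly q1 (a j) = 0" for j
    using root[of j] unfolding q1 by (cases "a j = a i") auto
  have q1n: "q1 \<noteq> 0" using qn q1 by auto
  have "degree q = Suc (degree q1)" unfolding q1 using q1n by (subst degree_mult_eq) auto
  with degq have dq1: "degree q1 < m" by simp
  let ?c = "\<chi> k. if k \<in> K then coeff q1 (\<iota> k) else 0"
  have "clin (z j) (part_krylov (S ** M) (axis e0 1) K \<iota> W *v ?c) = 0" for j
  proof -
    have "clin (z j) (part_krylov (S ** M) (axis e0 1) K \<iota> W *v ?c)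
        = (\<Sum>k\<in>K. coeff q1 (\<iota> k) * a j ^ \<iota> k) * z j $ e0"
      by (subst part_krylov_mult) (simp_all add: clin.sum_right clin_smult ck sum_distrib_right mult.assoc)
    also have "(\<Sum>k\<in>K. coeff q1 (\<iota> k) * a j ^ \<iota> k) = (\<Sum>l<m. coeff q1 l * a j ^ l)"
      by (rule sum.reindex_bij_betw[OF \<iota>])
    also have "\<dots> = (\<Sum>l\<le>degree q1. coeff q1 l * a j ^ l)"
      by (rule sum.mono_neutral_right) (use dq1 in \<open>auto simp: coeff_eq_0 not_le\<close>)
    also have "\<dots> = 0" using root1[of j] by (simp add: poly_altdef)
    finally show ?thesis by simp
  qed
  then have "part_krylov (S ** M) (axis e0 1) K \<iota> W *v ?c = 0"
    using frame_expand[of z \<eta> "part_krylov (S ** M) (axis e0 1) K \<iota> W *v ?c", OF orth nz] by simp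
  then have c0: "?c = 0" using det det_nonzero_iff by blast
  have "coeff q1 l = 0" for l
  proof (cases "l < m")
    case True
    then obtain k where "k \<in> K" "l = \<iota> k" using \<iota> by (auto simp: bij_betw_def)
    then show ?thesis using arg_cong[OF c0, of "\<lambda>v. v $ k"] by simp
  qed (use dq1 in \<open>simp add: coeff_eq_0\<close>)
  then show False using q1n by (simp add: poly_eq_iff)
qed

end

context fano_manifold
begin

text \<open>For \<open>M\<close> differentiated along \<open>v\<close> the degrees drop out of the diagonal entries: by the degree
  condition on the intersection form they contribute \<open>n\<close>, which cancels the term \<open>- n\<close> of the factor.\<close>

lemma derivative_diagonal:
  assumes sym: "\<And>\<alpha> \<beta> \<gamma>. C \<alpha> \<beta> \<gamma> = C \<beta> \<alpha> \<gamma>" "\<And>\<alpha> \<beta> \<gamma>. C \<alpha> \<beta> \<gamma> = C \<alpha> \<gamma> \<beta>"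
    and chi: "mult C v u = t *s u"
    and M': "\<And>\<alpha> \<beta>. M' $ \<alpha> $ \<beta> = (\<Sum>\<delta>\<in>UNIV. wt D \<alpha> \<beta> * C \<alpha> \<beta> \<delta> * v $ \<delta>)"
  shows "clin (Gmat D *v u) ((Smat D ** M') *v u) = t * clin (Gmat D *v u) u"
proof -
  let ?z = "Gmat D *v u" and ?p = "\<lambda>\<alpha>. of_nat (deg D \<alpha>) :: complex" and ?n = "of_nat (dimV D) :: complex"
  have K: "(\<Sum>\<beta>\<in>UNIV. \<Sum>\<delta>\<in>UNIV. C \<alpha> \<beta> \<delta> * v $ \<delta> * u $ \<beta>) = t * ?z $ \<alpha>" for \<alpha>
  proof -
    have "(\<Sum>\<beta>\<in>UNIV. \<Sum>\<delta>\<in>UNIV. C \<alpha> \<beta> \<delta> * v $ \<delta> * u $ \<beta>) = (\<Sum>\<delta>\<in>UNIV. \<Sum>\<beta>\<in>UNIV. C \<alpha> \<beta> \<delta> * v $ \<delta> * u $ \<beta>)"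
      by (rule sum.swap)
    also have "\<dots> = cvec C v u $ \<alpha>"
      unfolding cvec_def vec_lambda_beta
    proof (intro sum.cong refl)
      fix \<beta> \<delta>
      have "C \<alpha> \<beta> \<delta> = C \<delta> \<beta> \<alpha>" using sym by metis
      then show "C \<alpha> \<beta> \<delta> * v $ \<delta> * u $ \<beta> = v $ \<delta> * u $ \<beta> * C \<delta> \<beta> \<alpha>" by simp
    qed
    also have "cvec C v u = Gmat D *v mult C v u" by simp
    finally show ?thesis by (simp add: chi vec.scale)
  qed
  define s where "s = (\<Sum>\<alpha>\<in>UNIV. ?p \<alpha> * u $ \<alpha> * ?z $ \<alpha>)"
  have u: "u $ \<alpha> = (\<Sum>\<beta>\<in>UNIV. Smat D $ \<alpha> $ \<beta> * ?z $ \<beta>)" for \<alpha>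
  proof -
    have "u $ \<alpha> = (Smat D *v ?z) $ \<alpha>" by simp
    then show ?thesis by (simp only: matrix_vector_mult_def vec_lambda_beta)
  qed
  have symS': "Smat D $ \<alpha> $ \<beta> = Smat D $ \<beta> $ \<alpha>" for \<alpha> \<beta>
    using arg_cong[OF symS, of "\<lambda>A. A $ \<beta> $ \<alpha>"] by (simp add: transpose_def)
  \<comment> \<open>Exchanging the two summation indices replaces p by n - p, by
    \<open>Smat_degree\<close>; adding both forms of the sum leaves n times the square length of
    u.\<close>
  have s2: "2 * s = ?n * clin ?z u"
  proof -
    have 1: "s = (\<Sum>\<alpha>\<in>UNIV. \<Sum>\<beta>\<in>UNIV. ?p \<alpha> * Smat D $ \<alpha> $ \<beta> * ?z $ \<beta> * ?z $ \<alpha>)"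
      unfolding s_def by (intro sum.cong refl, subst u) (simp only: sum_distrib_left sum_distrib_right mult.assoc)
    also have "\<dots> = (\<Sum>\<beta>\<in>UNIV. \<Sum>\<alpha>\<in>UNIV. ?p \<alpha> * Smat D $ \<alpha> $ \<beta> * ?z $ \<beta> * ?z $ \<alpha>)" by (rule sum.swap)
    also have "\<dots> = (\<Sum>\<beta>\<in>UNIV. \<Sum>\<alpha>\<in>UNIV. (?n - ?p \<beta>) * Smat D $ \<beta> $ \<alpha> * ?z $ \<alpha> * ?z $ \<beta>)"
    proof (intro sum.cong refl)
      fix \<alpha> \<beta>
      have "?p \<alpha> * Smat D $ \<alpha> $ \<beta> = (?n - ?p \<beta>) * Smat D $ \<beta> $ \<alpha>"
        using Smat_degree[of \<beta> \<alpha>] by (simp add: symS'[of \<alpha> \<beta>] mult.commute)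
      then show "?p \<alpha> * Smat D $ \<alpha> $ \<beta> * ?z $ \<beta> * ?z $ \<alpha> = (?n - ?p \<beta>) * Smat D $ \<beta> $ \<alpha> * ?z $ \<alpha> * ?z $ \<beta>" by simp
    qed
    finally have "s + s = (\<Sum>\<alpha>\<in>UNIV. \<Sum>\<beta>\<in>UNIV. ?n * (Smat D $ \<alpha> $ \<beta> * ?z $ \<beta> * ?z $ \<alpha>))"
      by (subst (2) 1) (simp add: sum.distrib[symmetric] algebra_simps)
    also have "\<dots> = ?n * clin ?z u"
    proof -
      have "clin ?z u = (\<Sum>\<alpha>\<in>UNIV. \<Sum>\<beta>\<in>UNIV. Smat D $ \<alpha> $ \<beta> * ?z $ \<beta> * ?z $ \<alpha>)"
        unfolding clin_def by (intro sum.cong refl, subst u) (simp only: sum_distrib_left mult_ac)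
      then show ?thesis by (simp only: sum_distrib_left)
    qed
    finally show ?thesis by simp
  qed
  have "clin ?z ((Smat D ** M') *v u) = clin u (M' *v u)"
    by (simp add: matrix_vector_mul_assoc[symmetric] clin_S)
  also have "\<dots> = (\<Sum>\<alpha>\<in>UNIV. \<Sum>\<beta>\<in>UNIV. \<Sum>\<delta>\<in>UNIV. (1 - ?n + ?p \<alpha> + ?p \<beta>) * (u $ \<alpha> * (C \<alpha> \<beta> \<delta> * v $ \<delta> * u $ \<beta>)))"
    by (simp add: clin_def matrix_vector_mult_def M' sum_distrib_left sum_distrib_right mult_ac)
  also have "\<dots> = (\<Sum>\<alpha>\<in>UNIV. \<Sum>\<beta>\<in>UNIV. \<Sum>\<delta>\<in>UNIV. (1 - ?n) * (u $ \<alpha> * (C \<alpha> \<beta> \<delta> * v $ \<delta> * u $ \<beta>)))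
      + (\<Sum>\<alpha>\<in>UNIV. \<Sum>\<beta>\<in>UNIV. \<Sum>\<delta>\<in>UNIV. ?p \<alpha> * (u $ \<alpha> * (C \<alpha> \<beta> \<delta> * v $ \<delta> * u $ \<beta>)))
      + (\<Sum>\<alpha>\<in>UNIV. \<Sum>\<beta>\<in>UNIV. \<Sum>\<delta>\<in>UNIV. ?p \<beta> * (u $ \<alpha> * (C \<alpha> \<beta> \<delta> * v $ \<delta> * u $ \<beta>)))"
    by (simp only: sum.distrib[symmetric] distrib_right)
  also have "(\<Sum>\<alpha>\<in>UNIV. \<Sum>\<beta>\<in>UNIV. \<Sum>\<delta>\<in>UNIV. (1 - ?n) * (u $ \<alpha> * (C \<alpha> \<beta> \<delta> * v $ \<delta> * u $ \<beta>))) = (1 - ?n) * t * clin ?z u"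
    by (simp only: sum_distrib_left[symmetric] K) (simp add: clin_def sum_distrib_left mult_ac)
  also have "(\<Sum>\<alpha>\<in>UNIV. \<Sum>\<beta>\<in>UNIV. \<Sum>\<delta>\<in>UNIV. ?p \<alpha> * (u $ \<alpha> * (C \<alpha> \<beta> \<delta> * v $ \<delta> * u $ \<beta>))) = t * s"
    by (simp only: sum_distrib_left[symmetric] K) (simp add: s_def sum_distrib_left mult_ac)
  also have "(\<Sum>\<alpha>\<in>UNIV. \<Sum>\<beta>\<in>UNIV. \<Sum>\<delta>\<in>UNIV. ?p \<beta> * (u $ \<alpha> * (C \<alpha> \<beta> \<delta> * v $ \<delta> * u $ \<beta>))) = t * s"
  proof -
    have "(\<Sum>\<alpha>\<in>UNIV. \<Sum>\<beta>\<in>UNIV. \<Sum>\<delta>\<in>UNIV. ?p \<beta> * (u $ \<alpha> * (C \<alpha> \<beta> \<delta> * v $ \<delta> * u $ \<beta>)))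
      = (\<Sum>\<beta>\<in>UNIV. \<Sum>\<alpha>\<in>UNIV. \<Sum>\<delta>\<in>UNIV. ?p \<beta> * (u $ \<alpha> * (C \<alpha> \<beta> \<delta> * v $ \<delta> * u $ \<beta>)))" by (rule sum.swap)
    also have "\<dots> = (\<Sum>\<beta>\<in>UNIV. \<Sum>\<alpha>\<in>UNIV. \<Sum>\<delta>\<in>UNIV. ?p \<beta> * (u $ \<beta> * (C \<beta> \<alpha> \<delta> * v $ \<delta> * u $ \<alpha>)))"
    proof (intro sum.cong refl)
      fix \<alpha> \<beta> \<delta>
      have "C \<alpha> \<beta> \<delta> = C \<beta> \<alpha> \<delta>" by (rule sym(1))
      then show "?p \<beta> * (u $ \<alpha> * (C \<alpha> \<beta> \<delta> * v $ \<delta> * u $ \<beta>)) = ?p \<beta> * (u $ \<beta> * (C \<beta> \<alpha> \<delta> * v $ \<delta> * u $ \<alpha>))"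
        by simp
    qed
    also have "\<dots> = t * s" by (simp only: sum_distrib_left[symmetric] K) (simp add: s_def sum_distrib_left mult_ac)
    finally show ?thesis .
  qed
  also have "(1 - ?n) * t * clin ?z u + t * s + t * s = t * clin ?z u"
  proof -
    have "t * s + t * s = t * (2 * s)" by simp
    then show ?thesis unfolding s2 by (simp add: algebra_simps)
  qed
  finally show ?thesis .
qed

text \<open>The set is the nonvanishing locus of a Krylov determinant, hence open. If it missed an
  open V, the powers of the Euler field would satisfy on V a relation of degree m < N with
  coefficients differentiable near some point; differentiating that relation separates any two equal
  eigenvalues at the point.\<close>

lemma simple_eigenvalues_dense:
  assumes adm: "admissible D U f" and ss: "semisimple_associative D U (potential D f)"
  shows "open {x\<in>U. R_dom D (Ymat D x (hess f x))}" (is "open ?U'")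
    and "U \<subseteq> closure {x\<in>U. R_dom D (Ymat D x (hess f x))}"
proof -
  have U: "open U" using adm by (simp add: admissible_def)
  let ?W = "drop0 ` U"
  have W: "open ?W" by (rule open_drop0_image[OF U])
  obtain \<phi> where \<phi>: "holo_on \<phi> ?W" and he: "\<And>x. x \<in> U \<Longrightarrow> hess f x = hessian \<phi> (drop0 x)"
    and third: "\<And>x \<alpha> \<beta> \<gamma>. x \<in> U \<Longrightarrow> pd3 (potential D f) x \<alpha> \<beta> \<gamma> = g3 D \<alpha> \<beta> \<gamma> + d3 \<phi> (drop0 x) \<alpha> \<beta> \<gamma>"
    and E: "\<And>x \<alpha> \<beta>. x \<in> U \<Longrightarrow> (\<Sum>\<gamma>\<in>UNIV. euler_coeff D x \<gamma> * d3 \<phi> (drop0 x) \<alpha> \<beta> \<gamma>)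
        = wt D \<alpha> \<beta> * hess_ext (hess f x) \<alpha> \<beta>"
    by (rule admissible_Hessian[OF adm]) (rule that)
  define C where "C x \<alpha> \<beta> \<gamma> = g3 D \<alpha> \<beta> \<gamma> + d3 \<phi> (drop0 x) \<alpha> \<beta> \<gamma>" for x \<alpha> \<beta> \<gamma>
  define M where "M x = Mmat D (Ymat D x (hess f x))" for x
  let ?E = "\<lambda>x. \<chi> \<gamma>. euler_coeff D x \<gamma>" and ?e = "axis None 1 :: complex^('a option)"
  let ?S = "Smat D" and ?G = "Gmat D" and ?N = "CARD('a option)"
  define L where "L x = ?S ** M x" for x
  have inW: "drop0 x \<in> ?W" if "x \<in> U" for x using that by blast
  have sym: "C x \<alpha> \<beta> \<gamma> = C x \<beta> \<alpha> \<gamma>" "C x \<alpha> \<beta> \<gamma> = C x \<alpha> \<gamma> \<beta>" if "x \<in> U" for x \<alpha> \<beta> \<gamma>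
    unfolding C_def by (rule third_symmetric(1)[OF W \<phi> inW[OF that]], rule third_symmetric(2)[OF W \<phi> inW[OF that]])
  have alg: "algebra_at (C x)" if "x \<in> U" for x
  proof -
    have "algebra_at (pd3 (potential D f) x)"
      using ss that unfolding semisimple_associative_iff by blast
    moreover have "(pd3 (potential D f) x) = C x"
      by (intro ext) (simp only: third[OF that] C_def)
    ultimately show ?thesis by simp
  qed
  have th: "transpose (hess f x) = hess f x" if "x \<in> U" for x
    unfolding he[OF that] by (rule transpose_hessian[OF W \<phi> inW[OF that]])
  have tM: "transpose (M x) = M x" if "x \<in> U" for x
    unfolding M_def by (rule transpose_Mmat[OF th[OF that]])
  have ME: "M x $ \<alpha> $ \<beta> = (\<Sum>\<gamma>\<in>UNIV. ?E x $ \<gamma> * C x \<alpha> \<beta> \<gamma>)" if "x \<in> U" for x \<alpha> \<beta>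
    unfolding M_def C_def by (rule Mmat_third[OF E[OF that]])
  have comm: "mult (C x) v w = mult (C x) w v" and unit: "mult (C x) ?e v = v"
    and assoc: "mult (C x) (mult (C x) v w) v' = mult (C x) v (mult (C x) w v')" and simple: "semisimple_alg (mult (C x))"
    if "x \<in> U" for x v w v'
    using alg[OF that] unfolding algebra_at_def by blast+
  have mE: "mult (C x) (?E x) v = (?S ** M x) *v v" if "x \<in> U" for x v
    by (rule mult_Euler[OF sym[OF that] ME[OF that]])
  have frame: thesis if x: "x \<in> U" and *: "\<And>(u :: 'a option \<Rightarrow> complex^('a option)) \<chi>' \<eta>. \<lbrakk>\<And>v i. mult (C x) v (u i) = \<chi>' i v *s u i;
      \<And>i. (M x ** ?S) *v (?G *v u i) = \<chi>' i (?E x) *s (?G *v u i);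
      \<And>i j. clin (?G *v u i) (u j) = (if i = j then \<eta> i else 0); \<And>i. \<eta> i \<noteq> 0;
      \<And>i. (?G *v u i) $ None \<noteq> 0; \<And>i v. \<chi>' i v = clin (?G *v u i) v / (?G *v u i) $ None\<rbrakk> \<Longrightarrow> thesis" for x thesis
  proof (rule semisimple_frame[OF sym[OF x] comm[OF x] unit[OF x] assoc[OF x] simple[OF x] mE[OF x]])
    fix u :: "'a option \<Rightarrow> complex^('a option)" and \<chi>' \<eta>
    assume fr: "\<And>v i. mult (C x) v (u i) = \<chi>' i v *s u i"
      "\<And>i. (M x ** ?S) *v (?G *v u i) = \<chi>' i (?E x) *s (?G *v u i)"
      "\<And>i j. clin (?G *v u i) (u j) = (if i = j then \<eta> i else 0)" "\<And>i. \<eta> i \<noteq> 0"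
      "\<And>i. (?G *v u i) $ None \<noteq> 0" "\<And>i v. \<chi>' i v = clin (?G *v u i) v / (?G *v u i) $ None"
    show thesis by (rule *[of u \<chi>' \<eta>, OF fr])
  qed
  have R_if_inj: "R_dom D (Ymat D x (hess f x))"
    if x: "x \<in> U" and ev: "\<And>i. (M x ** ?S) *v z i = a i *s z i" and nz: "\<And>i. z i \<noteq> 0" and inj: "inj a"
    for x and z :: "'a option \<Rightarrow> complex^('a option)" and a
  proof -
    have es: "eigen_system D (Ymat D x (hess f x)) a z"
      using ev nz inj by (simp add: eigen_system_iff M_def[symmetric])
    have "R_denom D (z i) \<noteq> 0" for i
      by (rule algebra_eigen(1)[OF sym[OF x] ME[OF x, unfolded M_def] alg[OF x] es])
    with es show ?thesis unfolding R_dom_def by blast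
  qed
  have R_if_det: "R_dom D (Ymat D x (hess f x))" if x: "x \<in> U" and d: "det (krylov (L x) ?e \<iota>) \<noteq> 0" for x \<iota>
  proof (rule frame[OF x])
    fix u :: "'a option \<Rightarrow> complex^('a option)" and \<chi>' \<eta>
    assume fr: "\<And>v i. mult (C x) v (u i) = \<chi>' i v *s u i"
      "\<And>i. (M x ** ?S) *v (?G *v u i) = \<chi>' i (?E x) *s (?G *v u i)"
      "\<And>i j. clin (?G *v u i) (u j) = (if i = j then \<eta> i else 0)" "\<And>i. \<eta> i \<noteq> 0"
      "\<And>i. (?G *v u i) $ None \<noteq> 0" "\<And>i v. \<chi>' i v = clin (?G *v u i) v / (?G *v u i) $ None"
    have "inj (\<lambda>i. \<chi>' i (?E x))"
      by (rule det_krylov_simple[of "M x" "\<lambda>i. ?G *v u i" _ \<eta> \<iota>, OF tM[OF x] fr(2) _ fr(4) fr(5) d[unfolded L_def]])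
         (simp only: S_G fr(3))
    moreover have "?G *v u i \<noteq> 0" for i using fr(5)[of i] by auto
    ultimately show ?thesis
      using R_if_inj[of x "\<lambda>i. ?G *v u i" "\<lambda>i. \<chi>' i (?E x)", OF x fr(2)] by blast
  qed
  obtain \<iota>0 :: "'a option \<Rightarrow> nat" where \<iota>0: "bij_betw \<iota>0 UNIV {..<?N}" by (rule bij_index)
  have det_if_R: "det (krylov (L x) ?e \<iota>0) \<noteq> 0" if x: "x \<in> U" and R: "R_dom D (Ymat D x (hess f x))" for x
  proof -
    obtain a z where z: "eigen_system D (Ymat D x (hess f x)) a z" "\<And>i. R_denom D (z i) \<noteq> 0"
      using R unfolding R_dom_def by blast
    have ev: "(M x ** ?S) *v z i = a i *s z i" "inj a" for i
      using z(1) by (simp_all add: eigen_system_iff M_def)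
    show ?thesis unfolding L_def
      by (rule det_krylov_nonzero[of "M x" z a, OF tM[OF x] ev(1) ev(2) eigen_frame(3)[OF th[OF x] z] \<iota>0])
  qed
  have dM: "((\<lambda>x. M x $ \<alpha> $ \<beta>) has_derivative
      clin (\<chi> \<delta>. wt D \<alpha> \<beta> * C x \<alpha> \<beta> \<delta>)) (at x)" if x: "x \<in> U" for x \<alpha> \<beta>
  proof -
    let ?k = "wt D \<alpha> \<beta>"
    have h: "((\<lambda>x. hess_ext (hess f x) \<alpha> \<beta>) has_derivative clin (\<chi> \<delta>. d3 \<phi> (drop0 x) \<alpha> \<beta> \<delta>)) (at x)"
    proof (cases "\<exists>a b. \<alpha> = Some a \<and> \<beta> = Some b")
      case True
      then obtain a b where ab: "\<alpha> = Some a" "\<beta> = Some b" by blast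
      have "((\<lambda>x. pd a (pd b \<phi>) (drop0 x)) has_derivative clin (insert0 (\<chi> c. pd c (pd a (pd b \<phi>)) (drop0 x)))) (at x)"
        by (rule cd_drop0[OF holo_on_has_derivative[OF holo_on_pd[OF W holo_on_pd[OF W \<phi>]] inW[OF x]]])
      moreover have "insert0 (\<chi> c. pd c (pd a (pd b \<phi>)) (drop0 x)) = (\<chi> \<delta>. d3 \<phi> (drop0 x) \<alpha> \<beta> \<delta>)"
      proof -
        have "insert0 (\<chi> c. pd c (pd a (pd b \<phi>)) (drop0 x)) $ \<delta> = d3 \<phi> (drop0 x) \<delta> \<alpha> \<beta>" for \<delta>
          by (cases \<delta>) (simp_all add: ab)
        moreover have "d3 \<phi> (drop0 x) \<delta> \<alpha> \<beta> = d3 \<phi> (drop0 x) \<alpha> \<beta> \<delta>" for \<delta>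
          using d3_symmetric[OF W \<phi> inW[OF x]] by metis
        ultimately show ?thesis by (simp add: vec_eq_iff)
      qed
      ultimately have "((\<lambda>x. pd a (pd b \<phi>) (drop0 x)) has_derivative clin (\<chi> \<delta>. d3 \<phi> (drop0 x) \<alpha> \<beta> \<delta>)) (at x)" by simp
      then show ?thesis
        by (rule has_derivative_transform_within_open[OF _ U x]) (simp add: ab he hessian_def)
    next
      case False
      then have "(\<lambda>x. hess_ext (hess f x) \<alpha> \<beta>) = (\<lambda>x. 0)" "(\<chi> \<delta>. d3 \<phi> (drop0 x) \<alpha> \<beta> \<delta>) = 0"
        by (cases \<alpha>; cases \<beta>; simp add: vec_eq_iff)+
      then show ?thesis by (simp only: cd_const)
    qed
    have "((\<lambda>x. c2 D \<alpha> \<beta> + ?k * (hess_ext (hess f x) \<alpha> \<beta> + lin3 \<alpha> \<beta> x)) has_derivative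
        clin (0 + ?k *s ((\<chi> \<delta>. d3 \<phi> (drop0 x) \<alpha> \<beta> \<delta>) + (\<chi> \<delta>. g3 D \<alpha> \<beta> \<delta>)))) (at x)"
      by (rule cd_add[OF cd_const cd_cmult[OF cd_add[OF h cd_lin3]]])
    moreover have "0 + ?k *s ((\<chi> \<delta>. d3 \<phi> (drop0 x) \<alpha> \<beta> \<delta>) + (\<chi> \<delta>. g3 D \<alpha> \<beta> \<delta>)) = (\<chi> \<delta>. ?k * C x \<alpha> \<beta> \<delta>)"
      by (simp add: vec_eq_iff C_def algebra_simps)
    moreover have "(\<lambda>x. M x $ \<alpha> $ \<beta>) = (\<lambda>x. c2 D \<alpha> \<beta> + ?k * (hess_ext (hess f x) \<alpha> \<beta> + lin3 \<alpha> \<beta> x))"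
      by (simp add: fun_eq_iff M_def Mmat_def Ymat_nth lin3_def mult.commute)
    ultimately show ?thesis by simp
  qed
  have cM: "continuous_on U (\<lambda>x. M x $ \<alpha> $ \<beta>)" for \<alpha> \<beta>
    by (rule continuous_at_imp_continuous_on) (blast intro: has_derivative_continuous dM)
  have cL: "continuous_on U (\<lambda>x. L x $ \<alpha> $ \<beta>)" for \<alpha> \<beta>
    unfolding L_def matrix_matrix_mult_def vec_lambda_beta
    by (intro continuous_on_sum continuous_on_mult continuous_on_const cM)
  have cdet: "continuous_on U (\<lambda>x. det (krylov (L x) ?e \<iota>0))"
    by (rule continuous_on_det) (simp add: krylov_def continuous_on_kry cL)
  \<comment> \<open>For a semi-simple solution, membership in \<open>R_dom\<close> means
    independence of the powers of the Euler field.\<close>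
  have U': "?U' = U \<inter> (\<lambda>x. det (krylov (L x) ?e \<iota>0)) -` (- {0})"
    using R_if_det det_if_R by auto
  show "open ?U'"
    unfolding U' by (rule continuous_open_preimage[OF cdet U open_Compl[OF closed_singleton]])
  have dense: "\<exists>x\<in>V. R_dom D (Ymat D x (hess f x))" if V: "open V" "V \<subseteq> U" "V \<noteq> {}" for V
  proof (rule ccontr)
    assume no: "\<not> (\<exists>x\<in>V. R_dom D (Ymat D x (hess f x)))"
    \<comment> \<open>\<open>Q m\<close>: the powers of the Euler field below \<open>m\<close> are independent at some point of \<open>V\<close>\<close>
    define Q where "Q m \<longleftrightarrow> (\<exists>x\<in>V. \<exists>K \<iota> W. bij_betw \<iota> K {..<m} \<and> det (part_krylov (L x) ?e K \<iota> W) \<noteq> 0)" for m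
    have "Q 0"
    proof -
      obtain x where "x \<in> V" using V by blast
      moreover have "part_krylov (L x) ?e {} (\<lambda>_. 0) (mat 1) = mat 1" by (simp add: part_krylov_def mat_def vec_eq_iff)
      ultimately show ?thesis unfolding Q_def
        by (intro bexI[of _ x] exI[of _ "{}"] exI[of _ "\<lambda>_. 0"] exI[of _ "mat 1"]) (simp_all add: bij_betw_def)
    qed
    have "\<not> Q ?N"
    proof
      assume "Q ?N"
      then obtain x K \<iota> W where x: "x \<in> V" and b: "bij_betw \<iota> K {..<?N}" and d: "det (part_krylov (L x) ?e K \<iota> W) \<noteq> 0"
        unfolding Q_def by blast
      have "card K = ?N" using bij_betw_same_card[OF b] by simp
      then have "K = UNIV" by (intro card_eq_UNIV_imp_eq_UNIV) simp_all
      then have "part_krylov (L x) ?e K \<iota> W = krylov (L x) ?e \<iota>"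
        by (simp add: part_krylov_def krylov_def)
      with d R_if_det[of x \<iota>] x V no show False by auto
    qed
    \<comment> \<open>For such an m the first m powers are independent at some point of V, while the
      first m + 1 powers are dependent at every point of V.\<close>
    have "\<exists>m<?N. Q m \<and> \<not> Q (Suc m)"
    proof (rule ccontr)
      assume "\<not> (\<exists>m<?N. Q m \<and> \<not> Q (Suc m))"
      then have st: "Q m \<Longrightarrow> Q (Suc m)" if "m < ?N" for m using that by blast
      have "m \<le> ?N \<Longrightarrow> Q m" for m by (induction m) (use \<open>Q 0\<close> st in auto)
      with \<open>\<not> Q ?N\<close> show False by blast
    qed
    then obtain m where m: "m < ?N" "Q m" "\<not> Q (Suc m)" by blast
    then obtain x1 K \<iota> W where x1: "x1 \<in> V" and \<iota>: "bij_betw \<iota> K {..<m}" and d1: "det (part_krylov (L x1) ?e K \<iota> W) \<noteq> 0"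
      unfolding Q_def by blast
    define B where "B x = part_krylov (L x) ?e K \<iota> W" for x
    define Bk where "Bk x k = (\<chi> \<alpha> j. if j = k then kry (L x) ?e m $ \<alpha> else B x $ \<alpha> $ j)" for x k
    define c where "c x k = det (Bk x k) / det (B x)" for x k
    have x1U: "x1 \<in> U" using x1 V by blast
    \<comment> \<open>A nonzero value would make the power m a further independent column, which the
      choice of m forbids. Cramer's solution therefore involves only the Krylov columns and not
      those of the auxiliary \<open>W\<close>.\<close>
    have Bk0: "det (Bk x k) = 0" if x: "x \<in> V" and k: "k \<notin> K" for x k
    proof (rule ccontr)
      assume "det (Bk x k) \<noteq> 0"
      moreover have "Bk x k = part_krylov (L x) ?e (insert k K) (\<iota>(k := m)) W"
        using k by (auto simp: Bk_def B_def part_krylov_def vec_eq_iff)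
      moreover have "bij_betw (\<iota>(k := m)) (insert k K) {..<Suc m}"
      proof -
        have "bij_betw (\<iota>(k := m)) K {..<m}" using \<iota> k by (subst bij_betw_cong[of K "\<iota>(k := m)" \<iota>]) auto
        then have "bij_betw (\<iota>(k := m)) (K \<union> {k}) ({..<m} \<union> {(\<iota>(k := m)) k})"
          using k by (intro notIn_Un_bij_betw) auto
        then show ?thesis by (simp add: lessThan_Suc)
      qed
      ultimately have "Q (Suc m)" unfolding Q_def using x by metis
      with m(3) show False by blast
    qed
    have rel: "kry (L x) ?e m = (\<Sum>k\<in>K. c x k *s kry (L x) ?e (\<iota> k))" if x: "x \<in> V" and d: "det (B x) \<noteq> 0" for x
    proof -
      have "B x *v (\<chi> k. c x k) = kry (L x) ?e m"
        unfolding cramer[OF d] by (simp add: c_def[abs_def] Bk_def)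
      moreover have "B x *v (\<chi> k. c x k) = (\<Sum>k\<in>K. c x k *s kry (L x) ?e (\<iota> k))"
        unfolding B_def by (subst part_krylov_mult) (simp_all add: c_def Bk0[OF x])
      ultimately show ?thesis by simp
    qed
    \<comment> \<open>Passing from the unit to arbitrary w allows the relation to be applied to an
      eigenvector.\<close>
    have relw: "kry (L x) w m = (\<Sum>k\<in>K. c x k *s kry (L x) w (\<iota> k))" if x: "x \<in> V" and d: "det (B x) \<noteq> 0" for x w
    proof -
      have xU: "x \<in> U" using x V by blast
      have k: "kry (L x) w k = mult (C x) (kry (L x) ?e k) w" for k
        unfolding L_def by (rule kry_mult[OF unit[OF xU] assoc[OF xU] mE[OF xU]])
      show ?thesis unfolding k[of m] rel[OF x d] mult_sum mult_smult k[symmetric] ..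
    qed
    show False
    proof (rule frame[OF x1U])
      fix u :: "'a option \<Rightarrow> complex^('a option)" and \<chi>' \<eta>
      assume fr: "\<And>v i. mult (C x1) v (u i) = \<chi>' i v *s u i"
        "\<And>i. (M x1 ** ?S) *v (?G *v u i) = \<chi>' i (?E x1) *s (?G *v u i)"
        "\<And>i j. clin (?G *v u i) (u j) = (if i = j then \<eta> i else 0)" "\<And>i. \<eta> i \<noteq> 0"
        "\<And>i. (?G *v u i) $ None \<noteq> 0" "\<And>i v. \<chi>' i v = clin (?G *v u i) v / (?G *v u i) $ None"
      define a where "a i = \<chi>' i (?E x1)" for i
      have ev: "(M x1 ** ?S) *v (?G *v u i) = a i *s (?G *v u i)" for i unfolding a_def by (rule fr(2))
      have "\<not> inj a"
      proof
        assume inj: "inj a"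
        have "?G *v u i \<noteq> 0" for i using fr(5)[of i] by auto
        then have "R_dom D (Ymat D x1 (hess f x1))"
          using R_if_inj[of x1 "\<lambda>i. ?G *v u i" a, OF x1U ev _ inj] by blast
        with no x1 show False by blast
      qed
      then obtain i j where ij: "a i = a j" "i \<noteq> j" by (auto simp: inj_def)
      \<comment> \<open>This direction separates the two characters: \<open>\<chi>' i\<close> is
        nonzero on \<open>u i\<close>, and \<open>\<chi>' j\<close> vanishes there.\<close>
      define v where "v = u i"
      let ?x = "\<lambda>t. x1 + t *s v"
      define M' where "M' = (\<chi> \<alpha> \<beta>. clin (\<chi> \<delta>. wt D \<alpha> \<beta> * C x1 \<alpha> \<beta> \<delta>) v)"
      define L' where "L' = ?S ** M'"
      have Mt: "((\<lambda>t. M (?x t) $ \<alpha> $ \<beta>) has_field_derivative M' $ \<alpha> $ \<beta>) (at 0)" for \<alpha> \<beta>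
        unfolding M'_def vec_lambda_beta by (rule has_derivative_line) (use dM[OF x1U] in simp)
      have Lt: "((\<lambda>t. L (?x t) $ \<alpha> $ \<beta>) has_field_derivative L' $ \<alpha> $ \<beta>) (at 0)" for \<alpha> \<beta>
        unfolding L_def L'_def matrix_matrix_mult_def vec_lambda_beta
        by (intro DERIV_sum DERIV_cmult Mt)
      have kt: "((\<lambda>t. kry (L (?x t)) w k $ \<alpha>) has_field_derivative dkry (L x1) L' w k $ \<alpha>) (at 0)" for w k \<alpha>
        using kry_has_derivative[of "\<lambda>t. L (?x t)" L' 0 w k \<alpha>, OF Lt] by simp
      have kd: "(\<lambda>t. kry (L (?x t)) w k $ \<alpha>) field_differentiable (at 0)" for w k \<alpha>
        using kt field_differentiable_def by blast
      have Be: "(\<lambda>t. B (?x t) $ i $ j) field_differentiable (at 0)" for i j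
        by (cases "j \<in> K") (simp_all add: B_def part_krylov_def kd field_differentiable_const)
      have Bke: "(\<lambda>t. Bk (?x t) k $ i $ j) field_differentiable (at 0)" for i j k
        by (cases "j = k") (simp_all add: Bk_def kd Be)
      have Bd: "(\<lambda>t. det (B (?x t))) field_differentiable (at 0)"
        by (rule field_differentiable_det[OF Be])
      have Bkd: "(\<lambda>t. det (Bk (?x t) k)) field_differentiable (at 0)" for k
        by (rule field_differentiable_det[OF Bke])
      have d0: "det (B x1) \<noteq> 0" unfolding B_def by (rule d1)
      have "(\<lambda>t. c (?x t) k) field_differentiable (at 0)" for k
        unfolding c_def by (rule field_differentiable_divide[OF Bkd Bd]) (simp add: d0)
      then obtain c' where c': "\<And>k. ((\<lambda>t. c (?x t) k) has_field_derivative c' k) (at 0)"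
        unfolding field_differentiable_def by metis
      have near: "eventually (\<lambda>t. ?x t \<in> V \<and> det (B (?x t)) \<noteq> 0) (nhds 0)"
      proof (rule eventually_conj)
        have "open (?x -` V)"
          by (rule open_vimage[OF V(1)]) (intro continuous_on_add continuous_on_const continuous_on_vector_smult continuous_on_id)
        then show "eventually (\<lambda>t. ?x t \<in> V) (nhds 0)"
          unfolding eventually_nhds using x1 by (intro exI[of _ "?x -` V"]) auto
        have "isCont (\<lambda>t. det (B (?x t))) 0" by (rule field_differentiable_imp_continuous_at[OF Bd])
        then have "((\<lambda>t. det (B (?x t))) \<longlongrightarrow> det (B (?x 0))) (nhds 0)"
          unfolding isCont_def by (rule iffD1[OF tendsto_at_iff_tendsto_nhds])
        then show "eventually (\<lambda>t. det (B (?x t)) \<noteq> 0) (nhds 0)"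
          by (rule tendsto_imp_eventually_ne) (simp add: d0)
      qed
      define q' where "q' l = of_nat m * l ^ (m - 1) - (\<Sum>k\<in>K. c x1 k * (of_nat (\<iota> k) * l ^ (\<iota> k - 1)))" for l :: complex
      \<comment> \<open>The relation along the line is applied to the fixed vector
        \<open>u l\<close>, paired with the fixed covector \<open>?G *v u l\<close> and
        differentiated at 0. Only L and the coefficients c vary; the derivative of L contributes
        \<open>\<chi>' l v\<close> by \<open>derivative_diagonal\<close>.\<close>
      have main: "q' (a l) * \<chi>' l v = (\<Sum>k\<in>K. c' k * a l ^ \<iota> k)" for l
      proof -
        let ?z = "?G *v u l" and ?w = "u l"
        have wz: "?w = ?S *v ?z" by simp
        have dg: "clin ?z (L' *v ?w) = \<chi>' l v * \<eta> l"
          unfolding L'_def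
          using derivative_diagonal[of "C x1" v ?w "\<chi>' l v" M', OF sym[OF x1U] fr(1)] fr(3)[of l l]
          by (simp add: M'_def clin_def)
        note cd = clin_dkry[of "M x1" ?z "a l" ?w L', OF tM[OF x1U] ev wz dg, folded L_def]
        have clt: "((\<lambda>t. clin ?z (kry (L (?x t)) ?w k)) has_field_derivative clin ?z (dkry (L x1) L' ?w k)) (at 0)" for k
          unfolding clin_def by (intro DERIV_sum DERIV_cmult kt)
        have ck0: "clin ?z (kry (L x1) ?w k) = a l ^ k * \<eta> l" for k
          by (simp add: cd(2) clin_smult fr(3))
        have D1: "((\<lambda>t. \<Sum>k\<in>K. c (?x t) k * clin ?z (kry (L (?x t)) ?w (\<iota> k))) has_field_derivative
            (\<Sum>k\<in>K. c (?x 0) k * clin ?z (dkry (L x1) L' ?w (\<iota> k)) + c' k * clin ?z (kry (L (?x 0)) ?w (\<iota> k)))) (at 0)"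
          by (intro DERIV_sum DERIV_mult' c' clt)
        have evq: "eventually (\<lambda>t. clin ?z (kry (L (?x t)) ?w m) = (\<Sum>k\<in>K. c (?x t) k * clin ?z (kry (L (?x t)) ?w (\<iota> k)))) (nhds 0)"
          using near
        proof (rule eventually_mono)
          fix t assume t: "?x t \<in> V \<and> det (B (?x t)) \<noteq> 0"
          show "clin ?z (kry (L (?x t)) ?w m) = (\<Sum>k\<in>K. c (?x t) k * clin ?z (kry (L (?x t)) ?w (\<iota> k)))"
            by (subst relw) (use t in \<open>simp_all add: clin.sum_right clin_smult\<close>)
        qed
        from DERIV_unique[OF clt[of m] iffD2[OF DERIV_cong_ev[OF refl evq refl] D1]]
        have "of_nat m * a l ^ (m - 1) * (\<chi>' l v * \<eta> l)
            = (\<Sum>k\<in>K. c x1 k * (of_nat (\<iota> k) * a l ^ (\<iota> k - 1) * (\<chi>' l v * \<eta> l)) + c' k * (a l ^ \<iota> k * \<eta> l))"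
          by (simp add: cd(1) ck0)
        also have "\<dots> = ((\<Sum>k\<in>K. c x1 k * (of_nat (\<iota> k) * a l ^ (\<iota> k - 1))) * \<chi>' l v + (\<Sum>k\<in>K. c' k * a l ^ \<iota> k)) * \<eta> l"
          by (simp add: sum.distrib sum_distrib_right sum_distrib_left distrib_right distrib_left mult_ac)
        finally have "(of_nat m * a l ^ (m - 1) * \<chi>' l v) * \<eta> l
            = ((\<Sum>k\<in>K. c x1 k * (of_nat (\<iota> k) * a l ^ (\<iota> k - 1))) * \<chi>' l v + (\<Sum>k\<in>K. c' k * a l ^ \<iota> k)) * \<eta> l"
          by (simp only: mult.assoc)
        then have "of_nat m * a l ^ (m - 1) * \<chi>' l v
            = (\<Sum>k\<in>K. c x1 k * (of_nat (\<iota> k) * a l ^ (\<iota> k - 1))) * \<chi>' l v + (\<Sum>k\<in>K. c' k * a l ^ \<iota> k)"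
          using fr(4)[of l] by simp
        then show ?thesis by (simp add: q'_def left_diff_distrib)
      qed
      have "q' (a i) \<noteq> 0"
        unfolding q'_def
        by (rule minimal_polynomial_simple[of "M x1" "\<lambda>i. ?G *v u i" a \<eta> \<iota> K m W, OF tM[OF x1U] ev _ fr(4) fr(5) \<iota> d1[unfolded L_def]
              rel[OF x1 d0, unfolded L_def]]) (simp only: S_G fr(3))
      \<comment> \<open>The right side of \<open>main\<close> depends on the index only through the
        eigenvalue.\<close>
      moreover have "q' (a i) * \<chi>' i v = q' (a i) * \<chi>' j v" using main[of i] main[of j] ij(1) by simp
      ultimately have "\<chi>' i v = \<chi>' j v" by simp
      moreover have "\<chi>' i v \<noteq> 0" unfolding fr(6) v_def fr(3) using fr(4,5) by simp
      moreover have "\<chi>' j v = 0" unfolding fr(6) v_def fr(3) using ij(2) by simp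
      ultimately show False by simp
    qed
  qed
  show "U \<subseteq> closure ?U'"
  proof
    fix x assume x: "x \<in> U"
    show "x \<in> closure ?U'"
      unfolding closure_approachable
    proof (intro allI impI)
      fix \<epsilon> :: real assume "\<epsilon> > 0"
      with x have "x \<in> U \<inter> ball x \<epsilon>" by simp
      then have "\<exists>x'\<in>U \<inter> ball x \<epsilon>. R_dom D (Ymat D x' (hess f x'))"
        using dense[of "U \<inter> ball x \<epsilon>"] U by blast
      then obtain x' where "x' \<in> U \<inter> ball x \<epsilon>" "R_dom D (Ymat D x' (hess f x'))" ..
      then show "\<exists>x'\<in>?U'. dist x' x < \<epsilon>" by (auto simp: dist_commute)
    qed
  qed
qed

end

(* The six conjuncts:
   1. the functions r do not depend on x_0, are fully symmetric, and are rational;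
   2. for a given f, at the points where r is defined, the two problems are equivalent;
   3. these points are open and dense in the domain of a semi-simple solution;
   4. every solution y of the Pfaff problem comes locally from some f;
   5. such an f is unique up to the polynomials allowed in the first condition on f;
   6. the status of the constraint with the additional cubic term. *)
theorem theorem1:
  fixes D :: "('h::comm_ring_1, 'a::finite) fano_data"
  assumes "fano D"
  shows
    "((\<forall>x y a b c. transpose y = y \<longrightarrow>
        (R_dom D (Ymat D x y) \<longleftrightarrow> r_dom D (drop0 x) y) \<and>
        (R_dom D (Ymat D x y) \<longrightarrow> r_full D x y a b c = r D (drop0 x) y a b c))
      \<and> (\<forall>w y a b c. r D w y a b c = r D w y b a c \<and> r D w y a b c = r D w y a c b)
      \<and> (\<forall>a b c. \<exists>P Q. poly_fun P \<and> poly_fun Q \<and>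
           (\<forall>w y. r_dom D w y \<longrightarrow> Q w y \<noteq> 0 \<and> r D w y a b c = P w y / Q w y)))
     \<and>
     (\<forall>U f. admissible D U f \<and> (\<forall>x\<in>U. R_dom D (Ymat D x (hess f x))) \<longrightarrow>
        (semisimple_associative D U (potential D f) \<longleftrightarrow>
         (\<exists>y. pfaff_problem D (drop0 ` U) y \<and> (\<forall>x\<in>U. y (drop0 x) = hess f x))))
     \<and>
     (\<forall>U f. admissible D U f \<and> semisimple_associative D U (potential D f) \<longrightarrow>
        (let U' = {x\<in>U. R_dom D (Ymat D x (hess f x))} in open U' \<and> U \<subseteq> closure U'))
     \<and>
     (\<forall>W y. pfaff_problem D W y \<longrightarrow>
        (\<forall>w\<in>W. \<exists>W' f. open W' \<and> w \<in> W' \<and> W' \<subseteq> W \<and>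
           admissible D (drop0 -` W') f \<and>
           semisimple_associative D (drop0 -` W') (potential D f) \<and>
           (\<forall>x\<in>drop0 -` W'. y (drop0 x) = hess f x)))
     \<and>
     (\<forall>W f f'. connected W \<and> admissible D (drop0 -` W) f \<and> admissible D (drop0 -` W) f' \<and>
        (\<forall>x\<in>drop0 -` W. hess f x = hess f' x) \<longrightarrow>
        (\<exists>P. x0_quadratic P \<and> (\<forall>x\<in>drop0 -` W. f x = f' x + P x)))
     \<and>
     (\<forall>W y. pfaff_problem D W y \<and> W \<noteq> {} \<longrightarrow>
        ((\<forall>w\<in>W. constraint_with_cubic_term D w (y w)) \<longleftrightarrow>
         (\<forall>a b c. g3 D (Some a) (Some b) (Some c) = 0)))"
proof -
  interpret fano_manifold D by unfold_locales (rule assms)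
  show ?thesis
  proof (intro conjI allI impI)
    fix x and y :: "complex^'a^'a" and a b c assume "transpose y = y"
    then show "R_dom D (Ymat D x y) \<longleftrightarrow> r_dom D (drop0 x) y" using R_dom_shift[of x y] by (simp add: r_dom_def)
    show "r_full D x y a b c = r D (drop0 x) y a b c" by (rule r_full_eq)
  next
    fix w y a b c
    show "r D w y a b c = r D w y b a c" "r D w y a b c = r D w y a c b" by (rule r_symmetric)+
  next
    fix a b c
    show "\<exists>P Q. poly_fun P \<and> poly_fun Q \<and> (\<forall>w y. r_dom D w y \<longrightarrow> Q w y \<noteq> 0 \<and> r D w y a b c = P w y / Q w y)"
      by (rule r_rational)
  next
    fix U f assume "admissible D U f \<and> (\<forall>x\<in>U. R_dom D (Ymat D x (hess f x)))"
    then show "semisimple_associative D U (potential D f) \<longleftrightarrow>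
         (\<exists>y. pfaff_problem D (drop0 ` U) y \<and> (\<forall>x\<in>U. y (drop0 x) = hess f x))"
      using semisimple_iff_pfaff by blast
  next
    fix U f assume "admissible D U f \<and> semisimple_associative D U (potential D f)"
    then show "let U' = {x\<in>U. R_dom D (Ymat D x (hess f x))} in open U' \<and> U \<subseteq> closure U'"
      unfolding Let_def using simple_eigenvalues_dense[of U f] by blast
  next
    fix W y assume pf: "pfaff_problem D W y"
    show "\<forall>w\<in>W. \<exists>W' f. open W' \<and> w \<in> W' \<and> W' \<subseteq> W \<and> admissible D (drop0 -` W') f \<and>
           semisimple_associative D (drop0 -` W') (potential D f) \<and> (\<forall>x\<in>drop0 -` W'. y (drop0 x) = hess f x)"
      by (rule ballI) (rule pfaff_potential[OF pf])
  next
    fix W f f' assume "connected W \<and> admissible D (drop0 -` W) f \<and> admissible D (drop0 -` W) f' \<and>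
        (\<forall>x\<in>drop0 -` W. hess f x = hess f' x)"
    then show "\<exists>P. x0_quadratic P \<and> (\<forall>x\<in>drop0 -` W. f x = f' x + P x)"
      using potential_unique[of W f f'] by blast
  next
    fix W y assume "pfaff_problem D W y \<and> W \<noteq> {}"
    then show "(\<forall>w\<in>W. constraint_with_cubic_term D w (y w)) \<longleftrightarrow> (\<forall>a b c. g3 D (Some a) (Some b) (Some c) = 0)"
      using cubic_term_iff by blast
  qed
qed

end
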